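(* Let $\Omega$ be a bounded domain in $\mathbb{R}^n$ with analytic boundary and let $\omega\subset\Omega$ be a measurable set with positive Lebesgue measure. Let $f$ be an analytic function in $\Omega$ satisfying $$|\partial_x^\alpha f(x)|\le M|\alpha|!\,\rho^{-|\alpha|},\quad\text{for }\alpha\in\mathbb{N}^n\text{ and }x\in\Omega,$$ for some $M>0$ and $0<\rho\le1$. Then there are constants $N=N(\Omega,\rho,|\omega|,n)$ and $\theta=\theta(\Omega,\rho,|\omega|)$, $0<\theta<1$, such that $$\|\partial_x^\alpha f\|_{L^\infty(\Omega)}\le|\alpha|!\,(\rho/N)^{-|\alpha|-1}M^{1-\frac{\theta}{2^{|\alpha|}}}\Big(\frac{1}{|\omega|}\int_\omega|f|\,dx\Big)^{\frac{\theta}{2^{|\alpha|}}},\quad\text{when }\alpha\in\mathbb{N}^n.$$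
   Context: $|\omega|$ is the Lebesgue measure of $\omega$, and $|\alpha|=\alpha_1+\dots+\alpha_n$ for $\alpha\in\mathbb{N}^n$ (with $0\in\mathbb{N}$). The constants $N$ and $\theta$ depend only on the listed quantities (not on $f$, $M$ or $\alpha$). "Analytic boundary" means $\partial\Omega$ is locally, near each of its points and after a rigid motion, the graph of a real analytic function with $\Omega$ lying on one side of the graph. *)

theory Defs
  imports "HOL-Analysis.Analysis" "HOL-Probability.Essential_Supremum"
begin

definition mi_size :: "('n::finite \<Rightarrow> nat) \<Rightarrow> nat"
  where "mi_size \<alpha> = (\<Sum>i\<in>UNIV. \<alpha> i)"

definition mi_power :: "real ^ 'n::finite \<Rightarrow> ('n \<Rightarrow> nat) \<Rightarrow> real"
  where "mi_power x \<alpha> = (\<Prod>i\<in>UNIV. (x $ i) ^ \<alpha> i)"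

definition partial_deriv :: "'n::finite \<Rightarrow> (real ^ 'n \<Rightarrow> real) \<Rightarrow> real ^ 'n \<Rightarrow> real"
  where "partial_deriv i f x = deriv (\<lambda>t. f (x + t *\<^sub>R axis i 1)) 0"

(* The index type carries no order, so the coordinates are put in an arbitrary but fixed order.
   For analytic f the partial derivatives commute and the choice is immaterial. *)
definition coord_list :: "'n::finite list"
  where "coord_list = (SOME is. distinct is \<and> set is = UNIV)"

definition mi_deriv :: "('n::finite \<Rightarrow> nat) \<Rightarrow> (real ^ 'n \<Rightarrow> real) \<Rightarrow> real ^ 'n \<Rightarrow> real"
  where "mi_deriv \<alpha> f = foldr (\<lambda>i g. (partial_deriv i ^^ \<alpha> i) g) coord_list f"

definition real_analytic_on :: "(real ^ 'n::finite \<Rightarrow> real) \<Rightarrow> (real ^ 'n) set \<Rightarrow> bool"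
  where "real_analytic_on f S \<longleftrightarrow>
    (\<forall>a\<in>S. \<exists>c. \<exists>r>0. \<forall>x\<in>ball a r. ((\<lambda>\<alpha>. c \<alpha> * mi_power (x - a) \<alpha>) has_sum f x) UNIV)"

definition rigid_motion :: "(real ^ 'n::finite \<Rightarrow> real ^ 'n) \<Rightarrow> bool"
  where "rigid_motion T \<longleftrightarrow> (\<exists>A b. orthogonal_transformation A \<and> T = (\<lambda>x. A x + b))"

(* A function of the n - 1 coordinates other than the k-th one is encoded as a function \<phi> on
   the whole space that does not depend on the k-th coordinate; analyticity means the same for both.
   Rigid motions include reflections, so "above the graph" covers either side of it. *)
definition analytic_boundary :: "(real ^ 'n::finite) set \<Rightarrow> bool"
  where "analytic_boundary \<Omega> \<longleftrightarrow>
    (\<forall>p\<in>frontier \<Omega>. \<exists>T U k \<phi>.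
       rigid_motion T \<and> open U \<and> T p \<in> U \<and>
       (\<forall>y s. \<phi> (y + s *\<^sub>R axis k 1) = \<phi> y) \<and> real_analytic_on \<phi> U \<and>
       U \<inter> frontier (T ` \<Omega>) = {y \<in> U. y $ k = \<phi> y} \<and>
       U \<inter> T ` \<Omega> = {y \<in> U. y $ k > \<phi> y})"

end

theory Submission
  imports Defs "HOL-Computational_Algebra.Polynomial"
begin

text \<open>
  Everything is reduced to lines parallel to the coordinate axes, along which the hypothesis bounds the
  \<open>k\<close>-th derivative by \<open>M k! \<rho>\<^sup>-\<^sup>k\<close>. If a function on an interval of length at most \<open>\<rho>/2\<close> is
  at most \<open>M \<delta>\<close> on a set of measure \<open>\<mu>\<close>, Lagrange interpolation at \<open>k\<close> well spaced nodes of that set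
  bounds it on the whole interval by \<open>M (B\<^sup>k \<delta> + 2\<^sup>-\<^sup>k)\<close>; optimising \<open>k\<close> gives \<open>M C \<delta>\<^sup>\<theta>\<close>. Treating one
  coordinate after the other, Tonelli's theorem carries this from a subset of positive measure to a
  cube. Connectedness spreads it over compact subsets of \<open>\<Omega>\<close>. At a boundary point some coordinate
  direction is transversal to the boundary, hence by compactness each point of \<open>\<Omega>\<close> is the vertex of a cone of
  fixed size in \<open>\<Omega>\<close> around some \<open>\<plusminus>e\<^sub>j\<close>, and one further interval reaches all of \<open>\<Omega>\<close>.
  A finite cover of a large compact subset of \<open>\<Omega>\<close> makes the constants depend on \<open>\<omega>\<close> through its measure
  only, and Chebyshev's inequality turns the mean of \<open>|f|\<close> into a pointwise bound on half of \<open>\<omega>\<close>. The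
  derivatives follow by induction on \<open>|\<alpha>|\<close> from \<open>|\<partial>\<^sub>i g| \<le> 2G/(\<kappa>s) + 2sB\<close>, where \<open>G\<close> bounds \<open>g\<close> and \<open>B\<close> its
  second derivatives; each such step halves the exponent.
\<close>

section \<open>Power series and partial derivatives\<close>

text \<open>The hypothesis loses nothing along coordinate axes: the multi-index k e_i has size k, so
  the k-th derivative along e_i is at most M k! \<rho>^(-k). In an oblique direction the mixed terms
  would shrink \<rho>. Hence only axis-parallel segments are used, and the cones at the boundary
  open around some \<plusminus>e_j instead of around the normal. Segments of length at most \<rho>/2
  make the interpolation remainder geometric.

  The obstacle is uniformity: the constants may see \<omega> only through its measure. There is no
  compactness argument over all such sets, so the estimate on a cube is proved for all subsets of a
  given measure at once, and the cubes are fixed before \<omega>. Finitely many cubes inside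
  \<Omega> never reach the boundary, which is why a separate last segment is needed.

  Smallness is always measured relative to M. The inequalities are then homogeneous in f, and
  chaining them multiplies the exponents.\<close>

definition power_expansion ::
    "(('n::finite \<Rightarrow> nat) \<Rightarrow> real) \<Rightarrow> (real ^ 'n \<Rightarrow> real) \<Rightarrow> real ^ 'n \<Rightarrow> real \<Rightarrow> bool"
  where "power_expansion c f a r \<longleftrightarrow>
    (\<forall>x\<in>ball a r. ((\<lambda>\<alpha>. c \<alpha> * mi_power (x - a) \<alpha>) has_sum f x) UNIV)"

lemma real_analytic_on_iff_power_expansion:
  "real_analytic_on f S \<longleftrightarrow> (\<forall>a\<in>S. \<exists>c. \<exists>r>0. power_expansion c f a r)"
  by (simp add: real_analytic_on_def power_expansion_def)

text \<open>Differentiation in coordinate \<open>i\<close>, carried out on the coefficients of a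
  power series. There the operators visibly commute, which stands in for the symmetry of mixed
  partial derivatives.\<close>

definition coeff_deriv :: "'n \<Rightarrow> (('n::finite \<Rightarrow> nat) \<Rightarrow> real) \<Rightarrow> ('n \<Rightarrow> nat) \<Rightarrow> real"
  where "coeff_deriv i c = (\<lambda>\<alpha>. real (Suc (\<alpha> i)) * c (\<alpha>(i := Suc (\<alpha> i))))"

lemma coeff_deriv_commute: "coeff_deriv i (coeff_deriv j c) = coeff_deriv j (coeff_deriv i c)"
  by (cases "i = j") (auto simp: coeff_deriv_def fun_upd_twist intro!: ext)

lemma mi_power_split:
  "mi_power x \<alpha> = (x $ i) ^ \<alpha> i * (\<Prod>j\<in>UNIV - {i}. (x $ j) ^ \<alpha> j)"
  unfolding mi_power_def by (subst prod.remove[of _ i]) auto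

lemma abs_mi_power: "\<bar>mi_power x \<alpha>\<bar> = (\<Prod>j\<in>UNIV. \<bar>x $ j\<bar> ^ \<alpha> j)"
  by (simp add: mi_power_def abs_prod power_abs)

lemma abs_mi_power_mono:
  assumes "\<And>j. \<bar>x $ j\<bar> \<le> \<bar>y $ j\<bar>"
  shows "\<bar>mi_power x \<alpha>\<bar> \<le> \<bar>mi_power y \<alpha>\<bar>"
  unfolding abs_mi_power by (intro prod_mono conjI power_mono assms) auto

lemma power_expansion_abs_summable:
  assumes "power_expansion c f a r" and "norm v < r"
  shows "(\<lambda>\<alpha>. norm (c \<alpha> * mi_power v \<alpha>)) summable_on UNIV"
proof -
  have "a + v \<in> ball a r" using assms(2) by (simp add: dist_norm)
  with assms(1) have "((\<lambda>\<alpha>. c \<alpha> * mi_power v \<alpha>) has_sum f (a + v)) UNIV"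
    unfolding power_expansion_def by fastforce
  then have "(\<lambda>\<alpha>. c \<alpha> * mi_power v \<alpha>) summable_on UNIV"
    by (auto simp: summable_on_def)
  then show ?thesis using summable_on_iff_abs_summable_on_real by fast
qed

text \<open>The binomial expansion of \<open>(u + \<eta>) ^ k\<close> contains
  \<open>k * \<eta> * u ^ (k - 1)\<close>. A differentiated monomial is thus dominated by the
  monomial itself at a slightly larger point.\<close>

lemma power_step_bound:
  fixes u \<eta> :: real
  assumes "0 \<le> u" and "0 < \<eta>"
  shows "real k * u ^ (k - 1) \<le> (1 / \<eta>) * (u + \<eta>) ^ k"
proof (cases k)
  case (Suc l)
  have "(u + \<eta>) ^ Suc l \<ge> u ^ Suc l + real (Suc l) * \<eta> * u ^ l"
  proof (induction l)
    case (Suc l)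
    have "(u + \<eta>) ^ Suc (Suc l) \<ge> (u + \<eta>) * (u ^ Suc l + real (Suc l) * \<eta> * u ^ l)"
      using Suc mult_left_mono[OF Suc, of "u + \<eta>"] assms by simp
    moreover have "(u + \<eta>) * (u ^ Suc l + real (Suc l) * \<eta> * u ^ l)
        = u ^ Suc (Suc l) + real (Suc (Suc l)) * \<eta> * u ^ Suc l + real (Suc l) * \<eta>\<^sup>2 * u ^ l"
      by (simp add: algebra_simps power2_eq_square)
    moreover have "real (Suc l) * \<eta>\<^sup>2 * u ^ l \<ge> 0" using assms by simp
    ultimately show ?case by linarith
  qed (use assms in simp)
  then have "real (Suc l) * \<eta> * u ^ l \<le> (u + \<eta>) ^ Suc l"
    using assms zero_le_power[OF assms(1), of "Suc l"] by linarith
  then show ?thesis using Suc assms by (simp add: field_simps)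
qed (use assms in simp)

lemma norm_axis_real: "norm (axis i x) = \<bar>x :: real\<bar>"
proof -
  have "axis i x = x *\<^sub>R axis i 1" by (simp add: vec_eq_iff axis_def)
  then show ?thesis by simp
qed

lemma bij_multi_index_enum: "bij (from_nat_into (UNIV :: ('n::finite \<Rightarrow> nat) set))"
proof -
  have "infinite (UNIV :: ('n \<Rightarrow> nat) set)"
  proof
    assume "finite (UNIV :: ('n \<Rightarrow> nat) set)"
    then have "finite (range (\<lambda>k::nat. (\<lambda>_::'n. k)))" by (rule rev_finite_subset) auto
    moreover have "inj (\<lambda>k::nat. (\<lambda>_::'n. k))" by (auto simp: inj_def fun_eq_iff)
    ultimately show False using finite_imageD infinite_UNIV_nat by blast
  qed
  then show ?thesis by (intro bij_betw_from_nat_into) auto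
qed

text \<open>Termwise differentiation along a line through \<open>x\<close>. The Weierstrass test
  applies with the terms of the series at one larger displacement \<open>v\<close> as majorant, up
  to the factor \<open>1 / \<eta>\<close>; an enumeration of the multi-indices turns the unordered
  sum into a series.\<close>

lemma power_expansion_has_derivative:
  fixes f :: "real ^ 'n::finite \<Rightarrow> real"
  assumes ex: "power_expansion c f a r" and x: "x \<in> ball a r"
  obtains d where "((\<lambda>t. f (x + t *\<^sub>R axis i 1)) has_real_derivative d) (at 0)"
    and "((\<lambda>\<alpha>. coeff_deriv i c \<alpha> * mi_power (x - a) \<alpha>) has_sum d) UNIV"
proof -
  define y where "y = x - a"
  have ny: "norm y < r" using x by (simp add: y_def dist_norm norm_minus_commute)
  \<comment> \<open>A third of the distance to the sphere: one \<open>\<eta>\<close> is the range of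
    \<open>t\<close>, the second is spent on \<open>power_step_bound\<close>, and the third keeps
    \<open>v\<close> strictly inside the ball.\<close>
  define \<eta> where "\<eta> = (r - norm y) / 3"
  have \<eta>: "\<eta> > 0" "norm y + 2 * \<eta> < r" using ny by (auto simp: \<eta>_def field_simps)
  define v :: "real ^ 'n" where "v = (\<chi> j. \<bar>y $ j\<bar>) + axis i (2 * \<eta>)"
  have "norm (\<chi> j. \<bar>y $ j\<bar>) = norm y" by (simp add: norm_vec_def)
  then have "norm v \<le> norm y + 2 * \<eta>"
    unfolding v_def using norm_triangle_ineq[of "\<chi> j. \<bar>y $ j\<bar>" "axis i (2 * \<eta>)"] \<eta>
    by (simp add: norm_axis_real)
  then have nv: "norm v < r" using \<eta> by simp
  define e where "e = from_nat_into (UNIV :: ('n \<Rightarrow> nat) set)"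
  have be: "bij e" unfolding e_def by (rule bij_multi_index_enum)
  define Q where "Q \<alpha> = (\<Prod>j\<in>UNIV - {i}. (y $ j) ^ \<alpha> j)" for \<alpha>
  have mp: "mi_power (y + t *\<^sub>R axis i 1) \<alpha> = (y $ i + t) ^ \<alpha> i * Q \<alpha>" for t \<alpha>
    unfolding mi_power_split[of _ _ i] Q_def
    by (auto simp: axis_def intro!: prod.cong)
  define D where "D \<alpha> t = c \<alpha> * Q \<alpha> * (real (\<alpha> i) * (y $ i + t) ^ (\<alpha> i - 1))" for \<alpha> t
  have absv: "\<bar>mi_power v \<alpha>\<bar> = (\<bar>y $ i\<bar> + 2 * \<eta>) ^ \<alpha> i * \<bar>Q \<alpha>\<bar>" for \<alpha>
    unfolding mi_power_split[of _ _ i] Q_def abs_mult abs_prod power_abs v_def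
    using \<eta> by (auto simp: axis_def intro!: prod.cong)
  have Dbound: "norm (D \<alpha> t) \<le> (1 / \<eta>) * norm (c \<alpha> * mi_power v \<alpha>)" if "t \<in> {-\<eta>..\<eta>}" for \<alpha> t
  proof -
    have "real (\<alpha> i) * \<bar>y $ i + t\<bar> ^ (\<alpha> i - 1) \<le> real (\<alpha> i) * (\<bar>y $ i\<bar> + \<eta>) ^ (\<alpha> i - 1)"
      using that by (intro mult_left_mono power_mono) auto
    also have "\<dots> \<le> (1 / \<eta>) * ((\<bar>y $ i\<bar> + \<eta>) + \<eta>) ^ \<alpha> i"
      using \<eta> by (intro power_step_bound) auto
    finally have "real (\<alpha> i) * \<bar>y $ i + t\<bar> ^ (\<alpha> i - 1) \<le> (1 / \<eta>) * (\<bar>y $ i\<bar> + 2 * \<eta>) ^ \<alpha> i"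
      by (simp add: add_ac)
    then have "\<bar>c \<alpha> * Q \<alpha>\<bar> * (real (\<alpha> i) * \<bar>y $ i + t\<bar> ^ (\<alpha> i - 1))
        \<le> \<bar>c \<alpha> * Q \<alpha>\<bar> * ((1 / \<eta>) * (\<bar>y $ i\<bar> + 2 * \<eta>) ^ \<alpha> i)"
      by (intro mult_left_mono) auto
    then show ?thesis
      unfolding D_def by (simp add: abs_mult power_abs absv mult_ac)
  qed
  have abss: "(\<lambda>\<alpha>. norm (c \<alpha> * mi_power v \<alpha>)) summable_on UNIV"
    by (rule power_expansion_abs_summable[OF ex nv])
  then have abss': "(\<lambda>\<alpha>. (1 / \<eta>) * norm (c \<alpha> * mi_power v \<alpha>)) summable_on UNIV"
    by (rule summable_on_cmult_right)
  then have "(\<lambda>k. (1 / \<eta>) * norm (c (e k) * mi_power v (e k))) summable_on UNIV"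
    using summable_on_reindex_bij_betw[OF be] by fast
  then have sume: "summable (\<lambda>k. (1 / \<eta>) * norm (c (e k) * mi_power v (e k)))"
    by (rule summable_on_imp_summable)
  have hs: "((\<lambda>\<alpha>. c \<alpha> * mi_power (y + t *\<^sub>R axis i 1) \<alpha>) has_sum f (x + t *\<^sub>R axis i 1)) UNIV"
    if "t \<in> {-\<eta>..\<eta>}" for t
  proof -
    have "norm (y + t *\<^sub>R axis i 1) \<le> norm y + \<bar>t\<bar>"
      using norm_triangle_ineq[of y "t *\<^sub>R axis i 1"] by (simp add: norm_axis_real)
    then have "norm (y + t *\<^sub>R axis i 1) < r" using that \<eta> by auto
    then have "x + t *\<^sub>R axis i 1 \<in> ball a r"
      by (simp add: y_def dist_norm norm_minus_commute algebra_simps)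
    moreover have "x + t *\<^sub>R axis i 1 - a = y + t *\<^sub>R axis i 1" by (simp add: y_def)
    ultimately show ?thesis using ex unfolding power_expansion_def by metis
  qed
  have hse: "(\<lambda>k. c (e k) * mi_power (y + t *\<^sub>R axis i 1) (e k)) sums f (x + t *\<^sub>R axis i 1)"
    if "t \<in> {-\<eta>..\<eta>}" for t
    using hs[OF that] has_sum_reindex_bij_betw[OF be, of "\<lambda>\<alpha>. c \<alpha> * mi_power (y + t *\<^sub>R axis i 1) \<alpha>"]
    by (intro has_sum_imp_sums) fast
  have "((\<lambda>t. \<Sum>k. c (e k) * mi_power (y + t *\<^sub>R axis i 1) (e k)) has_field_derivative
      (\<Sum>k. D (e k) 0)) (at 0)"
  proof (rule has_field_derivative_series'(2)[where S = "{-\<eta>..\<eta>}" and x0 = 0])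
    show "((\<lambda>t. c (e k) * mi_power (y + t *\<^sub>R axis i 1) (e k)) has_field_derivative D (e k) t)
        (at t within {-\<eta>..\<eta>})" for k t
      unfolding mp D_def by (auto intro!: derivative_eq_intros)
    show "uniformly_convergent_on {-\<eta>..\<eta>} (\<lambda>k t. \<Sum>l<k. D (e l) t)"
      by (rule Weierstrass_m_test'[OF _ sume]) (use Dbound in auto)
    show "summable (\<lambda>k. c (e k) * mi_power (y + 0 *\<^sub>R axis i 1) (e k))"
      using hse[of 0] \<eta> by (auto simp: sums_iff)
  qed (use \<eta> in auto)
  then have "((\<lambda>t. f (x + t *\<^sub>R axis i 1)) has_field_derivative (\<Sum>k. D (e k) 0)) (at 0)"
  proof (rule DERIV_cong_ev[THEN iffD1, rotated 3])
    show "\<forall>\<^sub>F t in nhds 0. (\<Sum>k. c (e k) * mi_power (y + t *\<^sub>R axis i 1) (e k)) = f (x + t *\<^sub>R axis i 1)"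
      using eventually_nhds_in_open[of "{-\<eta><..<\<eta>}" 0] \<eta>
      by (auto elim!: eventually_mono simp: sums_unique[OF hse, symmetric])
  qed auto
  moreover have "((\<lambda>\<alpha>. coeff_deriv i c \<alpha> * mi_power (x - a) \<alpha>) has_sum (\<Sum>k. D (e k) 0)) UNIV"
  proof -
    have "(\<lambda>\<alpha>. norm (D \<alpha> 0)) summable_on UNIV"
      using Dbound[of 0] \<eta> by (intro summable_on_comparison_test[OF abss']) auto
    then have "(\<lambda>\<alpha>. D \<alpha> 0) summable_on UNIV" by (rule abs_summable_summable)
    then obtain s where s: "((\<lambda>\<alpha>. D \<alpha> 0) has_sum s) UNIV" by (auto simp: summable_on_def)
    then have "((\<lambda>k. D (e k) 0) has_sum s) UNIV"
      using has_sum_reindex_bij_betw[OF be, of "\<lambda>\<alpha>. D \<alpha> 0"] by fast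
    then have "(\<Sum>k. D (e k) 0) = s" using has_sum_imp_sums sums_unique by metis
    \<comment> \<open>Terms with \<open>\<alpha> i = 0\<close> vanish after differentiation.
      Dropping them makes raising the i-th index a bijection onto the remaining
      multi-indices.\<close>
    moreover have "((\<lambda>\<alpha>. D \<alpha> 0) has_sum s) {\<alpha>. \<alpha> i \<noteq> 0}"
      using s by (rule has_sum_cong_neutral[THEN iffD1, rotated 3]) (auto simp: D_def)
    moreover have "bij_betw (\<lambda>\<alpha>. \<alpha>(i := Suc (\<alpha> i))) UNIV {\<alpha>. \<alpha> i \<noteq> 0}"
      by (rule bij_betwI[where g = "\<lambda>\<alpha>. \<alpha>(i := \<alpha> i - 1)"]) (auto simp: fun_eq_iff)
    ultimately have "((\<lambda>\<alpha>. D (\<alpha>(i := Suc (\<alpha> i))) 0) has_sum (\<Sum>k. D (e k) 0)) UNIV"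
      using has_sum_reindex_bij_betw by fast
    moreover have "D (\<alpha>(i := Suc (\<alpha> i))) 0 = coeff_deriv i c \<alpha> * mi_power (x - a) \<alpha>" for \<alpha>
    proof -
      have "Q (\<alpha>(i := Suc (\<alpha> i))) = Q \<alpha>" by (auto simp: Q_def intro!: prod.cong)
      then show ?thesis using mp[of 0 \<alpha>] by (simp add: D_def coeff_deriv_def y_def)
    qed
    ultimately show ?thesis by simp
  qed
  ultimately show ?thesis using that by blast
qed

lemma power_expansion_partial_deriv:
  assumes "power_expansion c f a r"
  shows "power_expansion (coeff_deriv i c) (partial_deriv i f) a r"
  unfolding power_expansion_def
proof
  fix x assume "x \<in> ball a r"
  from power_expansion_has_derivative[OF assms this, of i] obtain d
    where "((\<lambda>t. f (x + t *\<^sub>R axis i 1)) has_real_derivative d) (at 0)"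
      "((\<lambda>\<alpha>. coeff_deriv i c \<alpha> * mi_power (x - a) \<alpha>) has_sum d) UNIV" .
  then show "((\<lambda>\<alpha>. coeff_deriv i c \<alpha> * mi_power (x - a) \<alpha>) has_sum partial_deriv i f x) UNIV"
    by (simp add: partial_deriv_def DERIV_imp_deriv)
qed

lemma power_expansion_unique:
  assumes "power_expansion c f a r" and "power_expansion c g a r" and "x \<in> ball a r"
  shows "f x = g x"
  using assms unfolding power_expansion_def by (meson has_sum_unique)

lemma real_analytic_on_partial_deriv:
  assumes "real_analytic_on f S"
  shows "real_analytic_on (partial_deriv i f) S"
  using assms power_expansion_partial_deriv
  unfolding real_analytic_on_iff_power_expansion by blast

lemma real_analytic_on_has_partial_deriv:
  assumes "real_analytic_on f S" and "x \<in> S"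
  shows "((\<lambda>t. f (x + t *\<^sub>R axis i 1)) has_real_derivative partial_deriv i f x) (at 0)"
proof -
  obtain c r where "r > 0" and ex: "power_expansion c f x r"
    using assms unfolding real_analytic_on_iff_power_expansion by blast
  then have "x \<in> ball x r" by simp
  from power_expansion_has_derivative[OF ex this, of i] obtain d where
    "((\<lambda>t. f (x + t *\<^sub>R axis i 1)) has_real_derivative d) (at 0)" .
  then show ?thesis by (simp add: partial_deriv_def DERIV_imp_deriv)
qed

lemma real_analytic_on_has_partial_deriv_line:
  assumes "real_analytic_on f S" and "x + t *\<^sub>R axis i 1 \<in> S"
  shows "((\<lambda>t. f (x + t *\<^sub>R axis i 1)) has_real_derivative partial_deriv i f (x + t *\<^sub>R axis i 1)) (at t)"
proof -
  have "((\<lambda>s. f (x + t *\<^sub>R axis i 1 + s *\<^sub>R axis i 1)) has_real_derivative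
      partial_deriv i f (x + t *\<^sub>R axis i 1)) (at 0)"
    using real_analytic_on_has_partial_deriv[OF assms] .
  also have "(\<lambda>s. f (x + t *\<^sub>R axis i 1 + s *\<^sub>R axis i 1)) = (\<lambda>s. f (x + (s + t) *\<^sub>R axis i 1))"
    by (simp add: scaleR_add_left add_ac)
  finally show ?thesis
    using DERIV_shift[of "\<lambda>t. f (x + t *\<^sub>R axis i 1)" _ 0 t] by simp
qed

lemma real_analytic_on_continuous_on:
  fixes f :: "real ^ 'n::finite \<Rightarrow> real"
  assumes "real_analytic_on f S"
  shows "continuous_on S f"
proof (rule continuous_at_imp_continuous_on, rule ballI)
  fix a assume "a \<in> S"
  then obtain c r where r: "r > 0" and ex: "power_expansion c f a r"
    using assms unfolding real_analytic_on_iff_power_expansion by blast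
  \<comment> \<open>The vector \<open>v\<close> with all entries \<open>w\<close> has l1-norm
    \<open>r / 2\<close>, so the series converges absolutely there, while on \<open>ball a w\<close>
    every coordinate of \<open>x - a\<close> is at most \<open>w\<close>. Hence \<open>v\<close>
    gives a majorant uniform in \<open>x\<close>.\<close>
  define w where "w = r / (2 * real CARD('n))"
  define v :: "real ^ 'n" where "v = (\<chi> j. w)"
  have w: "w > 0" using r by (simp add: w_def)
  have "norm v \<le> (\<Sum>j\<in>UNIV. \<bar>v $ j\<bar>)" by (rule norm_le_l1_cart)
  also have "\<dots> = r / 2" using r by (simp add: v_def w_def)
  finally have nv: "norm v < r" using r by simp
  have wr: "w < r" using component_le_norm_cart[of v undefined] nv w by (simp add: v_def)
  have "uniform_limit (ball a w) (\<lambda>X x. \<Sum>\<alpha>\<in>X. c \<alpha> * mi_power (x - a) \<alpha>)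
      (\<lambda>x. infsum (\<lambda>\<alpha>. c \<alpha> * mi_power (x - a) \<alpha>) UNIV) (finite_subsets_at_top UNIV)"
  proof (rule Weierstrass_m_test_general)
    show "norm (c \<alpha> * mi_power (x - a) \<alpha>) \<le> norm (c \<alpha> * mi_power v \<alpha>)" if "x \<in> ball a w" for \<alpha> x
    proof -
      have "\<bar>(x - a) $ j\<bar> \<le> \<bar>v $ j\<bar>" for j
        using component_le_norm_cart[of "x - a" j] that w
        by (simp add: v_def dist_norm norm_minus_commute)
      from abs_mi_power_mono[OF this] show ?thesis by (simp add: abs_mult mult_left_mono)
    qed
    show "(\<lambda>\<alpha>. norm (c \<alpha> * mi_power v \<alpha>)) summable_on UNIV"
      by (rule power_expansion_abs_summable[OF ex nv])
  qed
  then have "continuous_on (ball a w) (\<lambda>x. infsum (\<lambda>\<alpha>. c \<alpha> * mi_power (x - a) \<alpha>) UNIV)"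
    by (rule uniform_limit_theorem[rotated])
       (auto intro!: always_eventually continuous_intros simp: mi_power_def)
  moreover have "infsum (\<lambda>\<alpha>. c \<alpha> * mi_power (x - a) \<alpha>) UNIV = f x" if "x \<in> ball a w" for x
    using ex that wr unfolding power_expansion_def by (intro infsumI) auto
  ultimately have "continuous_on (ball a w) f" 
    by (subst (asm) continuous_on_cong[OF refl]) auto
  then show "isCont f a" using w by (simp add: continuous_on_eq_continuous_at)
qed

section \<open>Iterated partial derivatives and their independence of the order\<close>

lemma power_expansion_partial_deriv_funpow:
  assumes "power_expansion c f a r"
  shows "power_expansion ((coeff_deriv i ^^ k) c) ((partial_deriv i ^^ k) f) a r"
  using assms by (induction k) (auto intro: power_expansion_partial_deriv)

definition coeff_mi_deriv_list :: "'n::finite list \<Rightarrow> ('n \<Rightarrow> nat) \<Rightarrow> (('n \<Rightarrow> nat) \<Rightarrow> real) \<Rightarrow> ('n \<Rightarrow> nat) \<Rightarrow> real"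
  where "coeff_mi_deriv_list is \<alpha> c = foldr (\<lambda>i g. (coeff_deriv i ^^ \<alpha> i) g) is c"

lemma power_expansion_mi_deriv:
  assumes "power_expansion c f a r"
  shows "power_expansion (coeff_mi_deriv_list coord_list \<alpha> c) (mi_deriv \<alpha> f) a r"
proof -
  have "power_expansion (coeff_mi_deriv_list is \<alpha> c)
      (foldr (\<lambda>i g. (partial_deriv i ^^ \<alpha> i) g) is f) a r" for "is"
    unfolding coeff_mi_deriv_list_def
    by (induction "is") (auto simp: assms intro: power_expansion_partial_deriv_funpow)
  then show ?thesis by (simp add: mi_deriv_def)
qed

lemma coeff_deriv_funpow_commute:
  "(coeff_deriv i ^^ k) (coeff_deriv j c) = coeff_deriv j ((coeff_deriv i ^^ k) c)"
  by (induction k) (auto simp: coeff_deriv_commute)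

text \<open>An extra derivative in direction \<open>i\<close> lands somewhere inside the
  composition. On coefficients it can be commuted to the front; distinctness ensures that it is
  counted once.\<close>

lemma coeff_mi_deriv_list_Suc:
  assumes "distinct is"
  shows "coeff_mi_deriv_list is (\<alpha>(i := Suc (\<alpha> i))) c =
    (if i \<in> set is then coeff_deriv i (coeff_mi_deriv_list is \<alpha> c) else coeff_mi_deriv_list is \<alpha> c)"
  using assms
proof (induction "is")
  case (Cons j js)
  then show ?case
    by (cases "j = i") (auto simp: coeff_mi_deriv_list_def coeff_deriv_funpow_commute)
qed (simp add: coeff_mi_deriv_list_def)

lemma coord_list: "distinct (coord_list :: 'n::finite list)" "set (coord_list :: 'n list) = UNIV"
proof -
  have "\<exists>is. distinct is \<and> set is = (UNIV :: 'n set)"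
    using finite_distinct_list[OF finite[of UNIV]] by blast
  from someI_ex[OF this]
  show "distinct (coord_list :: 'n::finite list)" "set (coord_list :: 'n list) = UNIV"
    unfolding coord_list_def by auto
qed

text \<open>Both sides have expansions with the same coefficients on one ball around
  \<open>x\<close>, hence agree there.\<close>

lemma mi_deriv_Suc:
  fixes f :: "real ^ 'n::finite \<Rightarrow> real"
  assumes "real_analytic_on f S" and "x \<in> S"
  shows "mi_deriv (\<alpha>(i := Suc (\<alpha> i))) f x = partial_deriv i (mi_deriv \<alpha> f) x"
proof -
  obtain c r where "r > 0" and ex: "power_expansion c f x r"
    using assms unfolding real_analytic_on_iff_power_expansion by blast
  then have x: "x \<in> ball x r" by simp
  have "power_expansion (coeff_deriv i (coeff_mi_deriv_list coord_list \<alpha> c))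
      (mi_deriv (\<alpha>(i := Suc (\<alpha> i))) f) x r"
    using power_expansion_mi_deriv[OF ex, of "\<alpha>(i := Suc (\<alpha> i))"]
      coeff_mi_deriv_list_Suc[OF coord_list(1), of \<alpha> i c]
    by (simp add: coord_list(2))
  then show ?thesis
    using power_expansion_partial_deriv[OF power_expansion_mi_deriv[OF ex]] x
    by (rule power_expansion_unique)
qed

lemma real_analytic_on_mi_deriv:
  assumes "real_analytic_on f S"
  shows "real_analytic_on (mi_deriv \<alpha> f) S"
  using assms power_expansion_mi_deriv unfolding real_analytic_on_iff_power_expansion by blast

lemma mi_deriv_0: "mi_deriv (\<lambda>_. 0) f = f"
proof -
  have "foldr (\<lambda>i g. (partial_deriv i ^^ (0::nat)) g) is f = f" for "is" by (induction "is") auto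
  then show ?thesis by (simp add: mi_deriv_def)
qed

lemma mi_deriv_has_partial_deriv_line:
  assumes "real_analytic_on f S" and "x + t *\<^sub>R axis i 1 \<in> S"
  shows "((\<lambda>t. mi_deriv \<alpha> f (x + t *\<^sub>R axis i 1)) has_real_derivative
    mi_deriv (\<alpha>(i := Suc (\<alpha> i))) f (x + t *\<^sub>R axis i 1)) (at t)"
  using real_analytic_on_has_partial_deriv_line[OF real_analytic_on_mi_deriv[OF assms(1)] assms(2)]
    mi_deriv_Suc[OF assms] by simp

lemma mi_size_Suc: "mi_size (\<alpha>(i := Suc (\<alpha> i))) = Suc (mi_size \<alpha>)"
  unfolding mi_size_def by (simp add: sum.remove[of UNIV i])


section \<open>Smallness on an interval\<close>

text \<open>Zeros are added in increasing order. The bound \<open>Z' \<subseteq> {a..<Max Z}\<close>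
  is carried along so that the Rolle point between the old maximum and the new zero differs from all
  earlier ones.\<close>

lemma Rolle_zeros:
  fixes g g' :: "real \<Rightarrow> real"
  assumes "\<And>t. t \<in> {a..b} \<Longrightarrow> (g has_real_derivative g' t) (at t)"
    and "finite Z" and "Z \<noteq> {}" and "Z \<subseteq> {a..b}" and "\<And>t. t \<in> Z \<Longrightarrow> g t = 0"
  shows "\<exists>Z'. finite Z' \<and> Suc (card Z') = card Z \<and> Z' \<subseteq> {a..<Max Z} \<and> (\<forall>t\<in>Z'. g' t = 0)"
  using assms(2-5)
proof (induction Z rule: finite_linorder_max_induct)
  case (insert z Z)
  show ?case
  proof (cases "Z = {}")
    case True
    then show ?thesis by (intro exI[of _ "{}"]) auto
  next
    case False
    with insert obtain Z' where Z': "finite Z'" "Suc (card Z') = card Z" "Z' \<subseteq> {a..<Max Z}"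
      "\<forall>t\<in>Z'. g' t = 0" by auto
    have M: "Max Z \<in> Z" "Max Z < z" using False insert by auto
    have sub: "{Max Z..z} \<subseteq> {a..b}" using insert.prems M by auto
    have "\<exists>w. Max Z < w \<and> w < z \<and> (g has_real_derivative 0) (at w)"
    proof (rule Rolle)
      show "g (Max Z) = g z" using insert.prems M by simp
      show "continuous_on {Max Z..z} g"
        using assms(1) sub by (intro DERIV_continuous_on) (blast intro: has_field_derivative_at_within)
      show "g differentiable (at w)" if "Max Z < w" "w < z" for w
        using assms(1)[of w] that sub
        by (auto simp: real_differentiable_def)
    qed (use M in auto)
    then obtain w where w: "Max Z < w" "w < z" "(g has_real_derivative 0) (at w)" by blast
    have wab: "w \<in> {a..b}" using w sub by auto
    then have "g' w = 0" using DERIV_unique[OF assms(1) w(3)] by auto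
    moreover have "Max (insert z Z) = z" using M insert False by (simp add: max_absorb1)
    moreover have "w \<notin> Z'" using w Z' by auto
    ultimately show ?thesis
      using Z' w wab insert.hyps by (intro exI[of _ "insert w Z'"]) (auto simp: subset_iff)
  qed
qed simp

lemma Rolle_iterated:
  fixes G :: "nat \<Rightarrow> real \<Rightarrow> real"
  assumes "\<And>m t. m < n \<Longrightarrow> t \<in> {a..b} \<Longrightarrow> (G m has_real_derivative G (Suc m) t) (at t)"
    and "finite Z" and "card Z = Suc n" and "Z \<subseteq> {a..b}" and "\<And>t. t \<in> Z \<Longrightarrow> G 0 t = 0"
  shows "\<exists>\<xi>\<in>{a..b}. G n \<xi> = 0"
  using assms
proof (induction n arbitrary: G Z)
  case 0
  then obtain z where "Z = {z}" by (auto simp: card_Suc_eq)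
  with 0 show ?case by auto
next
  case (Suc n)
  have "Z \<noteq> {}" using Suc.prems by auto
  then have "Max Z \<in> {a..b}" using Suc.prems Max_in by blast
  moreover obtain Z' where "finite Z'" "Suc (card Z') = card Z" "Z' \<subseteq> {a..<Max Z}"
      "\<forall>t\<in>Z'. G 1 t = 0"
    using Rolle_zeros[of a b "G 0" "G 1" Z] Suc.prems \<open>Z \<noteq> {}\<close> by auto
  ultimately have "\<exists>\<xi>\<in>{a..b}. (\<lambda>m. G (Suc m)) n \<xi> = 0"
    using Suc.prems by (intro Suc.IH[of _ Z']) (auto simp: subset_iff)
  then show ?case by simp
qed

lemma higher_pderiv_monic:
  fixes p :: "real poly"
  assumes "degree p = n" and "lead_coeff p = 1"
  shows "poly ((pderiv ^^ n) p) t = fact n"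
proof -
  have "degree ((pderiv ^^ n) p) = 0" using assms by (simp add: degree_higher_pderiv)
  then obtain c where c: "(pderiv ^^ n) p = [:c:]" by (rule degree_eq_zeroE)
  have "c = coeff ((pderiv ^^ n) p) 0" by (simp add: c)
  also have "\<dots> = fact n"
    using assms by (simp add: coeff_higher_pderiv pochhammer_fact)
  finally show ?thesis by (simp add: c)
qed

lemma higher_pderiv_eq_0:
  fixes p :: "real poly"
  assumes "degree p < n"
  shows "(pderiv ^^ n) p = 0"
  by (rule poly_eqI) (use assms in \<open>simp add: coeff_higher_pderiv coeff_eq_0\<close>)

text \<open>Subtract from the interpolation error a multiple of the node polynomial \<open>W\<close>
  chosen to make it vanish at \<open>x\<close> too. The result has one zero more than there are
  nodes, so its derivative of order \<open>card T\<close> vanishes somewhere; that derivative kills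
  \<open>P\<close> and turns \<open>W\<close> into a factorial.\<close>

lemma lagrange_remainder:
  fixes G :: "nat \<Rightarrow> real \<Rightarrow> real"
  assumes G: "\<And>m t. t \<in> {a..b} \<Longrightarrow> (G m has_real_derivative G (Suc m) t) (at t)"
    and T: "finite T" "T \<subseteq> {a..b}" "x \<in> {a..b}" "x \<notin> T"
  shows "\<exists>\<xi>\<in>{a..b}. G 0 x = (\<Sum>s\<in>T. G 0 s * (\<Prod>u\<in>T - {s}. (x - u) / (s - u)))
    + G (card T) \<xi> / fact (card T) * (\<Prod>u\<in>T. x - u)"
proof -
  define W where "W = (\<Prod>u\<in>T. [:- u, 1:])"
  define P where "P = (\<Sum>s\<in>T. smult (G 0 s / (\<Prod>u\<in>T - {s}. s - u)) (\<Prod>u\<in>T - {s}. [:- u, 1:]))"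
  have polyW: "poly W t = (\<Prod>u\<in>T. t - u)" for t by (simp add: W_def poly_prod)
  have degW: "degree W = card T" unfolding W_def by (simp add: degree_prod_eq_sum_degree)
  have lcW: "lead_coeff W = 1" by (simp add: W_def lead_coeff_prod)
  have W0: "poly W x \<noteq> 0" using T by (auto simp: polyW)
  have polyP: "poly P t = (\<Sum>s\<in>T. G 0 s * (\<Prod>u\<in>T - {s}. (t - u) / (s - u)))" for t
    by (simp add: P_def poly_sum poly_prod prod_dividef)
  have polyPs: "poly P s = G 0 s" if "s \<in> T" for s
  proof -
    have "poly P s = (\<Sum>r\<in>T. if r = s then G 0 s else 0)"
      unfolding polyP using T that
      by (intro sum.cong refl) (auto intro!: prod.neutral)
    then show ?thesis using T that by simp
  qed
  have dP: "(pderiv ^^ card T) P = 0"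
  proof (cases "T = {}")
    case False
    have "degree (smult (G 0 s / (\<Prod>u\<in>T - {s}. s - u)) (\<Prod>u\<in>T - {s}. [:- u, 1:])) \<le> card T - 1"
      if "s \<in> T" for s
      using degree_smult_le[of _ "\<Prod>u\<in>T - {s}. [:- u, 1:]"] that T(1)
      by (simp add: degree_prod_eq_sum_degree)
    then have "degree P \<le> card T - 1" unfolding P_def by (intro degree_sum_le T)
    moreover have "card T > 0" using False T by (simp add: card_gt_0_iff)
    ultimately show ?thesis by (intro higher_pderiv_eq_0) simp
  qed (simp add: P_def)
  define c where "c = (G 0 x - poly P x) / poly W x"
  define H where "H m t = G m t - poly ((pderiv ^^ m) P) t - c * poly ((pderiv ^^ m) W) t" for m t
  have "\<exists>\<xi>\<in>{a..b}. H (card T) \<xi> = 0"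
  proof (rule Rolle_iterated[where Z = "insert x T"])
    show "(H m has_real_derivative H (Suc m) t) (at t)" if "t \<in> {a..b}" for m t
      unfolding H_def using that by (auto intro!: derivative_eq_intros G poly_DERIV)
    show "H 0 t = 0" if "t \<in> insert x T" for t
      using that T W0 by (auto simp: H_def c_def polyPs polyW)
  qed (use T in auto)
  then obtain \<xi> where \<xi>: "\<xi> \<in> {a..b}" "H (card T) \<xi> = 0" by blast
  then have "G (card T) \<xi> = c * fact (card T)"
    using higher_pderiv_monic[OF degW] lcW by (simp add: H_def dP degW)
  then have "c = G (card T) \<xi> / fact (card T)" by (simp add: field_simps)
  moreover have "G 0 x = poly P x + c * poly W x" using W0 by (simp add: c_def)
  ultimately show ?thesis using \<xi>(1) unfolding polyP polyW by blast
qed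

text \<open>Greedy choice: take a point of \<open>E\<close> close to its infimum, discard what lies
  less than \<open>d\<close> to its right, and continue.\<close>

lemma spaced_points:
  fixes E :: "real set" and d :: real
  assumes "E \<in> sets borel" and "E \<subseteq> {a..b}" and "0 < d" and "real n * d < measure lborel E"
  shows "\<exists>t::nat \<Rightarrow> real. (\<forall>i\<le>n. t i \<in> E) \<and> (\<forall>i<n. t i + d \<le> t (Suc i))"
  using assms(1,2,4)
proof (induction n arbitrary: E)
  case 0
  then have "E \<noteq> {}" by auto
  then obtain x where "x \<in> E" by blast
  then show ?case by (intro exI[of _ "\<lambda>_. x"]) auto
next
  case (Suc n)
  have fm: "F \<in> fmeasurable lborel" if "F \<in> sets borel" "F \<subseteq> {a..b}" for F :: "real set"
    using that fmeasurableI2[of "{a..b}" lborel F] by (simp add: fmeasurable_compact)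
  \<comment> \<open>The surplus of measure. Choosing \<open>t0\<close> within \<open>\<eta>\<close>
    of the infimum removes less than \<open>d + \<eta>\<close>, so more than \<open>n * d\<close> is
    left for the remaining points.\<close>
  define \<eta> where "\<eta> = measure lborel E - real (Suc n) * d"
  have \<eta>: "\<eta> > 0" using Suc.prems by (simp add: \<eta>_def)
  have ne: "E \<noteq> {}" using Suc.prems assms(3) by (auto simp: mult_less_0_iff)
  have bd: "bdd_below E" using Suc.prems by (meson bdd_below_Icc bdd_below_mono)
  obtain t0 where t0: "t0 \<in> E" "t0 < Inf E + \<eta>"
    using cInf_lessD[OF ne, of "Inf E + \<eta>"] \<eta> by auto
  define E' where "E' = E \<inter> {t0 + d..}"
  have E': "E' \<in> sets borel" "E' \<subseteq> {a..b}" using Suc.prems by (auto simp: E'_def)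
  have "E \<subseteq> E' \<union> {Inf E..t0 + d}" using cInf_lower[OF _ bd] by (auto simp: E'_def)
  moreover have "{Inf E..t0 + d} \<in> fmeasurable lborel" by (simp add: fmeasurable_compact)
  ultimately have "measure lborel E \<le> measure lborel (E' \<union> {Inf E..t0 + d})"
    using Suc.prems fm E' by (intro measure_mono_fmeasurable) auto
  also have "\<dots> \<le> measure lborel E' + measure lborel {Inf E..t0 + d}"
    using E' by (intro measure_Un_le) auto
  also have "measure lborel {Inf E..t0 + d} = t0 + d - Inf E"
    using cInf_lower[OF t0(1) bd] assms(3) by simp
  finally have "real n * d < measure lborel E'" using t0 by (simp add: \<eta>_def algebra_simps)
  from Suc.IH[OF E' this] obtain t where t: "\<forall>i\<le>n. t i \<in> E'" "\<forall>i<n. t i + d \<le> t (Suc i)" by blast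
  show ?case
  proof (intro exI[of _ "\<lambda>i. case i of 0 \<Rightarrow> t0 | Suc j \<Rightarrow> t j"] conjI allI impI)
    fix i assume "i \<le> Suc n"
    then show "(case i of 0 \<Rightarrow> t0 | Suc j \<Rightarrow> t j) \<in> E"
      using t t0 by (cases i) (auto simp: E'_def)
  next
    fix i assume "i < Suc n"
    then show "(case i of 0 \<Rightarrow> t0 | Suc j \<Rightarrow> t j) + d \<le> (case Suc i of 0 \<Rightarrow> t0 | Suc j \<Rightarrow> t j)"
      using t by (cases i) (auto simp: E'_def)
  qed
qed

lemma spaced_points_dist:
  fixes t :: "nat \<Rightarrow> real"
  assumes "\<forall>i<n. t i + d \<le> t (Suc i)" and "i \<le> j" and "j \<le> n"
  shows "t i + real (j - i) * d \<le> t j"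
  using assms(2,3)
proof (induction j rule: dec_induct)
  case (step j)
  then have "t j + d \<le> t (Suc j)" using assms(1) by auto
  moreover have "real (Suc j - i) = real (j - i) + 1" using step by (simp add: of_nat_diff)
  ultimately show ?case using step by (simp add: algebra_simps)
qed simp

text \<open>The model case of equidistant nodes. Distances between nodes with spacing
  \<open>d\<close> are at least \<open>d\<close> times those of their indices, so the denominators
  of the Lagrange weights are compared with these factorials.\<close>

lemma prod_abs_diff:
  assumes "i \<le> (n::nat)"
  shows "(\<Prod>j\<in>{..n} - {i}. \<bar>real i - real j\<bar>) = fact i * fact (n - i)"
proof -
  have split: "{..n} - {i} = {..<i} \<union> {i<..n}" using assms by auto
  have "(\<Prod>j\<in>{..n} - {i}. \<bar>real i - real j\<bar>)
      = (\<Prod>j<i. \<bar>real i - real j\<bar>) * (\<Prod>j\<in>{i<..n}. \<bar>real i - real j\<bar>)"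
    unfolding split by (rule prod.union_disjoint) auto
  also have "(\<Prod>j<i. \<bar>real i - real j\<bar>) = (\<Prod>j\<in>{1..i}. real j)"
    by (rule prod.reindex_bij_witness[of _ "\<lambda>j. i - j" "\<lambda>j. i - j"]) auto
  also have "(\<Prod>j\<in>{i<..n}. \<bar>real i - real j\<bar>) = (\<Prod>j\<in>{1..n - i}. real j)"
    by (rule prod.reindex_bij_witness[of _ "\<lambda>j. j + i" "\<lambda>j. j - i"]) auto
  finally show ?thesis by (simp add: fact_prod)
qed

text \<open>A weak form of Stirling's formula: one term of the exponential series at
  \<open>k + 1\<close> is at most the whole sum. It makes the factor \<open>(k + 1) ^ k\<close>,
  caused by a spacing of order \<open>1 / (k + 1)\<close>, geometric.\<close>

lemma Suc_power_le_fact_exp: "real (Suc k) ^ k \<le> fact k * exp 1 ^ Suc k"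
proof -
  have "real (Suc k) ^ Suc k / fact (Suc k) \<le> exp (real (Suc k))"
  proof -
    have s: "(\<lambda>n. real (Suc k) ^ n /\<^sub>R fact n) sums exp (real (Suc k))" by (rule exp_converges)
    have "(\<Sum>n\<in>{Suc k}. real (Suc k) ^ n /\<^sub>R fact n) \<le> (\<Sum>n. real (Suc k) ^ n /\<^sub>R fact n)"
      using s by (intro sum_le_suminf) (auto simp: sums_iff)
    then show ?thesis using s by (simp add: sums_iff field_simps)
  qed
  also have "exp (real (Suc k)) = exp 1 ^ Suc k" using exp_of_nat_mult[of "Suc k" 1] by simp
  also have "real (Suc k) ^ Suc k / fact (Suc k) = real (Suc k) ^ k / fact k"
    by (simp del: of_nat_Suc add: fact_Suc)
  finally show ?thesis by (simp add: field_simps)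
qed

text \<open>Interpolation at \<open>k + 1\<close> points of \<open>E\<close>. The weights grow only
  geometrically because their factorials beat the shrinking spacing. The remainder decays
  geometrically because every node is within \<open>\<rho> / 2\<close> of \<open>x\<close>, against
  a factor \<open>1 / \<rho>\<close> per derivative.\<close>

lemma smallness_on_interval:
  fixes G :: "nat \<Rightarrow> real \<Rightarrow> real" and a b L \<mu> \<epsilon> \<rho> M x :: real
  assumes G: "\<And>m t. t \<in> {a..b} \<Longrightarrow> (G m has_real_derivative G (Suc m) t) (at t)"
    and Gb: "\<And>m t. t \<in> {a..b} \<Longrightarrow> \<bar>G m t\<bar> \<le> M * fact m * (1 / \<rho>) ^ m"
    and ab: "b - a \<le> \<rho> / 2" "b - a \<le> L" and \<rho>: "0 < \<rho>"
    and x: "x \<in> {a..b}"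
    and E: "E \<in> sets borel" "E \<subseteq> {a..b}" "\<mu> \<le> measure lborel E" and \<mu>: "0 < \<mu>"
    and small: "\<And>t. t \<in> E \<Longrightarrow> \<bar>G 0 t\<bar> \<le> \<epsilon>" and \<epsilon>: "0 \<le> \<epsilon>"
  shows "\<bar>G 0 x\<bar> \<le> (2 * exp 1 * L / \<mu>) ^ Suc k * \<epsilon> + M * (1 / 2) ^ Suc k"
proof -
  \<comment> \<open>\<open>k + 1\<close> nodes need only \<open>k\<close> gaps, so
    \<open>k * d\<close> stays strictly below \<open>\<mu>\<close>, as \<open>spaced_points\<close>
    demands.\<close>
  define d where "d = \<mu> / real (Suc k)"
  have d: "d > 0" using \<mu> by (simp add: d_def)
  have "measure lborel E \<le> measure lborel {a..b}"
    using E by (intro measure_mono_fmeasurable) (auto simp: fmeasurable_compact)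
  then have \<mu>L: "\<mu> \<le> L" using E x ab by simp
  have fmE: "E \<in> fmeasurable lborel"
    using E fmeasurableI2[of "{a..b}" lborel E] by (simp add: fmeasurable_compact)
  \<comment> \<open>The point \<open>x\<close> may lie in \<open>E\<close> but must not be a node;
    removing it leaves the measure unchanged.\<close>
  then have "measure lborel (E - {x}) = measure lborel E"
    by (intro measure_Diff_null_set) (auto simp: E intro: countable_imp_null_set_lborel)
  moreover have "real k * d < \<mu>" using \<mu> by (simp add: d_def field_simps)
  ultimately have "\<exists>t::nat \<Rightarrow> real. (\<forall>i\<le>k. t i \<in> E - {x}) \<and> (\<forall>i<k. t i + d \<le> t (Suc i))"
    using E d by (intro spaced_points[where a = a and b = b]) auto
  then obtain t where t: "\<forall>i\<le>k. t i \<in> E - {x}" "\<forall>i<k. t i + d \<le> t (Suc i)" by blast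
  have gap: "\<bar>t i - t j\<bar> \<ge> \<bar>real i - real j\<bar> * d" if "i \<le> k" "j \<le> k" for i j
  proof (cases "i \<le> j")
    case True
    then show ?thesis using spaced_points_dist[OF t(2) True that(2)] by (simp add: of_nat_diff)
  next
    case False
    then show ?thesis using spaced_points_dist[OF t(2), of j i] that by (simp add: of_nat_diff)
  qed
  have inj: "inj_on t {..k}"
  proof (rule inj_onI)
    fix i j assume ij: "i \<in> {..k}" "j \<in> {..k}" "t i = t j"
    then have "\<bar>real i - real j\<bar> * d \<le> 0" using gap[of i j] by simp
    then show "i = j" using d by (simp add: mult_le_0_iff)
  qed
  define T where "T = t ` {..k}"
  have T: "finite T" "T \<subseteq> {a..b}" "x \<notin> T" "card T = Suc k"
    using t E inj by (auto simp: T_def card_image)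
  from lagrange_remainder[of a b G T x, OF G T(1,2) x T(3)] obtain \<xi> where \<xi>: "\<xi> \<in> {a..b}"
    and eq: "G 0 x = (\<Sum>s\<in>T. G 0 s * (\<Prod>u\<in>T - {s}. (x - u) / (s - u)))
      + G (card T) \<xi> / fact (card T) * (\<Prod>u\<in>T. x - u)" by blast
  have xu: "\<bar>x - u\<bar> \<le> b - a" if "u \<in> T" for u
  proof -
    have "u \<in> {a..b}" using that T by blast
    then show ?thesis using x by auto
  qed
  have "\<bar>\<Sum>s\<in>T. G 0 s * (\<Prod>u\<in>T - {s}. (x - u) / (s - u))\<bar>
      \<le> (\<Sum>s\<in>T. \<bar>G 0 s\<bar> * (\<Prod>u\<in>T - {s}. \<bar>x - u\<bar> / \<bar>s - u\<bar>))"
    using sum_abs[of "\<lambda>s. G 0 s * (\<Prod>u\<in>T - {s}. (x - u) / (s - u))" T]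
    by (simp add: abs_mult abs_prod)
  also have "\<dots> = (\<Sum>i\<le>k. \<bar>G 0 (t i)\<bar> * (\<Prod>j\<in>{..k} - {i}. \<bar>x - t j\<bar> / \<bar>t i - t j\<bar>))"
  proof -
    have "(\<Prod>u\<in>T - {t i}. \<bar>x - u\<bar> / \<bar>t i - u\<bar>) = (\<Prod>j\<in>{..k} - {i}. \<bar>x - t j\<bar> / \<bar>t i - t j\<bar>)"
      if "i \<le> k" for i
    proof -
      have "T - {t i} = t ` ({..k} - {i})" using inj that by (auto simp: T_def inj_on_def)
      then show ?thesis using inj by (simp add: prod.reindex inj_on_diff)
    qed
    then show ?thesis unfolding T_def by (subst sum.reindex[OF inj]) simp
  qed
  also have "\<dots> \<le> (\<Sum>i\<le>k. \<epsilon> * ((L / d) ^ k / (fact i * fact (k - i))))"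
  proof (intro sum_mono mult_mono)
    fix i assume i: "i \<in> {..k}"
    show "\<bar>G 0 (t i)\<bar> \<le> \<epsilon>" using small t i by auto
    have "(\<Prod>j\<in>{..k} - {i}. \<bar>x - t j\<bar> / \<bar>t i - t j\<bar>)
        \<le> (\<Prod>j\<in>{..k} - {i}. L / (\<bar>real i - real j\<bar> * d))"
    proof (intro prod_mono conjI frac_le)
      fix j assume j: "j \<in> {..k} - {i}"
      then show "\<bar>x - t j\<bar> \<le> L" using xu[of "t j"] ab by (auto simp: T_def)
      show "\<bar>real i - real j\<bar> * d \<le> \<bar>t i - t j\<bar>" using gap i j by auto
      show "0 < \<bar>real i - real j\<bar> * d" using d j by auto
    qed (use \<mu> \<mu>L in auto)
    also have "\<dots> = (L / d) ^ k / (fact i * fact (k - i))"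
    proof -
      have "(\<Prod>j\<in>{..k} - {i}. L / (\<bar>real i - real j\<bar> * d))
          = (\<Prod>j\<in>{..k} - {i}. (L / d) / \<bar>real i - real j\<bar>)"
        by (intro prod.cong) (auto simp: field_simps)
      also have "\<dots> = (L / d) ^ k / (\<Prod>j\<in>{..k} - {i}. \<bar>real i - real j\<bar>)"
        using i by (simp add: prod_dividef prod.distrib power_divide mult_ac)
      finally show ?thesis using prod_abs_diff[of i k] i by simp
    qed
    finally show "(\<Prod>j\<in>{..k} - {i}. \<bar>x - t j\<bar> / \<bar>t i - t j\<bar>) \<le> (L / d) ^ k / (fact i * fact (k - i))" .
  qed (use \<epsilon> in \<open>auto intro!: prod_nonneg\<close>)
  also have "\<dots> = \<epsilon> * (L / d) ^ k * (\<Sum>i\<le>k. 1 / (fact i * fact (k - i)))"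
    by (simp add: sum_distrib_left)
  also have "(\<Sum>i\<le>k. 1 / (fact i * fact (k - i))) = 2 ^ k / (fact k :: real)"
  proof -
    have "(\<Sum>i\<le>k. 1 / (fact i * fact (k - i))) = (\<Sum>i\<le>k. real (k choose i) / fact k)"
      by (intro sum.cong) (auto simp: binomial_fact)
    also have "\<dots> = real (\<Sum>i\<le>k. k choose i) / fact k" by (simp add: sum_divide_distrib)
    finally show ?thesis by (simp add: choose_row_sum)
  qed
  also have "\<epsilon> * (L / d) ^ k * (2 ^ k / fact k) = \<epsilon> * (2 * L / \<mu>) ^ k * (real (Suc k) ^ k / fact k)"
    by (simp add: d_def power_mult_distrib power_divide field_simps del: of_nat_Suc)
  also have "\<dots> \<le> \<epsilon> * (2 * L / \<mu>) ^ k * exp 1 ^ Suc k"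
    using Suc_power_le_fact_exp[of k] \<epsilon> \<mu> \<mu>L
    by (intro mult_left_mono) (auto simp: field_simps)
  \<comment> \<open>The base is at least 1, so its power may be raised to \<open>Suc k\<close>; both
    terms of the estimate then carry the same exponent.\<close>
  also have "\<dots> \<le> \<epsilon> * (2 * L / \<mu>) ^ Suc k * exp 1 ^ Suc k"
  proof -
    have "1 \<le> 2 * L / \<mu>" using \<mu> \<mu>L by (simp add: field_simps)
    then have "(2 * L / \<mu>) ^ k \<le> (2 * L / \<mu>) ^ Suc k" by (intro power_increasing) auto
    then show ?thesis using \<epsilon> by (intro mult_left_mono mult_right_mono) auto
  qed
  also have "\<dots> = (2 * exp 1 * L / \<mu>) ^ Suc k * \<epsilon>"
    by (simp add: power_mult_distrib power_divide)
  finally have 1: "\<bar>\<Sum>s\<in>T. G 0 s * (\<Prod>u\<in>T - {s}. (x - u) / (s - u))\<bar>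
      \<le> (2 * exp 1 * L / \<mu>) ^ Suc k * \<epsilon>" .
  have M0: "0 \<le> M" using Gb[OF x, of 0] by simp
  have "\<bar>G (card T) \<xi> / fact (card T) * (\<Prod>u\<in>T. x - u)\<bar>
      = \<bar>G (Suc k) \<xi>\<bar> / fact (Suc k) * (\<Prod>u\<in>T. \<bar>x - u\<bar>)"
    by (simp add: abs_mult abs_prod T)
  also have "\<dots> \<le> (M * (1 / \<rho>) ^ Suc k) * (\<rho> / 2) ^ Suc k"
  proof (intro mult_mono)
    show "\<bar>G (Suc k) \<xi>\<bar> / fact (Suc k) \<le> M * (1 / \<rho>) ^ Suc k"
      using Gb[OF \<xi>, of "Suc k"] by (simp add: field_simps del: fact_Suc)
    have "(\<Prod>u\<in>T. \<bar>x - u\<bar>) \<le> (\<Prod>u\<in>T. \<rho> / 2)"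
      using order_trans[OF xu ab(1)] by (intro prod_mono conjI) auto
    then show "(\<Prod>u\<in>T. \<bar>x - u\<bar>) \<le> (\<rho> / 2) ^ Suc k" by (simp add: T)
  qed (use M0 \<rho> in \<open>auto intro!: prod_nonneg\<close>)
  also have "\<dots> = M * (1 / 2) ^ Suc k"
    using \<rho> by (simp add: power_mult_distrib[symmetric] mult.assoc del: power_Suc)
  finally have 2: "\<bar>G (card T) \<xi> / fact (card T) * (\<Prod>u\<in>T. x - u)\<bar> \<le> M * (1 / 2) ^ Suc k" .
  show ?thesis unfolding eq using 1 2 by linarith
qed

text \<open>Choosing \<open>k\<close> so that the two terms balance turns the estimate into a Hoelder bound.\<close>

lemma hoelder_from_two_terms:
  fixes g C M \<delta> :: real
  assumes bnd: "\<And>k. g \<le> C ^ Suc k * (M * \<delta>) + M * (1 / 2) ^ Suc k" and "g \<le> M"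
    and C: "1 \<le> C" and "0 < M" and \<delta>: "0 < \<delta>"
  shows "g \<le> M * ((2 * C + 1) * \<delta> powr (ln 2 / ln (2 * C)))"
proof (cases "\<delta> < 1")
  case False
  then have "\<delta> powr (ln 2 / ln (2 * C)) \<ge> 1" using C by (intro ge_one_powr_ge_zero) auto
  then have "(2 * C + 1) * \<delta> powr (ln 2 / ln (2 * C)) \<ge> 1 * 1" using C by (intro mult_mono) auto
  then show ?thesis using assms by (smt (verit, best) mult_le_cancel_left1)
next
  case True
  define B where "B = 2 * C"
  \<comment> \<open>Solves \<open>B powr \<theta> = 2\<close>, so that powers of 1/2 become powers
    of \<open>1 / B\<close>, which can be compared with \<delta>.\<close>
  define \<theta> where "\<theta> = ln 2 / ln B"
  have B: "B \<ge> 2" using C by (simp add: B_def)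
  obtain n where "1 / \<delta> < B ^ n" using real_arch_pow[of B "1 / \<delta>"] B by auto
  then have ex: "\<exists>n. 1 / \<delta> \<le> B ^ n" by (auto intro: less_imp_le)
  \<comment> \<open>The least such \<open>n\<close> serves both terms:
    \<open>1 / \<delta> \<le> B ^ n\<close> bounds \<open>(1 / 2) ^ n\<close> by
    \<open>\<delta> powr \<theta>\<close>, and minimality gives
    \<open>\<delta> * B ^ k \<le> 1\<close>, which reduces the first term to a multiple of the
    second.\<close>
  define n where "n = (LEAST n. 1 / \<delta> \<le> B ^ n)"
  have n: "1 / \<delta> \<le> B ^ n" unfolding n_def by (rule LeastI_ex[OF ex])
  have "n \<noteq> 0"
  proof
    assume "n = 0"
    with n True \<delta> show False by (simp add: field_simps)
  qed
  then obtain k where k: "n = Suc k" by (cases n) auto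
  have "\<not> 1 / \<delta> \<le> B ^ k" using not_less_Least[of k "\<lambda>n. 1 / \<delta> \<le> B ^ n"] k unfolding n_def by simp
  then have d1: "\<delta> * B ^ k \<le> 1" using \<delta> by (simp add: field_simps)
  have "C ^ Suc k * \<delta> = (\<delta> * B ^ k) * (B * (1 / 2) ^ Suc k)"
    by (simp add: B_def power_mult_distrib field_simps)
  also have "\<dots> \<le> 1 * (B * (1 / 2) ^ Suc k)" using d1 B by (intro mult_right_mono) auto
  finally have "C ^ Suc k * \<delta> + (1 / 2) ^ Suc k \<le> (B + 1) * (1 / 2) ^ Suc k" by (simp add: algebra_simps)
  also have "(1 / 2) ^ Suc k \<le> \<delta> powr \<theta>"
  proof -
    have "1 / B ^ n \<le> \<delta>" using n \<delta> B by (simp add: field_simps)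
    then have "(1 / B ^ n) powr \<theta> \<le> \<delta> powr \<theta>" using B by (intro powr_mono2) (auto simp: \<theta>_def)
    also have "(1 / B ^ n) powr \<theta> = (1 / 2) ^ n"
    proof -
      have "(B ^ n) powr \<theta> = (B powr \<theta>) ^ n" using B
        by (simp add: powr_realpow[symmetric] powr_powr mult.commute)
      also have "B powr \<theta> = 2" using B by (simp add: \<theta>_def powr_def)
      finally show ?thesis using B by (simp add: powr_divide power_divide)
    qed
    finally show ?thesis by (simp add: k)
  qed
  finally have "C ^ Suc k * \<delta> + (1 / 2) ^ Suc k \<le> (B + 1) * \<delta> powr \<theta>" using B by simp
  then have "M * (C ^ Suc k * \<delta> + (1 / 2) ^ Suc k) \<le> M * ((B + 1) * \<delta> powr \<theta>)"
    using assms by (intro mult_left_mono) auto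
  moreover have "g \<le> M * (C ^ Suc k * \<delta> + (1 / 2) ^ Suc k)" using bnd[of k] by (simp add: algebra_simps)
  ultimately show ?thesis unfolding B_def \<theta>_def by linarith
qed


section \<open>Smallness on a cube\<close>

definition analytic_class :: "(real ^ 'n::finite) set \<Rightarrow> real \<Rightarrow> real \<Rightarrow> (real ^ 'n \<Rightarrow> real) \<Rightarrow> bool"
  where "analytic_class \<Omega> \<rho> M f \<longleftrightarrow> 0 < M \<and> real_analytic_on f \<Omega> \<and>
    (\<forall>\<alpha>. \<forall>x\<in>\<Omega>. \<bar>mi_deriv \<alpha> f x\<bar> \<le> M * fact (mi_size \<alpha>) * (1 / \<rho>) ^ mi_size \<alpha>)"

definition propagates ::
    "(real ^ 'n::finite) set \<Rightarrow> real \<Rightarrow> real \<Rightarrow> real \<Rightarrow> (real ^ 'n) set \<Rightarrow> (real ^ 'n) set \<Rightarrow> bool"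
  where "propagates \<Omega> \<rho> C \<theta> S T \<longleftrightarrow> 1 \<le> C \<and> 0 < \<theta> \<and> \<theta> < 1 \<and>
    (\<forall>M f \<delta>. analytic_class \<Omega> \<rho> M f \<longrightarrow> 0 < \<delta> \<longrightarrow> (\<forall>x\<in>S. \<bar>f x\<bar> \<le> M * \<delta>) \<longrightarrow>
      (\<forall>x\<in>T. \<bar>f x\<bar> \<le> M * (C * \<delta> powr \<theta>)))"

lemma analytic_class_bound:
  assumes "analytic_class \<Omega> \<rho> M f" and "x \<in> \<Omega>"
  shows "\<bar>f x\<bar> \<le> M"
proof -
  have "\<bar>mi_deriv (\<lambda>_. 0) f x\<bar> \<le> M * fact (mi_size (\<lambda>_::'a. 0)) * (1 / \<rho>) ^ mi_size (\<lambda>_::'a. 0)"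
    using assms unfolding analytic_class_def by blast
  then show ?thesis by (simp add: mi_deriv_0 mi_size_def)
qed

lemma propagates_mono:
  assumes "propagates \<Omega> \<rho> C \<theta> S T" and "S \<subseteq> S'" and "T' \<subseteq> T"
  shows "propagates \<Omega> \<rho> C \<theta> S' T'"
  using assms unfolding propagates_def by (meson subset_iff)

lemma propagates_trans:
  assumes 1: "propagates \<Omega> \<rho> C \<theta> S T" and 2: "propagates \<Omega> \<rho> C' \<theta>' T U"
  shows "propagates \<Omega> \<rho> (C' * C powr \<theta>') (\<theta> * \<theta>') S U"
proof -
  have c: "1 \<le> C" "0 < \<theta>" "\<theta> < 1" "1 \<le> C'" "0 < \<theta>'" "\<theta>' < 1"
    using 1 2 by (auto simp: propagates_def)
  have "1 \<le> C powr \<theta>'" using c by (intro ge_one_powr_ge_zero) auto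
  then have "1 * 1 \<le> C' * C powr \<theta>'" using c by (intro mult_mono) auto
  moreover have "\<theta> * \<theta>' < 1 * 1" using c by (intro mult_strict_mono) auto
  moreover have "\<bar>f x\<bar> \<le> M * (C' * C powr \<theta>' * \<delta> powr (\<theta> * \<theta>'))"
    if "analytic_class \<Omega> \<rho> M f" "0 < \<delta>" "\<forall>x\<in>S. \<bar>f x\<bar> \<le> M * \<delta>" "x \<in> U" for M f \<delta> x
  proof -
    have "\<forall>x\<in>T. \<bar>f x\<bar> \<le> M * (C * \<delta> powr \<theta>)" using 1 that unfolding propagates_def by blast
    moreover have "0 < C * \<delta> powr \<theta>" using c that by simp
    ultimately have "\<bar>f x\<bar> \<le> M * (C' * (C * \<delta> powr \<theta>) powr \<theta>')"
      using 2 that unfolding propagates_def by blast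
    then show ?thesis using c that by (simp add: powr_mult powr_powr mult_ac)
  qed
  ultimately show ?thesis using c unfolding propagates_def by auto
qed

text \<open>For \<open>\<delta> \<le> 1\<close> a smaller exponent gives a larger power. For
  \<open>\<delta> > 1\<close> this comparison fails and the claim follows from
  \<open>\<bar>f x\<bar> \<le> M\<close>, hence the condition
  \<open>T \<subseteq> \<Omega>\<close>.\<close>

lemma propagates_weaken:
  assumes "propagates \<Omega> \<rho> C \<theta> S T" and "C \<le> C'" and "0 < \<theta>'" and "\<theta>' \<le> \<theta>" and "T \<subseteq> \<Omega>"
  shows "propagates \<Omega> \<rho> C' \<theta>' S T"
proof -
  have c: "1 \<le> C" "0 < \<theta>" "\<theta> < 1" using assms by (auto simp: propagates_def)
  have "\<bar>f x\<bar> \<le> M * (C' * \<delta> powr \<theta>')"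
    if f: "analytic_class \<Omega> \<rho> M f" and d: "0 < \<delta>" and "\<forall>x\<in>S. \<bar>f x\<bar> \<le> M * \<delta>" "x \<in> T" for M f \<delta> x
  proof (cases "\<delta> \<le> 1")
    case True
    have "\<bar>f x\<bar> \<le> M * (C * \<delta> powr \<theta>)" using assms(1) that unfolding propagates_def by blast
    also have "\<dots> \<le> M * (C' * \<delta> powr \<theta>')"
      using f True d c assms
      by (intro mult_left_mono mult_mono powr_mono') (auto simp: analytic_class_def)
    finally show ?thesis .
  next
    case False
    then have "1 \<le> \<delta> powr \<theta>'" using assms by (intro ge_one_powr_ge_zero) auto
    then have "1 * 1 \<le> C' * \<delta> powr \<theta>'" using c assms by (intro mult_mono) auto
    then have "M * 1 \<le> M * (C' * \<delta> powr \<theta>')"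
      using f by (intro mult_left_mono) (auto simp: analytic_class_def)
    moreover have "\<bar>f x\<bar> \<le> M" using analytic_class_bound[OF f] that assms by auto
    ultimately show ?thesis by simp
  qed
  then show ?thesis using c assms unfolding propagates_def by auto
qed

text \<open>Exponents are required to be strictly below 1, so even the trivial inequality is
  recorded with exponent 1/2.\<close>

lemma propagates_refl:
  assumes "T \<subseteq> S" and "T \<subseteq> \<Omega>"
  shows "propagates \<Omega> \<rho> 1 (1 / 2) S T"
proof -
  have "\<bar>f x\<bar> \<le> M * (1 * \<delta> powr (1 / 2))"
    if f: "analytic_class \<Omega> \<rho> M f" and d: "0 < \<delta>" and s: "\<forall>x\<in>S. \<bar>f x\<bar> \<le> M * \<delta>" and "x \<in> T" for M f \<delta> x
  proof (cases "\<delta> \<le> 1")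
    case True
    have "\<bar>f x\<bar> \<le> M * \<delta>" using s that assms by auto
    also have "\<delta> \<le> \<delta> powr (1 / 2)" using powr_mono'[of "1/2" 1 \<delta>] d True by simp
    finally show ?thesis using f by (auto simp: analytic_class_def)
  next
    case False
    then have "1 \<le> \<delta> powr (1 / 2)" by (intro ge_one_powr_ge_zero) auto
    then have "M * 1 \<le> M * \<delta> powr (1 / 2)"
      using f by (intro mult_left_mono) (auto simp: analytic_class_def)
    moreover have "\<bar>f x\<bar> \<le> M" using analytic_class_bound[OF f] that assms by auto
    ultimately show ?thesis by simp
  qed
  then show ?thesis unfolding propagates_def by auto
qed

text \<open>The qualitative form, for chains of fixed sets. Where one pair of constants must serve a
  whole family of sets \<open>S\<close>, \<open>propagates\<close> is used with explicit
  constants.\<close>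

definition controls :: "(real ^ 'n::finite) set \<Rightarrow> real \<Rightarrow> (real ^ 'n) set \<Rightarrow> (real ^ 'n) set \<Rightarrow> bool"
  where "controls \<Omega> \<rho> S T \<longleftrightarrow> (\<exists>C \<theta>. propagates \<Omega> \<rho> C \<theta> S T)"

lemma controls_trans: "controls \<Omega> \<rho> S T \<Longrightarrow> controls \<Omega> \<rho> T U \<Longrightarrow> controls \<Omega> \<rho> S U"
  unfolding controls_def using propagates_trans by blast

lemma controls_mono: "controls \<Omega> \<rho> S T \<Longrightarrow> S \<subseteq> S' \<Longrightarrow> T' \<subseteq> T \<Longrightarrow> controls \<Omega> \<rho> S' T'"
  unfolding controls_def using propagates_mono by blast

text \<open>The largest \<open>C\<close> and the smallest \<theta> serve all indices. Each
  \<open>F i\<close> may be infinite: it is later the family of all subsets of a cube with a given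
  measure.\<close>

lemma finite_common_constants:
  assumes "finite I"
    and "\<And>i. i \<in> I \<Longrightarrow> \<exists>C \<theta>. 1 \<le> C \<and> 0 < \<theta> \<and> \<theta> < 1 \<and> (\<forall>S\<in>F i. propagates \<Omega> \<rho> C \<theta> S (T i))"
    and "\<And>i. i \<in> I \<Longrightarrow> T i \<subseteq> \<Omega>"
  shows "\<exists>C \<theta>. 1 \<le> C \<and> 0 < \<theta> \<and> \<theta> < 1 \<and> (\<forall>i\<in>I. \<forall>S\<in>F i. propagates \<Omega> \<rho> C \<theta> S (T i))"
  using assms
proof (induction I)
  case empty
  then show ?case by (intro exI[of _ 1] exI[of _ "1/2"]) auto
next
  case (insert i I)
  then obtain C \<theta> C' \<theta>' where 1: "1 \<le> C" "0 < \<theta>" "\<theta> < 1"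
    "\<forall>S\<in>F i. propagates \<Omega> \<rho> C \<theta> S (T i)"
    "1 \<le> C'" "0 < \<theta>'" "\<theta>' < 1" "\<forall>i\<in>I. \<forall>S\<in>F i. propagates \<Omega> \<rho> C' \<theta>' S (T i)" by (metis insertCI)
  have "propagates \<Omega> \<rho> (max C C') (min \<theta> \<theta>') S (T k)" if "k \<in> insert i I" "S \<in> F k" for k S
  proof (cases "k = i")
    case True
    with that 1 have "propagates \<Omega> \<rho> C \<theta> S (T i)" by blast
    then show ?thesis unfolding True
      by (rule propagates_weaken) (use 1 insert.prems(2) in auto)
  next
    case False
    with that have k: "k \<in> I" by simp
    then have "propagates \<Omega> \<rho> C' \<theta>' S (T k)" using 1 that by blast
    then show ?thesis
      by (rule propagates_weaken) (use k 1 insert.prems(2) in auto)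
  qed
  then show ?case using 1
    by (intro exI[of _ "max C C'"] exI[of _ "min \<theta> \<theta>'"]) auto
qed

lemma controls_UN:
  assumes "finite I" and "\<And>i. i \<in> I \<Longrightarrow> controls \<Omega> \<rho> S (T i)" and "\<And>i. i \<in> I \<Longrightarrow> T i \<subseteq> \<Omega>"
  shows "controls \<Omega> \<rho> S (\<Union>i\<in>I. T i)"
proof -
  have "\<exists>C \<theta>. 1 \<le> C \<and> 0 < \<theta> \<and> \<theta> < 1 \<and> (\<forall>S\<in>{S}. propagates \<Omega> \<rho> C \<theta> S (T i))" if i: "i \<in> I" for i
  proof -
    obtain C \<theta> where "propagates \<Omega> \<rho> C \<theta> S (T i)" using assms(2)[OF i] by (auto simp: controls_def)
    moreover from this have "1 \<le> C" "0 < \<theta>" "\<theta> < 1" by (auto simp: propagates_def)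
    ultimately show ?thesis by blast
  qed
  from finite_common_constants[of I "\<lambda>_. {S}" \<Omega> \<rho> T, OF assms(1) this assms(3)]
  obtain C \<theta> where "1 \<le> C" "0 < \<theta>" "\<theta> < 1" "\<forall>i\<in>I. propagates \<Omega> \<rho> C \<theta> S (T i)" by auto
  then show ?thesis unfolding controls_def propagates_def by (intro exI[of _ C] exI[of _ \<theta>]) blast
qed

text \<open>The m-th derivative of \<open>f\<close> along the segment is the derivative with
  multi-index m e_i, so the one-dimensional hypotheses hold with the same \<open>M\<close> and
  \<rho>. The target point is the parameter 0.\<close>

lemma axis_propagation:
  fixes a b L \<mu> \<rho> M \<delta> :: real
  defines "B \<equiv> 2 * exp 1 * L / \<mu>"
  assumes f: "analytic_class \<Omega> \<rho> M f" and \<rho>: "0 < \<rho>"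
    and seg: "\<And>t. t \<in> {a..b} \<Longrightarrow> x + t *\<^sub>R axis i 1 \<in> \<Omega>" and "0 \<in> {a..b}"
    and ab: "b - a \<le> \<rho> / 2" "b - a \<le> L"
    and E: "E \<in> sets borel" "E \<subseteq> {a..b}" "\<mu> \<le> measure lborel E" and "0 < \<mu>" and "0 < \<delta>"
    and small: "\<And>t. t \<in> E \<Longrightarrow> \<bar>f (x + t *\<^sub>R axis i 1)\<bar> \<le> M * \<delta>"
  shows "\<bar>f x\<bar> \<le> M * ((2 * B + 1) * \<delta> powr (ln 2 / ln (2 * B)))"
proof -
  have M: "0 < M" and fa: "real_analytic_on f \<Omega>" using f by (auto simp: analytic_class_def)
  define I where "I m = (\<lambda>_. 0)(i := m)" for m :: nat
  have I: "mi_size (I m) = m" for m by (simp add: I_def mi_size_def)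
  have ISuc: "(I m)(i := Suc (I m i)) = I (Suc m)" for m by (simp add: I_def)
  have I0: "I 0 = (\<lambda>_. 0)" by (auto simp: I_def)
  define G where "G m t = mi_deriv (I m) f (x + t *\<^sub>R axis i 1)" for m t
  have G0: "G 0 t = f (x + t *\<^sub>R axis i 1)" for t by (simp add: G_def I0 mi_deriv_0)
  have dG: "(G m has_real_derivative G (Suc m) t) (at t)" if "t \<in> {a..b}" for m t
    using mi_deriv_has_partial_deriv_line[OF fa seg[OF that], of "I m"] unfolding ISuc G_def .
  have bG: "\<bar>G m t\<bar> \<le> M * fact m * (1 / \<rho>) ^ m" if "t \<in> {a..b}" for m t
    using f seg[OF that] I[of m] unfolding analytic_class_def G_def by metis
  have "measure lborel E \<le> measure lborel {a..b}"
    using E by (intro measure_mono_fmeasurable) (auto simp: fmeasurable_compact)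
  then have \<mu>L: "\<mu> \<le> L" using E ab \<open>0 \<in> {a..b}\<close> by simp
  have "1 * 1 \<le> (2 * exp 1) * (L / \<mu>)"
    using exp_ge_add_one_self[of 1] \<mu>L \<open>0 < \<mu>\<close> by (intro mult_mono) auto
  then have B1: "1 \<le> B" by (simp add: B_def)
  have "\<bar>G 0 0\<bar> \<le> M * ((2 * B + 1) * \<delta> powr (ln 2 / ln (2 * B)))"
  proof (rule hoelder_from_two_terms[OF _ _ B1 M \<open>0 < \<delta>\<close>])
    show "\<bar>G 0 0\<bar> \<le> B ^ Suc k * (M * \<delta>) + M * (1 / 2) ^ Suc k" for k
      unfolding B_def
      by (rule smallness_on_interval[OF dG bG ab \<rho> _ E])
         (use small M \<open>0 < \<delta>\<close> \<open>0 < \<mu>\<close> \<open>0 \<in> {a..b}\<close> in \<open>auto simp: G0\<close>)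
    show "\<bar>G 0 0\<bar> \<le> M" using bG[OF \<open>0 \<in> {a..b}\<close>, of 0] by simp
  qed
  then show ?thesis by (simp add: G0)
qed

lemma axis_constants:
  fixes L \<mu> :: real
  assumes "0 < \<mu>" and "\<mu> \<le> L"
  shows "1 \<le> 2 * (2 * exp 1 * L / \<mu>) + 1" and "0 < ln 2 / ln (2 * (2 * exp 1 * L / \<mu>))"
    and "ln 2 / ln (2 * (2 * exp 1 * L / \<mu>)) < 1"
proof -
  have "2 * 1 \<le> (2 * exp 1) * (L / \<mu>)"
    using exp_ge_add_one_self[of 1] assms by (intro mult_mono) auto
  then have B: "2 \<le> 2 * exp 1 * L / \<mu>" by simp
  then show "1 \<le> 2 * (2 * exp 1 * L / \<mu>) + 1" by linarith
  have less: "ln 2 < ln (2 * (2 * exp 1 * L / \<mu>))" using B by (subst ln_less_cancel_iff) auto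
  have "(0::real) < ln 2" by simp
  then have pos: "0 < ln (2 * (2 * exp 1 * L / \<mu>))" using less by (rule less_trans)
  show "0 < ln 2 / ln (2 * (2 * exp 1 * L / \<mu>))" by (rule divide_pos_pos[OF _ pos]) simp
  show "ln 2 / ln (2 * (2 * exp 1 * L / \<mu>)) < 1" by (subst divide_less_eq_1_pos[OF pos]) (rule less)
qed

section \<open>Measure of intersections with lines\<close>

lemma nn_integral_translate:
  fixes g :: "'a::euclidean_space \<Rightarrow> ennreal"
  assumes "g \<in> borel_measurable borel"
  shows "(\<integral>\<^sup>+x. g (c + x) \<partial>lborel) = (\<integral>\<^sup>+x. g x \<partial>lborel)"
proof -
  have "(\<integral>\<^sup>+x. g x \<partial>lborel) = (\<integral>\<^sup>+x. g x \<partial>distr lborel borel ((+) c))"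
    by (simp add: lborel_distr_plus)
  also have "\<dots> = (\<integral>\<^sup>+x. g (c + x) \<partial>lborel)" using assms by (intro nn_integral_distr) auto
  finally show ?thesis by simp
qed

lemma borel_shift_set:
  fixes E :: "'a::euclidean_space set"
  assumes "E \<in> sets borel"
  shows "{t::real. x + t *\<^sub>R e \<in> E} \<in> sets borel"
proof -
  have "(\<lambda>t::real. x + t *\<^sub>R e) -` E \<inter> space borel \<in> sets borel"
    using assms by (intro measurable_sets[where A = borel]) auto
  then show ?thesis by (simp add: vimage_def)
qed

lemma emeasure_line_eq_nn_integral:
  fixes E :: "'a::euclidean_space set"
  assumes "E \<in> sets borel"
  shows "emeasure lborel {t::real. x + t *\<^sub>R e \<in> E} = (\<integral>\<^sup>+t. indicator E (x + t *\<^sub>R e) \<partial>lborel)"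
proof -
  have "(\<integral>\<^sup>+t. indicator E (x + t *\<^sub>R e) \<partial>lborel) = (\<integral>\<^sup>+t. indicator {t. x + t *\<^sub>R e \<in> E} t \<partial>lborel)"
    by (intro nn_integral_cong) (auto simp: indicator_def)
  then show ?thesis using borel_shift_set[OF assms] by simp
qed

lemma borel_measurable_line_measure:
  fixes E :: "'a::euclidean_space set"
  assumes [measurable]: "E \<in> sets borel"
  shows "(\<lambda>x. emeasure lborel {t::real. x + t *\<^sub>R e \<in> E}) \<in> borel_measurable borel"
  unfolding emeasure_line_eq_nn_integral[OF assms] by measurable

text \<open>Tonelli's theorem together with the translation invariance of Lebesgue measure.\<close>

lemma line_measure_symmetry:
  fixes E Q :: "'a::euclidean_space set"
  assumes E[measurable]: "E \<in> sets borel" and Q[measurable]: "Q \<in> sets borel"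
  shows "(\<integral>\<^sup>+x. indicator Q x * emeasure lborel {t::real. x + t *\<^sub>R e \<in> E} \<partial>lborel)
    = (\<integral>\<^sup>+x. indicator E x * emeasure lborel {t::real. x + t *\<^sub>R (- e) \<in> Q} \<partial>lborel)"
proof -
  have "(\<integral>\<^sup>+x. indicator Q x * emeasure lborel {t::real. x + t *\<^sub>R e \<in> E} \<partial>lborel)
      = (\<integral>\<^sup>+x. \<integral>\<^sup>+t. indicator Q x * indicator E (x + t *\<^sub>R e) \<partial>lborel \<partial>lborel)"
    by (simp add: emeasure_line_eq_nn_integral[OF E] nn_integral_cmult)
  also have "\<dots> = (\<integral>\<^sup>+t. \<integral>\<^sup>+x. indicator Q x * indicator E (x + t *\<^sub>R e) \<partial>lborel \<partial>lborel)"
    by (rule lborel_pair.Fubini'[symmetric]) measurable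
  also have "\<dots> = (\<integral>\<^sup>+t. \<integral>\<^sup>+x. indicator E x * indicator Q (x + t *\<^sub>R (- e)) \<partial>lborel \<partial>lborel)"
  proof (rule nn_integral_cong)
    fix t :: real
    have "(\<integral>\<^sup>+x. indicator E x * indicator Q (x + t *\<^sub>R (- e)) \<partial>lborel)
        = (\<integral>\<^sup>+x. indicator E (t *\<^sub>R e + x) * indicator Q (t *\<^sub>R e + x + t *\<^sub>R (- e)) \<partial>lborel)"
      by (rule nn_integral_translate[symmetric]) measurable
    also have "\<dots> = (\<integral>\<^sup>+x. indicator Q x * indicator E (x + t *\<^sub>R e) \<partial>lborel)"
      by (simp add: mult.commute add.commute)
    finally show "(\<integral>\<^sup>+x. indicator Q x * indicator E (x + t *\<^sub>R e) \<partial>lborel)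
        = (\<integral>\<^sup>+x. indicator E x * indicator Q (x + t *\<^sub>R (- e)) \<partial>lborel)" by (rule sym)
  qed
  also have "\<dots> = (\<integral>\<^sup>+x. \<integral>\<^sup>+t. indicator E x * indicator Q (x + t *\<^sub>R (- e)) \<partial>lborel \<partial>lborel)"
    by (rule lborel_pair.Fubini') measurable
  also have "\<dots> = (\<integral>\<^sup>+x. indicator E x * emeasure lborel {t::real. x + t *\<^sub>R (- e) \<in> Q} \<partial>lborel)"
    unfolding emeasure_line_eq_nn_integral[OF Q] by (simp add: nn_integral_cmult)
  finally show ?thesis .
qed

text \<open>Averaging: the lengths of the slices of \<open>E\<close>, integrated over the cube, give
  \<open>s\<close> times its measure. Points on lines with short slices contribute at most half of
  that, so those on lines with long slices must fill a set of measure at least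
  \<open>\<mu> / 2\<close>.\<close>

lemma cube_line_cylinder_measure:
  fixes a b :: "real ^ 'n::finite" and i :: 'n and s \<mu> :: real
  assumes side: "\<And>j. b $ j = a $ j + s" and s: "0 < s"
    and E: "E \<in> sets borel" "E \<subseteq> cbox a b" "\<mu> \<le> measure lborel E" and \<mu>: "0 < \<mu>"
  defines "F \<equiv> {x \<in> cbox a b. \<mu> / (2 * s ^ CARD('n)) * s \<le> measure lborel {t. x + t *\<^sub>R axis i 1 \<in> E}}"
  shows "F \<in> sets borel" and "\<mu> / 2 \<le> measure lborel F"
proof -
  \<comment> \<open>The threshold satisfies \<open>\<mu>' * s ^ CARD('n) = s * (\<mu> / 2)\<close>,
    which is the allowed contribution of the short slices.\<close>
  define \<mu>' where "\<mu>' = \<mu> / (2 * s ^ CARD('n)) * s"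
  have \<mu>': "0 < \<mu>'" using \<mu> s by (simp add: \<mu>'_def)
  define u where "u x = emeasure lborel {t. x + t *\<^sub>R axis i (1::real) \<in> E}" for x
  have [measurable]: "u \<in> borel_measurable borel"
    unfolding u_def by (rule borel_measurable_line_measure[OF E(1)])
  have sub: "{t. x + t *\<^sub>R axis i 1 \<in> E} \<subseteq> {a $ i - x $ i .. b $ i - x $ i}" for x
  proof
    fix t assume "t \<in> {t. x + t *\<^sub>R axis i 1 \<in> E}"
    then have "x + t *\<^sub>R axis i 1 \<in> cbox a b" using E by auto
    then have "a $ i \<le> (x + t *\<^sub>R axis i 1) $ i" "(x + t *\<^sub>R axis i 1) $ i \<le> b $ i"
      unfolding mem_box_cart by blast+
    then show "t \<in> {a $ i - x $ i .. b $ i - x $ i}" by simp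
  qed
  have us: "u x \<le> ennreal s" for x
  proof -
    have "u x \<le> emeasure lborel {a $ i - x $ i .. b $ i - x $ i}"
      unfolding u_def by (intro emeasure_mono sub) auto
    also have "\<dots> = ennreal s" using side[of i] s by simp
    finally show ?thesis .
  qed
  have F: "F = {x \<in> cbox a b. ennreal \<mu>' \<le> u x}"
  proof -
    have "u x = ennreal (measure lborel {t. x + t *\<^sub>R axis i 1 \<in> E})" for x
      unfolding u_def using us[of x] unfolding u_def
      by (intro emeasure_eq_ennreal_measure) (auto simp: top_unique)
    then show ?thesis unfolding F_def \<mu>'_def[symmetric] using \<mu>' by (auto simp: ennreal_le_iff)
  qed
  show Fb[measurable]: "F \<in> sets borel"
    unfolding F by measurable
  have mQ: "emeasure lborel (cbox a b) = ennreal (s ^ CARD('n))"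
  proof -
    have "cbox a b \<noteq> {}" using side s by (simp add: interval_ne_empty_cart less_imp_le)
    then have "measure lborel (cbox a b) = s ^ CARD('n)" using side by (simp add: content_cbox_cart)
    moreover have "emeasure lborel (cbox a b) = ennreal (measure lborel (cbox a b))"
      using emeasure_lborel_cbox_finite[of a b] by (intro emeasure_eq_ennreal_measure) auto
    ultimately show ?thesis by simp
  qed
  have Efin: "emeasure lborel E = ennreal (measure lborel E)"
    using E emeasure_mono[of E "cbox a b" lborel] mQ
    by (intro emeasure_eq_ennreal_measure) (auto simp: top_unique)
  have Ffin: "emeasure lborel F = ennreal (measure lborel F)"
    using emeasure_mono[of F "cbox a b" lborel] mQ
    by (intro emeasure_eq_ennreal_measure) (auto simp: top_unique F)
  have "ennreal s * emeasure lborel E = (\<integral>\<^sup>+x. ennreal s * indicator E x \<partial>lborel)"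
    using E by (simp add: nn_integral_cmult)
  \<comment> \<open>An axis-parallel line through a point of the cube meets the cube in length
    exactly \<open>s\<close>, so the double integral read in the other order has a constant inner
    integral on \<open>E\<close>.\<close>
  also have "\<dots> = (\<integral>\<^sup>+x. indicator E x * emeasure lborel {t::real. x + t *\<^sub>R (- axis i 1) \<in> cbox a b} \<partial>lborel)"
  proof (intro nn_integral_cong)
    fix x
    have "emeasure lborel {t::real. x + t *\<^sub>R (- axis i 1) \<in> cbox a b} = ennreal s" if "x \<in> E"
    proof -
      have x: "a $ j \<le> x $ j" "x $ j \<le> b $ j" for j
        using that E(2) unfolding subset_iff mem_box_cart by blast+
      have "x + t *\<^sub>R (- axis i 1) \<in> cbox a b \<longleftrightarrow> t \<in> {x $ i - b $ i .. x $ i - a $ i}" for t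
      proof
        assume "x + t *\<^sub>R (- axis i 1) \<in> cbox a b"
        then have "a $ i \<le> (x + t *\<^sub>R (- axis i 1)) $ i" "(x + t *\<^sub>R (- axis i 1)) $ i \<le> b $ i"
          unfolding mem_box_cart by blast+
        then show "t \<in> {x $ i - b $ i .. x $ i - a $ i}" by simp
      next
        assume "t \<in> {x $ i - b $ i .. x $ i - a $ i}"
        then show "x + t *\<^sub>R (- axis i 1) \<in> cbox a b"
          unfolding mem_box_cart using x by (auto simp: axis_def)
      qed
      then have "{t. x + t *\<^sub>R (- axis i 1) \<in> cbox a b} = {x $ i - b $ i .. x $ i - a $ i}" by blast
      then show ?thesis using side[of i] s by simp
    qed
    then show "ennreal s * indicator E x
        = indicator E x * emeasure lborel {t::real. x + t *\<^sub>R (- axis i 1) \<in> cbox a b}"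
      by (cases "x \<in> E") auto
  qed
  also have "\<dots> = (\<integral>\<^sup>+x. indicator (cbox a b) x * u x \<partial>lborel)"
    unfolding u_def by (rule line_measure_symmetry[symmetric]) (use E in auto)
  also have "\<dots> \<le> (\<integral>\<^sup>+x. ennreal s * indicator F x + ennreal \<mu>' * indicator (cbox a b) x \<partial>lborel)"
  proof (intro nn_integral_mono)
    fix x
    show "indicator (cbox a b) x * u x \<le> ennreal s * indicator F x + ennreal \<mu>' * indicator (cbox a b) x"
      using us[of x] by (auto simp: indicator_def F intro: add_increasing2)
  qed
  also have "\<dots> = ennreal s * emeasure lborel F + ennreal \<mu>' * emeasure lborel (cbox a b)"
    by (simp add: nn_integral_add nn_integral_cmult)
  finally have "s * measure lborel E \<le> s * measure lborel F + \<mu>' * s ^ CARD('n)"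
    unfolding Efin Ffin mQ using s \<mu>'
    by (simp add: ennreal_mult[symmetric] ennreal_plus[symmetric] del: ennreal_plus)
  also have "\<mu>' * s ^ CARD('n) = s * (\<mu> / 2)" using s by (simp add: \<mu>'_def field_simps)
  finally have "s * measure lborel E \<le> s * (measure lborel F + \<mu> / 2)" by (simp add: algebra_simps)
  then have "measure lborel E \<le> measure lborel F + \<mu> / 2" using s by simp
  then show "\<mu> / 2 \<le> measure lborel F" using E by linarith
qed

lemma line_measure_shift:
  assumes "E \<in> sets borel"
  shows "measure lborel {t::real. t + \<tau> \<in> E} = measure lborel E"
proof -
  have "emeasure lborel E = emeasure (distr lborel borel ((+) \<tau>)) E" by (simp add: lborel_distr_plus)
  also have "\<dots> = emeasure lborel {t. t + \<tau> \<in> E}"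
    using assms by (subst emeasure_distr) (auto simp: vimage_def add.commute)
  finally show ?thesis by (simp add: measure_def)
qed

text \<open>
  The last hypothesis on \<open>E\<close> says that, inside the cube, \<open>E\<close> is a cylinder over the coordinates in \<open>I\<close>.
  Removing one coordinate from \<open>I\<close> replaces \<open>E\<close> by the union of those lines that meet it in a set of
  definite length; when \<open>I\<close> is empty, \<open>E\<close> is the whole cube.
\<close>

lemma cube_propagation_aux:
  fixes a b :: "real ^ 'n::finite"
  assumes side: "\<And>j. b $ j = a $ j + s" and s: "0 < s" "s \<le> \<rho> / 2" and sub: "cbox a b \<subseteq> \<Omega>"
    and "finite I" and "0 < \<mu>"
  shows "\<exists>C \<theta>. 1 \<le> C \<and> 0 < \<theta> \<and> \<theta> < 1 \<and> (\<forall>E. E \<in> sets borel \<longrightarrow> E \<subseteq> cbox a b \<longrightarrow> \<mu> \<le> measure lborel E \<longrightarrow>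
    (\<forall>x\<in>E. \<forall>y\<in>cbox a b. (\<forall>j\<in>I. x $ j = y $ j) \<longrightarrow> y \<in> E) \<longrightarrow> propagates \<Omega> \<rho> C \<theta> E (cbox a b))"
  using \<open>finite I\<close> \<open>0 < \<mu>\<close>
proof (induction I arbitrary: \<mu>)
  case empty
  have "propagates \<Omega> \<rho> 1 (1 / 2) E (cbox a b)"
    if "\<mu> \<le> measure lborel E" "\<forall>x\<in>E. \<forall>y\<in>cbox a b. y \<in> E" for E
  proof -
    have "E \<noteq> {}" using that empty by auto
    then show ?thesis using that sub by (intro propagates_refl) auto
  qed
  then show ?case by (intro exI[of _ 1] exI[of _ "1/2"]) auto
next
  case (insert i I)
  from insert.IH[of "\<mu> / 2"] insert.prems obtain C \<theta> where C: "1 \<le> C" "0 < \<theta>" "\<theta> < 1"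
    and IH: "\<And>E. E \<in> sets borel \<Longrightarrow> E \<subseteq> cbox a b \<Longrightarrow> \<mu> / 2 \<le> measure lborel E \<Longrightarrow>
      (\<forall>x\<in>E. \<forall>y\<in>cbox a b. (\<forall>j\<in>I. x $ j = y $ j) \<longrightarrow> y \<in> E) \<Longrightarrow> propagates \<Omega> \<rho> C \<theta> E (cbox a b)"
    by auto
  define \<mu>' where "\<mu>' = \<mu> / (2 * s ^ CARD('n)) * s"
  have \<mu>': "0 < \<mu>'" using insert.prems s by (simp add: \<mu>'_def)
  \<comment> \<open>\<mu> is arbitrary and may be too large for any \<open>E\<close> to exist; the
    maximum secures \<open>\<mu>' \<le> L\<close>, which the constants need, in that case
    too.\<close>
  define L where "L = max s \<mu>'"
  define B where "B = 2 * exp 1 * L / \<mu>'"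
  have L: "\<mu>' \<le> L" "s \<le> L" by (auto simp: L_def)
  define \<theta>' where "\<theta>' = ln 2 / ln (2 * B)"
  have cc: "1 \<le> 2 * B + 1" "0 < \<theta>'" "\<theta>' < 1"
    using axis_constants[OF \<mu>' L(1)] by (auto simp: B_def \<theta>'_def)
  have "propagates \<Omega> \<rho> (C * (2 * B + 1) powr \<theta>) (\<theta>' * \<theta>) E (cbox a b)"
    if E: "E \<in> sets borel" "E \<subseteq> cbox a b" "\<mu> \<le> measure lborel E"
      and inv: "\<forall>x\<in>E. \<forall>y\<in>cbox a b. (\<forall>j\<in>insert i I. x $ j = y $ j) \<longrightarrow> y \<in> E" for E
  proof -
    define F where "F = {x \<in> cbox a b. \<mu>' \<le> measure lborel {t. x + t *\<^sub>R axis i 1 \<in> E}}"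
    have Fb: "F \<in> sets borel" "\<mu> / 2 \<le> measure lborel F"
      using cube_line_cylinder_measure[OF side s(1) E insert.prems, of i] unfolding F_def \<mu>'_def by auto
    have 1: "propagates \<Omega> \<rho> (2 * B + 1) \<theta>' E F"
      unfolding propagates_def
    proof (intro conjI allI impI ballI cc)
      fix M f \<delta> x assume f: "analytic_class \<Omega> \<rho> M f" "0 < \<delta>" "\<forall>x\<in>E. \<bar>f x\<bar> \<le> M * \<delta>" "x \<in> F"
      have x: "a $ j \<le> x $ j" "x $ j \<le> b $ j" for j
        using f(4) unfolding F_def by (auto simp: mem_box_cart)
      show "\<bar>f x\<bar> \<le> M * ((2 * B + 1) * \<delta> powr \<theta>')"
        unfolding B_def \<theta>'_def
      proof (rule axis_propagation[OF f(1), where a = "a $ i - x $ i" and b = "b $ i - x $ i" and i = i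
            and E = "{t. x + t *\<^sub>R axis i 1 \<in> E}"])
        show "x + t *\<^sub>R axis i 1 \<in> \<Omega>" if "t \<in> {a $ i - x $ i..b $ i - x $ i}" for t
        proof -
          have "x + t *\<^sub>R axis i 1 \<in> cbox a b"
            using that x unfolding mem_box_cart by (auto simp: axis_def)
          then show ?thesis using sub by auto
        qed
        show "{t. x + t *\<^sub>R axis i 1 \<in> E} \<subseteq> {a $ i - x $ i..b $ i - x $ i}"
        proof
          fix t assume "t \<in> {t. x + t *\<^sub>R axis i 1 \<in> E}"
          then have "x + t *\<^sub>R axis i 1 \<in> cbox a b" using E by auto
          then have "a $ i \<le> (x + t *\<^sub>R axis i 1) $ i" "(x + t *\<^sub>R axis i 1) $ i \<le> b $ i"
            unfolding mem_box_cart by blast+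
          then show "t \<in> {a $ i - x $ i .. b $ i - x $ i}" by simp
        qed
        show "{t. x + t *\<^sub>R axis i 1 \<in> E} \<in> sets borel" by (rule borel_shift_set[OF E(1)])
        show "\<mu>' \<le> measure lborel {t. x + t *\<^sub>R axis i 1 \<in> E}" using f(4) by (simp add: F_def)
      qed (use x[of i] s \<mu>' f side[of i] L in auto)
    qed
    \<comment> \<open>\<open>F\<close> is a cylinder over the smaller set \<open>I\<close>: if
      \<open>x\<close> and \<open>y\<close> agree on \<open>I\<close>, their lines in direction
      \<open>i\<close> differ, up to the shift \<tau>, only in coordinates outside
      \<open>insert i I\<close>, which do not affect membership in \<open>E\<close>.\<close>
    have "y \<in> F" if "x \<in> F" "y \<in> cbox a b" "\<forall>j\<in>I. x $ j = y $ j" for x y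
    proof -
      define \<tau> where "\<tau> = x $ i - y $ i"
      have x: "a $ j \<le> x $ j" "x $ j \<le> b $ j" for j
        using that(1) unfolding F_def by (auto simp: mem_box_cart)
      have y: "a $ j \<le> y $ j" "y $ j \<le> b $ j" for j
        using that(2) by (auto simp: mem_box_cart)
      have "x + t *\<^sub>R axis i 1 \<in> E \<longleftrightarrow> y + (t + \<tau>) *\<^sub>R axis i 1 \<in> E" for t
      proof
        assume t: "x + t *\<^sub>R axis i 1 \<in> E"
        then have "x + t *\<^sub>R axis i 1 \<in> cbox a b" using E by auto
        then have "a $ i \<le> (x + t *\<^sub>R axis i 1) $ i" "(x + t *\<^sub>R axis i 1) $ i \<le> b $ i"
          unfolding mem_box_cart by blast+
        then have "y + (t + \<tau>) *\<^sub>R axis i 1 \<in> cbox a b"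
          unfolding mem_box_cart using y by (auto simp: axis_def \<tau>_def)
        moreover have "\<forall>j\<in>insert i I. (x + t *\<^sub>R axis i 1) $ j = (y + (t + \<tau>) *\<^sub>R axis i 1) $ j"
          using that(3) by (auto simp: axis_def \<tau>_def)
        ultimately show "y + (t + \<tau>) *\<^sub>R axis i 1 \<in> E" using inv t by blast
      next
        assume t: "y + (t + \<tau>) *\<^sub>R axis i 1 \<in> E"
        then have "y + (t + \<tau>) *\<^sub>R axis i 1 \<in> cbox a b" using E by auto
        then have "a $ i \<le> (y + (t + \<tau>) *\<^sub>R axis i 1) $ i" "(y + (t + \<tau>) *\<^sub>R axis i 1) $ i \<le> b $ i"
          unfolding mem_box_cart by blast+
        then have "x + t *\<^sub>R axis i 1 \<in> cbox a b"
          unfolding mem_box_cart using x by (auto simp: axis_def \<tau>_def)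
        moreover have "\<forall>j\<in>insert i I. (y + (t + \<tau>) *\<^sub>R axis i 1) $ j = (x + t *\<^sub>R axis i 1) $ j"
          using that(3) by (auto simp: axis_def \<tau>_def)
        ultimately show "x + t *\<^sub>R axis i 1 \<in> E" using inv t by blast
      qed
      then have "measure lborel {t. x + t *\<^sub>R axis i 1 \<in> E} = measure lborel {t. y + t *\<^sub>R axis i 1 \<in> E}"
        using line_measure_shift[OF borel_shift_set[OF E(1)], of \<tau> y "axis i 1"] by simp
      then show ?thesis using that by (simp add: F_def)
    qed
    then have 2: "propagates \<Omega> \<rho> C \<theta> F (cbox a b)"
      using Fb by (intro IH) (auto simp: F_def)
    show ?thesis by (rule propagates_trans[OF 1 2])
  qed
  moreover have "1 * 1 \<le> C * (2 * B + 1) powr \<theta>"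
    using cc C by (intro mult_mono ge_one_powr_ge_zero) auto
  moreover have "\<theta>' * \<theta> < 1 * 1" using cc C by (intro mult_strict_mono) auto
  ultimately show ?case using C cc
    by (intro exI[of _ "C * (2 * B + 1) powr \<theta>"] exI[of _ "\<theta>' * \<theta>"]) auto
qed

lemma cube_propagation:
  fixes a b :: "real ^ 'n::finite"
  assumes side: "\<And>j. b $ j = a $ j + s" and s: "0 < s" "s \<le> \<rho> / 2" and sub: "cbox a b \<subseteq> \<Omega>"
    and "0 < \<mu>"
  shows "\<exists>C \<theta>. 1 \<le> C \<and> 0 < \<theta> \<and> \<theta> < 1 \<and> (\<forall>E. E \<in> sets borel \<longrightarrow> E \<subseteq> cbox a b \<longrightarrow>
    \<mu> \<le> measure lborel E \<longrightarrow> propagates \<Omega> \<rho> C \<theta> E (cbox a b))"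
proof -
  have "(\<forall>j\<in>UNIV. x $ j = y $ j) \<longleftrightarrow> x = y" for x y :: "real ^ 'n" by (auto simp: vec_eq_iff)
  then show ?thesis using cube_propagation_aux[OF side s sub finite[of UNIV] \<open>0 < \<mu>\<close>] by simp
qed


section \<open>Propagation in the interior and the cone condition\<close>

text \<open>The closed ball of radius \<open>r\<close> in the maximum norm; its side is
  \<open>2 * r\<close>.\<close>

definition cube :: "real ^ 'n::finite \<Rightarrow> real \<Rightarrow> (real ^ 'n) set"
  where "cube x r = cbox (x - vec r) (x + vec r)"

lemma mem_cube: "y \<in> cube x r \<longleftrightarrow> (\<forall>j. \<bar>y $ j - x $ j\<bar> \<le> r)"
proof -
  have "(x $ j - r \<le> y $ j \<and> y $ j \<le> x $ j + r) \<longleftrightarrow> \<bar>y $ j - x $ j\<bar> \<le> r" for j by auto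
  then show ?thesis by (simp add: cube_def mem_box_cart)
qed

lemma ball_subset_cube: "ball x r \<subseteq> cube x r"
proof
  fix y assume "y \<in> ball x r"
  then have "norm (y - x) < r" by (simp add: dist_norm norm_minus_commute)
  then show "y \<in> cube x r"
    unfolding mem_cube using order_trans[OF component_le_norm_cart[of "y - x"] less_imp_le] by simp
qed

lemma cube_subset_cube:
  assumes "norm (y - x) + s \<le> r"
  shows "cube y s \<subseteq> cube x r"
proof
  fix z assume z: "z \<in> cube y s"
  have "\<bar>z $ j - x $ j\<bar> \<le> r" for j
  proof -
    have "\<bar>z $ j - y $ j\<bar> \<le> s" using z by (simp add: mem_cube)
    moreover have "\<bar>y $ j - x $ j\<bar> \<le> norm (y - x)" using component_le_norm_cart[of "y - x" j] by simp
    ultimately show ?thesis using assms by linarith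
  qed
  then show "z \<in> cube x r" by (simp add: mem_cube)
qed

lemma cube_subset_ball:
  fixes x :: "real ^ 'n::finite"
  assumes "0 < e"
  shows "cube x (e / (2 * real CARD('n))) \<subseteq> ball x e"
proof
  fix y assume y: "y \<in> cube x (e / (2 * real CARD('n)))"
  have "norm (y - x) \<le> (\<Sum>j\<in>UNIV. \<bar>(y - x) $ j\<bar>)" by (rule norm_le_l1_cart)
  also have "\<dots> \<le> (\<Sum>j\<in>(UNIV :: 'n set). e / (2 * real CARD('n)))"
    using y by (intro sum_mono) (simp add: mem_cube)
  also have "\<dots> = e / 2" by simp
  finally show "y \<in> ball x e" using assms by (simp add: dist_norm norm_minus_commute)
qed

lemma cube_in_open:
  fixes x :: "real ^ 'n::finite"
  assumes "open U" and "x \<in> U" and "0 < R"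
  obtains r where "0 < r" and "r \<le> R" and "cube x r \<subseteq> U"
proof -
  obtain e where e: "0 < e" "ball x e \<subseteq> U" using assms by (auto simp: open_contains_ball)
  define r where "r = min R (e / (2 * real CARD('n)))"
  have "cube x r \<subseteq> cube x (e / (2 * real CARD('n)))" by (rule cube_subset_cube) (simp add: r_def)
  then have "cube x r \<subseteq> U" using cube_subset_ball[OF e(1), of x] e(2) by blast
  moreover have "0 < r" "r \<le> R" using e assms by (auto simp: r_def)
  ultimately show ?thesis using that by blast
qed

lemma measure_cube_pos:
  assumes "0 < r"
  shows "0 < measure lborel (cube x r)"
  unfolding cube_def using assms
  by (subst content_cbox_cart) (auto simp: interval_ne_empty_cart intro!: prod_pos)

lemma cube_sets_borel: "cube x r \<in> sets borel"
  by (simp add: cube_def)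

text \<open>The condition \<open>r \<le> \<rho> / 4\<close> keeps the side at most
  \<open>\<rho> / 2\<close>, as the interval estimate requires. One pair of constants serves every
  \<open>E\<close>.\<close>

lemma cube_family_propagates:
  assumes "cube x r \<subseteq> \<Omega>" and "0 < r" and "r \<le> \<rho> / 4" and "0 < \<mu>"
  shows "\<exists>C \<theta>. 1 \<le> C \<and> 0 < \<theta> \<and> \<theta> < 1 \<and> (\<forall>E. E \<in> sets borel \<longrightarrow> E \<subseteq> cube x r \<longrightarrow>
    \<mu> \<le> measure lborel E \<longrightarrow> propagates \<Omega> \<rho> C \<theta> E (cube x r))"
  unfolding cube_def
  by (rule cube_propagation[where s = "2 * r"]) (use assms in \<open>auto simp: cube_def\<close>)

lemma subcube_controls:
  assumes "cube x r \<subseteq> \<Omega>" and "0 < r" and "r \<le> \<rho> / 4" and "cube y s \<subseteq> cube x r" and "0 < s"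
  shows "controls \<Omega> \<rho> (cube y s) (cube x r)"
proof -
  from cube_family_propagates[OF assms(1-3) measure_cube_pos[OF assms(5), of y]]
  obtain C \<theta> where fam: "\<And>E. E \<in> sets borel \<Longrightarrow> E \<subseteq> cube x r \<Longrightarrow>
      measure lborel (cube y s) \<le> measure lborel E \<Longrightarrow> propagates \<Omega> \<rho> C \<theta> E (cube x r)" by metis
  have "propagates \<Omega> \<rho> C \<theta> (cube y s) (cube x r)"
    by (rule fam[OF cube_sets_borel assms(4) order_refl])
  then show ?thesis unfolding controls_def by (intro exI)
qed

text \<open>The set \<open>G\<close> of good centres is open, and so is its complement in \<Omega>:
  a good centre close to \<open>x\<close> has a small good cube inside a fixed cube around
  \<open>x\<close>, and that small cube, having positive measure, controls the fixed one.
  Connectedness leaves only \<open>G = \<Omega>\<close>.\<close>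

lemma cube_controls_nearby:
  assumes "open \<Omega>" and "connected \<Omega>" and "0 < \<rho>" and S: "cube x0 r0 \<subseteq> \<Omega>" "0 < r0" and "x \<in> \<Omega>"
  shows "\<exists>r>0. cube x r \<subseteq> \<Omega> \<and> controls \<Omega> \<rho> (cube x0 r0) (cube x r)"
proof -
  define G where "G = {x \<in> \<Omega>. \<exists>r>0. cube x r \<subseteq> \<Omega> \<and> controls \<Omega> \<rho> (cube x0 r0) (cube x r)}"
  have "open G"
    unfolding open_contains_ball
  proof
    fix x assume "x \<in> G"
    then obtain r where r: "0 < r" "cube x r \<subseteq> \<Omega>" "controls \<Omega> \<rho> (cube x0 r0) (cube x r)"
      by (auto simp: G_def)
    have "y \<in> G" if "y \<in> ball x (r / 2)" for y
    proof -
      have sub: "cube y (r / 2) \<subseteq> cube x r"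
        using that by (intro cube_subset_cube) (simp add: dist_norm norm_minus_commute)
      moreover have "y \<in> cube y (r / 2)" using r by (simp add: mem_cube)
      ultimately show ?thesis
        unfolding G_def using r controls_mono[OF r(3) order_refl sub] by (auto intro!: exI[of _ "r / 2"])
    qed
    then show "\<exists>e>0. ball x e \<subseteq> G" using r by (intro exI[of _ "r / 2"]) auto
  qed
  moreover have "open (\<Omega> - G)"
    unfolding open_contains_ball
  proof
    fix x assume x: "x \<in> \<Omega> - G"
    obtain R where R: "0 < R" "R \<le> \<rho> / 4" "cube x R \<subseteq> \<Omega>"
      using cube_in_open[of \<Omega> x "\<rho> / 4"] assms x by auto
    have "y \<in> \<Omega> - G" if y: "y \<in> ball x R" for y
    proof -
      have "y \<notin> G"
      proof
        assume "y \<in> G"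
        then obtain r where r: "0 < r" "controls \<Omega> \<rho> (cube x0 r0) (cube y r)"
          by (auto simp: G_def)
        \<comment> \<open>Small enough for \<open>cube y s\<close> to lie both in the good cube
          around \<open>y\<close> and in \<open>cube x R\<close>.\<close>
        define s where "s = min r (R - norm (y - x))"
        have s: "0 < s" using y r by (simp add: s_def dist_norm norm_minus_commute)
        have "cube y s \<subseteq> cube y r" by (rule cube_subset_cube) (simp add: s_def)
        then have 1: "controls \<Omega> \<rho> (cube x0 r0) (cube y s)" using controls_mono[OF r(2)] by blast
        have "cube y s \<subseteq> cube x R" by (rule cube_subset_cube) (simp add: s_def)
        then have "controls \<Omega> \<rho> (cube y s) (cube x R)" using R s by (intro subcube_controls)
        with 1 have "controls \<Omega> \<rho> (cube x0 r0) (cube x R)" by (rule controls_trans)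
        then show False using x R by (auto simp: G_def)
      qed
      then show ?thesis using y R ball_subset_cube by blast
    qed
    then show "\<exists>e>0. ball x e \<subseteq> \<Omega> - G" using R by blast
  qed
  moreover have "x0 \<in> \<Omega> \<inter> G"
  proof -
    have "x0 \<in> cube x0 r0" using S by (simp add: mem_cube)
    moreover have "controls \<Omega> \<rho> (cube x0 r0) (cube x0 r0)"
      unfolding controls_def using propagates_refl[OF order_refl S(1)] by blast
    ultimately show ?thesis using S unfolding G_def by blast
  qed
  ultimately have "(\<Omega> - G) \<inter> \<Omega> = {}"
    using connectedD[OF assms(2), of G "\<Omega> - G"] by auto
  then have "x \<in> G" using assms by auto
  then show ?thesis by (auto simp: G_def)
qed

lemma cube_controls_compact:
  assumes "open \<Omega>" and "connected \<Omega>" and "0 < \<rho>" and S: "cube x0 r0 \<subseteq> \<Omega>" "0 < r0"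
    and K: "compact K" "K \<subseteq> \<Omega>"
  shows "controls \<Omega> \<rho> (cube x0 r0) K"
proof -
  have "\<forall>x\<in>K. \<exists>r>0. cube x r \<subseteq> \<Omega> \<and> controls \<Omega> \<rho> (cube x0 r0) (cube x r)"
    using cube_controls_nearby[OF assms(1-5)] K by blast
  then obtain r where r: "\<And>x. x \<in> K \<Longrightarrow> 0 < r x \<and> cube x (r x) \<subseteq> \<Omega> \<and> controls \<Omega> \<rho> (cube x0 r0) (cube x (r x))"
    by metis
  have "\<exists>I\<subseteq>K. finite I \<and> K \<subseteq> (\<Union>x\<in>I. ball x (r x))"
    by (rule compactE_image[OF K(1), of K "\<lambda>x. ball x (r x)"]) (use r in \<open>auto intro: centre_in_ball[THEN iffD2]\<close>)
  then obtain I where I: "I \<subseteq> K" "finite I" "K \<subseteq> (\<Union>x\<in>I. ball x (r x))" by blast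
  then have "K \<subseteq> (\<Union>x\<in>I. cube x (r x))" using ball_subset_cube by blast
  moreover have "controls \<Omega> \<rho> (cube x0 r0) (\<Union>x\<in>I. cube x (r x))"
    using I r by (intro controls_UN) (auto dest: subsetD)
  ultimately show ?thesis using controls_mono by blast
qed

section \<open>Strict differentiability and axis cones\<close>

lemma coordinate_lipschitz:
  fixes \<psi> :: "real ^ 'n::finite \<Rightarrow> real"
  assumes der: "\<And>z i. z \<in> cbox a b \<Longrightarrow> ((\<lambda>t. \<psi> (z + t *\<^sub>R axis i 1)) has_real_derivative D i z) (at 0)"
    and bd: "\<And>z i. z \<in> cbox a b \<Longrightarrow> \<bar>D i z\<bar> \<le> K"
    and x: "x \<in> cbox a b" and y: "y \<in> cbox a b"
  shows "\<bar>\<psi> x - \<psi> y\<bar> \<le> K * (\<Sum>i\<in>UNIV. \<bar>x $ i - y $ i\<bar>)"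
proof -
  have "\<bar>\<psi> x - \<psi> y\<bar> \<le> K * (\<Sum>i\<in>S. \<bar>x $ i - y $ i\<bar>)"
    if "finite S" "y \<in> cbox a b" "\<forall>j. j \<notin> S \<longrightarrow> x $ j = y $ j" for S y
    using that
  proof (induction S arbitrary: y)
    case empty
    then have "x = y" by (simp add: vec_eq_iff)
    then show ?case by simp
  next
    case (insert i S)
    \<comment> \<open>Coordinate \<open>i\<close> of \<open>y\<close> is replaced by that of
      \<open>x\<close>. A box contains all such mixtures of two of its points, so the connecting
      segment stays inside.\<close>
    define \<tau> where "\<tau> = x $ i - y $ i"
    define y' where "y' = y + \<tau> *\<^sub>R axis i 1"
    have y'i: "y' $ j = (if j = i then x $ i else y $ j)" for j
      by (simp add: y'_def \<tau>_def axis_def)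
    have y': "y' \<in> cbox a b" using x insert.prems(1) unfolding mem_box_cart y'i by auto
    have "\<bar>\<psi> x - \<psi> y'\<bar> \<le> K * (\<Sum>j\<in>S. \<bar>x $ j - y' $ j\<bar>)"
      using insert.prems(2) by (intro insert.IH y') (auto simp: y'i)
    also have "(\<Sum>j\<in>S. \<bar>x $ j - y' $ j\<bar>) = (\<Sum>j\<in>S. \<bar>x $ j - y $ j\<bar>)"
      using insert.hyps by (intro sum.cong) (auto simp: y'i)
    finally have 1: "\<bar>\<psi> x - \<psi> y'\<bar> \<le> K * (\<Sum>j\<in>S. \<bar>x $ j - y $ j\<bar>)" .
    have seg: "y + t *\<^sub>R axis i 1 \<in> cbox a b" if "t \<in> closed_segment 0 \<tau>" for t
    proof -
      have "y + t *\<^sub>R axis i 1 \<in> closed_segment y y'"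
        using that unfolding y'_def by (auto simp: in_segment algebra_simps intro!: exI)
      then show ?thesis using convex_contains_segment[of "cbox a b"] insert.prems(1) y' by auto
    qed
    have "norm ((\<lambda>t. \<psi> (y + t *\<^sub>R axis i 1)) \<tau> - (\<lambda>t. \<psi> (y + t *\<^sub>R axis i 1)) 0) \<le> K * norm (\<tau> - 0)"
    proof (rule field_differentiable_bound[where S = "closed_segment 0 \<tau>" and f' = "\<lambda>t. D i (y + t *\<^sub>R axis i 1)"])
      fix t assume t: "t \<in> closed_segment 0 \<tau>"
      have "((\<lambda>s. \<psi> (y + t *\<^sub>R axis i 1 + s *\<^sub>R axis i 1)) has_real_derivative D i (y + t *\<^sub>R axis i 1)) (at 0)"
        by (rule der[OF seg[OF t]])
      also have "(\<lambda>s. \<psi> (y + t *\<^sub>R axis i 1 + s *\<^sub>R axis i 1)) = (\<lambda>s. \<psi> (y + (s + t) *\<^sub>R axis i 1))"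
        by (simp add: scaleR_add_left add_ac)
      finally show "((\<lambda>t. \<psi> (y + t *\<^sub>R axis i 1)) has_real_derivative D i (y + t *\<^sub>R axis i 1))
          (at t within closed_segment 0 \<tau>)"
        using DERIV_shift[of "\<lambda>t. \<psi> (y + t *\<^sub>R axis i 1)" _ 0 t] by (simp add: has_field_derivative_at_within)
      show "norm (D i (y + t *\<^sub>R axis i 1)) \<le> K" using bd[OF seg[OF t]] by simp
    qed auto
    then have "\<bar>\<psi> y' - \<psi> y\<bar> \<le> K * \<bar>x $ i - y $ i\<bar>" by (simp add: y'_def \<tau>_def)
    with 1 show ?case using insert.hyps by (simp add: algebra_simps)
  qed
  from this[of UNIV y] y show ?thesis by simp
qed

text \<open>Both \<open>x\<close> and \<open>y\<close> vary, because cones of a common size are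
  needed at all points of \<Omega> near a boundary point. Continuity of the partial derivatives
  makes the function minus its linear part at \<open>p\<close> Lipschitz with a small
  constant.\<close>

lemma real_analytic_strictly_differentiable:
  fixes \<phi> :: "real ^ 'n::finite \<Rightarrow> real"
  assumes an: "real_analytic_on \<phi> U" and "open U" and "p \<in> U" and "0 < \<eta>"
  shows "\<exists>r>0. ball p r \<subseteq> U \<and> (\<forall>x\<in>ball p r. \<forall>y\<in>ball p r.
    \<bar>\<phi> x - \<phi> y - (\<Sum>i\<in>UNIV. partial_deriv i \<phi> p * (x $ i - y $ i))\<bar> \<le> \<eta> * norm (x - y))"
proof -
  \<comment> \<open>The coordinatewise estimate involves the l1-norm, which is at most
    \<open>CARD('n)\<close> times the Euclidean norm.\<close>
  define K where "K = \<eta> / real CARD('n)"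
  have K: "0 < K" using assms by (simp add: K_def)
  have "\<forall>\<^sub>F z in nhds p. \<bar>partial_deriv i \<phi> z - partial_deriv i \<phi> p\<bar> < K" for i
  proof -
    have "continuous_on U (partial_deriv i \<phi>)"
      by (intro real_analytic_on_continuous_on real_analytic_on_partial_deriv an)
    then have "isCont (partial_deriv i \<phi>) p" using assms by (simp add: continuous_on_eq_continuous_at)
    then have "(partial_deriv i \<phi> \<longlongrightarrow> partial_deriv i \<phi> p) (nhds p)"
      by (simp add: continuous_at tendsto_at_iff_tendsto_nhds)
    then show ?thesis using K by (auto dest!: tendstoD simp: dist_real_def)
  qed
  then have "\<forall>\<^sub>F z in nhds p. z \<in> U \<and> (\<forall>i\<in>UNIV. \<bar>partial_deriv i \<phi> z - partial_deriv i \<phi> p\<bar> < K)"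
    using eventually_nhds_in_open[OF assms(2,3)] by (intro eventually_conj eventually_ball_finite) auto
  then obtain V where V: "open V" "p \<in> V"
    "\<And>z. z \<in> V \<Longrightarrow> z \<in> U \<and> (\<forall>i\<in>UNIV. \<bar>partial_deriv i \<phi> z - partial_deriv i \<phi> p\<bar> < K)"
    unfolding eventually_nhds by blast
  obtain r where r: "0 < r" "cube p r \<subseteq> V" using cube_in_open[OF V(1,2), of 1] by auto
  define \<psi> where "\<psi> z = \<phi> z - (\<Sum>i\<in>UNIV. partial_deriv i \<phi> p * z $ i)" for z
  have "\<bar>\<phi> x - \<phi> y - (\<Sum>i\<in>UNIV. partial_deriv i \<phi> p * (x $ i - y $ i))\<bar> \<le> \<eta> * norm (x - y)"
    if "x \<in> ball p r" "y \<in> ball p r" for x y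
  proof -
    have "\<bar>\<psi> x - \<psi> y\<bar> \<le> K * (\<Sum>i\<in>UNIV. \<bar>x $ i - y $ i\<bar>)"
    proof (rule coordinate_lipschitz[where D = "\<lambda>i z. partial_deriv i \<phi> z - partial_deriv i \<phi> p"])
      fix z i assume "z \<in> cbox (p - vec r) (p + vec r)"
      then have z: "z \<in> V" using r by (auto simp: cube_def)
      have "((\<lambda>t. \<Sum>j\<in>UNIV. partial_deriv j \<phi> p * (z + t *\<^sub>R axis i 1) $ j) has_real_derivative
          (\<Sum>j\<in>UNIV. partial_deriv j \<phi> p * axis i 1 $ j)) (at 0)"
        by (auto intro!: derivative_eq_intros sum.cong simp: mult.commute)
      also have "(\<Sum>j\<in>UNIV. partial_deriv j \<phi> p * axis i 1 $ j) = partial_deriv i \<phi> p"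
        by (simp add: axis_def if_distrib[of "\<lambda>x. _ * x"] cong: if_cong)
      finally show "((\<lambda>t. \<psi> (z + t *\<^sub>R axis i 1)) has_real_derivative
          partial_deriv i \<phi> z - partial_deriv i \<phi> p) (at 0)"
        unfolding \<psi>_def using real_analytic_on_has_partial_deriv[OF an] V(3)[OF z]
        by (intro DERIV_diff) auto
      show "\<bar>partial_deriv i \<phi> z - partial_deriv i \<phi> p\<bar> \<le> K" using V(3)[OF z] by (simp add: less_imp_le)
    qed (use that ball_subset_cube[of p r] in \<open>auto simp: cube_def\<close>)
    also have "\<dots> \<le> K * (\<Sum>i\<in>(UNIV :: 'n set). norm (x - y))"
      using K component_le_norm_cart[of "x - y"] by (intro mult_left_mono sum_mono) auto
    also have "\<dots> = \<eta> * norm (x - y)" by (simp add: K_def)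
    also have "\<psi> x - \<psi> y = \<phi> x - \<phi> y - (\<Sum>i\<in>UNIV. partial_deriv i \<phi> p * (x $ i - y $ i))"
      by (simp add: \<psi>_def right_diff_distrib sum_subtractf)
    finally show ?thesis .
  qed
  moreover have "ball p r \<subseteq> U" using ball_subset_cube[of p r] r V(3) by blast
  ultimately show ?thesis using r by blast
qed

text \<open>A truncated cone with vertex \<open>x\<close>, written as a union of closed balls of
  radius \<open>\<kappa> * s\<close> about the points of its axis; \<sigma> is meant to be 1 or -1.
  The vertex, \<open>s = 0\<close>, is left out.\<close>

definition axis_cone :: "(real ^ 'n::finite) set \<Rightarrow> real ^ 'n \<Rightarrow> 'n \<Rightarrow> real \<Rightarrow> real \<Rightarrow> real \<Rightarrow> bool"
  where "axis_cone \<Omega> x j \<sigma> s0 \<kappa> \<longleftrightarrow>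
    (\<forall>s v. 0 < s \<longrightarrow> s \<le> s0 \<longrightarrow> norm v \<le> \<kappa> * s \<longrightarrow> x + (\<sigma> * s) *\<^sub>R axis j 1 + v \<in> \<Omega>)"

lemma axis_cone_mono:
  assumes "axis_cone \<Omega> x j \<sigma> s0 \<kappa>" and "s1 \<le> s0" and "\<kappa>' \<le> \<kappa>"
  shows "axis_cone \<Omega> x j \<sigma> s1 \<kappa>'"
  unfolding axis_cone_def
proof (intro allI impI)
  fix s :: real and v :: "real ^ 'a"
  assume s: "0 < s" "s \<le> s1" "norm v \<le> \<kappa>' * s"
  then have "\<kappa>' * s \<le> \<kappa> * s" using assms by (intro mult_right_mono) auto
  then have "norm v \<le> \<kappa> * s" "s \<le> s0" using s assms(2) by linarith+
  then show "x + (\<sigma> * s) *\<^sub>R axis j 1 + v \<in> \<Omega>" using assms(1) s unfolding axis_cone_def by blast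
qed

text \<open>The images of the basis vectors under an orthogonal map span the space, so only 0 is
  orthogonal to all of them.\<close>

lemma exists_axis_not_in_kernel:
  fixes A :: "real ^ 'n::finite \<Rightarrow> real ^ 'n"
  assumes "orthogonal_transformation A" and "w \<noteq> 0"
  shows "\<exists>j. w \<bullet> A (axis j 1) \<noteq> 0"
proof (rule ccontr)
  assume "\<not> ?thesis"
  then have 0: "w \<bullet> A (axis j 1) = 0" for j by blast
  have lin: "linear A" using assms by (simp add: orthogonal_transformation_linear)
  obtain z where z: "A z = w" using assms(1) orthogonal_transformation_surj by (metis surjD)
  have "A z = (\<Sum>j\<in>UNIV. z $ j *\<^sub>R A (axis j 1))"
  proof -
    have "A (\<Sum>j\<in>UNIV. z $ j *\<^sub>R axis j 1) = (\<Sum>j\<in>UNIV. z $ j *\<^sub>R A (axis j 1))"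
      using lin by (simp add: linear_sum linear_scale)
    moreover have "(\<Sum>j\<in>UNIV. z $ j *\<^sub>R axis j 1) = z"
      using basis_expansion[of z] by (simp add: scalar_mult_eq_scaleR)
    ultimately show ?thesis by simp
  qed
  then have "w \<bullet> w = w \<bullet> (\<Sum>j\<in>UNIV. z $ j *\<^sub>R A (axis j 1))" using z by simp
  also have "\<dots> = 0" by (simp add: inner_sum_right 0)
  finally show False using assms by simp
qed

text \<open>
  The gradient of the defining function does not vanish, so some coordinate direction of the original
  space, pulled back through the rigid motion, is transversal to the boundary.
\<close>

lemma axis_cone_at_boundary_point:
  fixes \<Omega> :: "(real ^ 'n::finite) set"
  assumes "analytic_boundary \<Omega>" and p: "p \<in> frontier \<Omega>"
  shows "\<exists>r s0 \<kappa> j \<sigma>. 0 < r \<and> 0 < s0 \<and> 0 < \<kappa> \<and> \<bar>\<sigma>\<bar> = 1 \<and> (\<forall>x\<in>ball p r \<inter> \<Omega>. axis_cone \<Omega> x j \<sigma> s0 \<kappa>)"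
proof -
  from assms obtain T U k \<phi> where T: "rigid_motion T" and U: "open U" "T p \<in> U"
    and inv: "\<And>y s. \<phi> (y + s *\<^sub>R axis k 1) = \<phi> y" and an: "real_analytic_on \<phi> U"
    and above: "U \<inter> T ` \<Omega> = {y \<in> U. y $ k > \<phi> y}"
    unfolding analytic_boundary_def by blast
  from T obtain A b where A: "orthogonal_transformation A" and TA: "T = (\<lambda>x. A x + b)"
    unfolding rigid_motion_def by blast
  have lin: "linear A" using A by (simp add: orthogonal_transformation_linear)
  have nA: "norm (A v) = norm v" for v using A by (simp add: orthogonal_transformation_norm)
  have injT: "T x = T y \<Longrightarrow> x = y" for x y
    using orthogonal_transformation_inj[OF A] by (auto simp: TA inj_def)
  have Tadd: "T (x + v) = T x + A v" for x v using lin by (simp add: TA linear_add)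
  have Tdist: "dist (T x) (T y) = dist x y" for x y
    using nA[of "x - y"] lin by (simp add: TA dist_norm linear_diff)
  \<comment> \<open>The gradient at \<open>T p\<close> of \<open>y $ k - \<phi> y\<close>, which
    inside \<open>U\<close> is positive exactly on the image of \<Omega>. Its k-th entry is 1
    because \<phi> does not depend on that coordinate.\<close>
  define w where "w = axis k 1 - (\<chi> i. partial_deriv i \<phi> (T p))"
  have wv: "w \<bullet> v = v $ k - (\<Sum>i\<in>UNIV. partial_deriv i \<phi> (T p) * v $ i)" for v
  proof -
    have "axis k 1 \<bullet> v = v $ k" by (simp add: inner_axis')
    moreover have "(\<chi> i. partial_deriv i \<phi> (T p)) \<bullet> v = (\<Sum>i\<in>UNIV. partial_deriv i \<phi> (T p) * v $ i)"
      by (simp add: inner_vec_def)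
    ultimately show ?thesis unfolding w_def inner_diff_left by simp
  qed
  have "partial_deriv k \<phi> (T p) = 0" by (simp add: partial_deriv_def inv)
  then have "w $ k = 1" by (simp add: w_def)
  then have "w \<noteq> 0" by auto
  then obtain j where j: "w \<bullet> A (axis j 1) \<noteq> 0" using exists_axis_not_in_kernel[OF A] by blast
  define d where "d = \<bar>w \<bullet> A (axis j 1)\<bar>"
  have d: "0 < d" using j by (simp add: d_def)
  define \<sigma> where "\<sigma> = sgn (w \<bullet> A (axis j 1))"
  have \<sigma>: "\<bar>\<sigma>\<bar> = 1" using j by (simp add: \<sigma>_def abs_sgn_eq)
  have \<sigma>d: "w \<bullet> A (axis j 1) * \<sigma> = d" unfolding d_def \<sigma>_def by (simp add: abs_sgn)
  \<comment> \<open>Lets the deviation \<open>v\<close> from the axis cost at most a quarter of the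
    gain \<open>s * d\<close> along it; the bound by 1 gives
    \<open>norm u \<le> 2 * s\<close>.\<close>
  define \<kappa> where "\<kappa> = min 1 (d / (4 * (norm w + 1)))"
  have \<kappa>: "0 < \<kappa>" "\<kappa> \<le> 1" "norm w * \<kappa> \<le> d / 4"
  proof -
    have "norm w * \<kappa> \<le> norm w * (d / (4 * (norm w + 1)))" by (intro mult_left_mono) (auto simp: \<kappa>_def)
    also have "\<dots> = (d / 4) * (norm w / (norm w + 1))" by simp
    also have "\<dots> \<le> (d / 4) * 1" using d add_nonneg_pos[of "norm w" 1] by (intro mult_left_mono) auto
    finally show "norm w * \<kappa> \<le> d / 4" by simp
  qed (use d in \<open>auto simp: \<kappa>_def add_nonneg_pos\<close>)
  \<comment> \<open>With \<open>norm u \<le> 2 * s\<close>, the tolerance \<open>d / 8\<close> keeps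
    the nonlinear error below another quarter of \<open>s * d\<close>, so half of the gain
    survives.\<close>
  obtain r where r: "0 < r" "ball (T p) r \<subseteq> U"
    and strict: "\<And>x y. x \<in> ball (T p) r \<Longrightarrow> y \<in> ball (T p) r \<Longrightarrow>
      \<bar>\<phi> x - \<phi> y - (\<Sum>i\<in>UNIV. partial_deriv i \<phi> (T p) * (x $ i - y $ i))\<bar> \<le> d / 8 * norm (x - y)"
    using real_analytic_strictly_differentiable[OF an U, of "d / 8"] d by auto
  have "x + (\<sigma> * s) *\<^sub>R axis j 1 + v \<in> \<Omega>"
    if x: "x \<in> ball p (r / 2) \<inter> \<Omega>" and s: "0 < s" "s \<le> r / 4" and v: "norm v \<le> \<kappa> * s" for x s v
  proof -
    define u where "u = (\<sigma> * s) *\<^sub>R axis j 1 + v"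
    have vs: "norm v \<le> s" using v \<kappa> s mult_right_mono[of \<kappa> 1 s] by linarith
    have nu: "norm u \<le> 2 * s"
    proof -
      have "norm u \<le> norm ((\<sigma> * s) *\<^sub>R axis j (1::real)) + norm v" unfolding u_def by (rule norm_triangle_ineq)
      also have "norm ((\<sigma> * s) *\<^sub>R axis j (1::real)) = s" using \<sigma> s by (simp add: norm_axis_real abs_mult)
      finally show ?thesis using vs by simp
    qed
    have 1: "T x \<in> ball (T p) r" using x r by (auto simp: Tdist)
    have "dist p (x + u) \<le> dist p x + norm u"
      using dist_triangle[of p "x + u" x] by (simp add: dist_norm)
    also have "\<dots> < r" using x nu s by auto
    finally have 2: "T (x + u) \<in> ball (T p) r" by (simp add: Tdist)
    have "T x \<in> U \<inter> T ` \<Omega>" using 1 r x by auto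
    then have h: "T x $ k > \<phi> (T x)" using above by blast
    have "w \<bullet> A u = s * d + w \<bullet> A v"
    proof -
      have "A u = (\<sigma> * s) *\<^sub>R A (axis j 1) + A v"
        unfolding u_def using lin by (simp add: linear_add linear_scale)
      then have "w \<bullet> A u = s * (w \<bullet> A (axis j 1) * \<sigma>) + w \<bullet> A v"
        by (simp add: inner_add_right)
      then show ?thesis unfolding \<sigma>d .
    qed
    moreover have "\<bar>w \<bullet> A v\<bar> \<le> s * d / 4"
    proof -
      have "\<bar>w \<bullet> A v\<bar> \<le> norm w * norm v" using Cauchy_Schwarz_ineq2[of w "A v"] by (simp add: nA)
      also have "\<dots> \<le> norm w * (\<kappa> * s)" using v by (intro mult_left_mono) auto
      also have "\<dots> \<le> d / 4 * s" using \<kappa>(3) s mult_right_mono[of "norm w * \<kappa>" "d / 4" s] by simp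
      finally show ?thesis by (simp add: mult_ac)
    qed
    moreover have "\<bar>\<phi> (T (x + u)) - \<phi> (T x) - (\<Sum>i\<in>UNIV. partial_deriv i \<phi> (T p) * A u $ i)\<bar> \<le> s * d / 4"
    proof -
      have "\<bar>\<phi> (T (x + u)) - \<phi> (T x) - (\<Sum>i\<in>UNIV. partial_deriv i \<phi> (T p) * A u $ i)\<bar> \<le> d / 8 * norm u"
        using strict[OF 2 1] by (simp add: Tadd nA)
      also have "\<dots> \<le> d / 8 * (2 * s)" using nu d by (intro mult_left_mono) auto
      finally show ?thesis by (simp add: mult_ac)
    qed
    moreover have "T (x + u) $ k = T x $ k + A u $ k" by (simp add: Tadd)
    moreover have "0 < s * d" using s d by simp
    ultimately have "\<phi> (T (x + u)) < T (x + u) $ k" using wv[of "A u"] h by linarith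
    then have "T (x + u) \<in> U \<inter> T ` \<Omega>" using above 2 r(2) by blast
    then have "x + u \<in> \<Omega>" using injT by blast
    then show ?thesis by (simp add: u_def add.assoc)
  qed
  then show ?thesis using r(1) \<kappa>(1) \<sigma>
    by (intro exI[of _ "r / 2"] exI[of _ "r / 4"] exI[of _ \<kappa>] exI[of _ j] exI[of _ \<sigma>])
       (auto simp: axis_cone_def)
qed

lemma uniform_axis_cone:
  fixes \<Omega> :: "(real ^ 'n::finite) set"
  assumes "analytic_boundary \<Omega>" and "open \<Omega>" and "bounded \<Omega>"
  shows "\<exists>s0 \<kappa>. 0 < s0 \<and> 0 < \<kappa> \<and> (\<forall>x\<in>\<Omega>. \<exists>j \<sigma>. \<bar>\<sigma>\<bar> = 1 \<and> axis_cone \<Omega> x j \<sigma> s0 \<kappa>)"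
proof -
  have "\<exists>r s0 \<kappa> j \<sigma>. 0 < r \<and> 0 < s0 \<and> 0 < \<kappa> \<and> \<bar>\<sigma>\<bar> = 1 \<and> (\<forall>x\<in>ball p r \<inter> \<Omega>. axis_cone \<Omega> x j \<sigma> s0 \<kappa>)"
    if "p \<in> closure \<Omega>" for p
  proof (cases "p \<in> \<Omega>")
    case True
    then obtain R where R: "0 < R" "ball p R \<subseteq> \<Omega>" using assms by (auto simp: open_contains_ball)
    \<comment> \<open>Well inside \<Omega> every direction serves; \<open>undefined\<close> stands
      for an arbitrary axis.\<close>
    have "axis_cone \<Omega> x undefined 1 (R / 4) 1" if x: "x \<in> ball p (R / 2)" for x
      unfolding axis_cone_def
    proof (intro allI impI)
      fix s :: real and v :: "real ^ 'n"
      assume s: "0 < s" "s \<le> R / 4" "norm v \<le> 1 * s"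
      have eq: "x + (1 * s) *\<^sub>R axis undefined 1 + v = x + (s *\<^sub>R axis undefined 1 + v)"
        by (simp add: add.assoc)
      have "dist p (x + (s *\<^sub>R axis undefined 1 + v)) \<le> dist p x + norm (s *\<^sub>R axis undefined (1::real) + v)"
        using norm_triangle_ineq4[of "p - x" "s *\<^sub>R axis undefined 1 + v"] unfolding dist_norm diff_diff_eq .
      also have "norm (s *\<^sub>R axis undefined (1::real) + v) \<le> s + norm v"
        using norm_triangle_ineq[of "s *\<^sub>R axis undefined 1" v] s by (simp add: norm_axis_real)
      also have "dist p x + (s + norm v) < R" using x s by auto
      finally have "x + (1 * s) *\<^sub>R axis undefined 1 + v \<in> ball p R" unfolding eq by simp
      then show "x + (1 * s) *\<^sub>R axis undefined 1 + v \<in> \<Omega>" using R by blast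
    qed
    then show ?thesis using R
      by (intro exI[of _ "R / 2"] exI[of _ "R / 4"] exI[of _ 1] exI[of _ undefined] exI[of _ 1]) auto
  next
    case False
    then have "p \<in> frontier \<Omega>" using that assms by (simp add: frontier_def interior_open)
    then show ?thesis by (rule axis_cone_at_boundary_point[OF assms(1)])
  qed
  then obtain r s0 \<kappa> j \<sigma> where c: "\<And>p. p \<in> closure \<Omega> \<Longrightarrow> 0 < r p \<and> 0 < s0 p \<and> 0 < \<kappa> p \<and> \<bar>\<sigma> p\<bar> = 1 \<and>
      (\<forall>x\<in>ball p (r p) \<inter> \<Omega>. axis_cone \<Omega> x (j p) (\<sigma> p) (s0 p) (\<kappa> p))"
    by metis
  have "compact (closure \<Omega>)" using assms by simp
  then have "\<exists>I\<subseteq>closure \<Omega>. finite I \<and> closure \<Omega> \<subseteq> (\<Union>p\<in>I. ball p (r p))"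
    by (rule compactE_image[of _ "closure \<Omega>" "\<lambda>p. ball p (r p)"]) (use c in \<open>auto intro: centre_in_ball[THEN iffD2]\<close>)
  then obtain I where I: "I \<subseteq> closure \<Omega>" "finite I" "closure \<Omega> \<subseteq> (\<Union>p\<in>I. ball p (r p))" by blast
  define s1 where "s1 = Min (insert 1 (s0 ` I))"
  define \<kappa>1 where "\<kappa>1 = Min (insert 1 (\<kappa> ` I))"
  have "0 < s1" unfolding s1_def using I c by (subst Min_gr_iff) auto
  moreover have "0 < \<kappa>1" unfolding \<kappa>1_def using I c by (subst Min_gr_iff) auto
  moreover have "\<exists>j \<sigma>. \<bar>\<sigma>\<bar> = 1 \<and> axis_cone \<Omega> x j \<sigma> s1 \<kappa>1" if x: "x \<in> \<Omega>" for x
  proof -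
    have "x \<in> closure \<Omega>" using x closure_subset by blast
    then obtain p where p: "p \<in> I" "x \<in> ball p (r p)" using I by blast
    then have "axis_cone \<Omega> x (j p) (\<sigma> p) (s0 p) (\<kappa> p)" "\<bar>\<sigma> p\<bar> = 1" using c I x by blast+
    moreover have "s1 \<le> s0 p" "\<kappa>1 \<le> \<kappa> p" using p I by (auto simp: s1_def \<kappa>1_def)
    ultimately show ?thesis using axis_cone_mono by blast
  qed
  ultimately show ?thesis by blast
qed


section \<open>Propagation to the whole domain and interpolation\<close>

text \<open>On the axis of the cone at \<open>x\<close>, points at distance between
  \<open>s / 2\<close> and \<open>s\<close> have a ball of radius \<open>\<kappa> * (s / 2)\<close>
  inside \<Omega>. They fill half of a segment starting at \<open>x\<close>, and the interval
  estimate carries smallness to its end point.\<close>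

lemma interior_controls_domain:
  fixes \<Omega> :: "(real ^ 'n::finite) set"
  assumes cone: "\<And>x. x \<in> \<Omega> \<Longrightarrow> \<exists>j \<sigma>. \<bar>\<sigma>\<bar> = 1 \<and> axis_cone \<Omega> x j \<sigma> s \<kappa>"
    and s: "0 < s" "s \<le> \<rho> / 2" and "0 < \<kappa>" and "0 < \<rho>"
  shows "controls \<Omega> \<rho> {z. ball z (\<kappa> * (s / 2)) \<subseteq> \<Omega>} \<Omega>"
proof -
  define K where "K = {z. ball z (\<kappa> * (s / 2)) \<subseteq> \<Omega>}"
  define B where "B = 2 * exp 1 * s / (s / 2)"
  define \<theta> where "\<theta> = ln 2 / ln (2 * B)"
  have "propagates \<Omega> \<rho> (2 * B + 1) \<theta> K \<Omega>"
    unfolding propagates_def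
  proof (intro conjI allI impI ballI)
    show "1 \<le> 2 * B + 1" "0 < \<theta>" "\<theta> < 1"
      using axis_constants[of "s / 2" s] s unfolding B_def \<theta>_def by auto
    fix M f \<delta> x
    assume f: "analytic_class \<Omega> \<rho> M f" and \<delta>: "0 < \<delta>" and small: "\<forall>x\<in>K. \<bar>f x\<bar> \<le> M * \<delta>" and x: "x \<in> \<Omega>"
    obtain j \<sigma> where \<sigma>: "\<bar>\<sigma>\<bar> = 1" and c: "axis_cone \<Omega> x j \<sigma> s \<kappa>" using cone[OF x] by blast
    have in\<Omega>: "x + (\<sigma> * t) *\<^sub>R axis j 1 \<in> \<Omega>" if "0 \<le> t" "t \<le> s" for t
    proof (cases "t = 0")
      case False
      then have "x + (\<sigma> * t) *\<^sub>R axis j 1 + 0 \<in> \<Omega>"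
        using c that \<open>0 < \<kappa>\<close> unfolding axis_cone_def by (metis less_eq_real_def mult_nonneg_nonneg norm_zero)
      then show ?thesis by simp
    qed (use x in simp)
    have inK: "x + (\<sigma> * t) *\<^sub>R axis j 1 \<in> K" if t: "s / 2 \<le> t" "t \<le> s" for t
      unfolding K_def
    proof (rule CollectI, rule subsetI)
      fix y assume "y \<in> ball (x + (\<sigma> * t) *\<^sub>R axis j 1) (\<kappa> * (s / 2))"
      then have "norm (y - (x + (\<sigma> * t) *\<^sub>R axis j 1)) \<le> \<kappa> * (s / 2)"
        by (simp add: dist_norm norm_minus_commute)
      also have "\<dots> \<le> \<kappa> * t" using t \<open>0 < \<kappa>\<close> by (intro mult_left_mono) auto
      finally have "x + (\<sigma> * t) *\<^sub>R axis j 1 + (y - (x + (\<sigma> * t) *\<^sub>R axis j 1)) \<in> \<Omega>"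
        using c t s unfolding axis_cone_def by (meson half_gt_zero less_le_trans)
      then show "y \<in> \<Omega>" by simp
    qed
    \<comment> \<open>\<open>axis_propagation\<close> parametrises lines by the positive axis
      direction, so for \<open>\<sigma> = -1\<close> the interval is reflected.\<close>
    consider "\<sigma> = 1" | "\<sigma> = -1" using \<sigma> by (auto simp: abs_if split: if_splits)
    then show "\<bar>f x\<bar> \<le> M * ((2 * B + 1) * \<delta> powr \<theta>)"
    proof cases
      case 1
      show ?thesis
        unfolding B_def \<theta>_def
        by (rule axis_propagation[OF f \<open>0 < \<rho>\<close>, where a = 0 and b = s and i = j and E = "{s / 2..s}"])
           (use s \<delta> small inK in\<Omega> 1 in auto)
    next
      case 2
      have in\<Omega>': "x + t *\<^sub>R axis j 1 \<in> \<Omega>" if "- s \<le> t" "t \<le> 0" for t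
        using in\<Omega>[of "- t"] that 2 by simp
      have inK': "x + t *\<^sub>R axis j 1 \<in> K" if "- s \<le> t" "t \<le> - (s / 2)" for t
        using inK[of "- t"] that 2 by simp
      show ?thesis
        unfolding B_def \<theta>_def
        by (rule axis_propagation[OF f \<open>0 < \<rho>\<close>, where a = "- s" and b = 0 and i = j and E = "{- s..- (s / 2)}"])
           (use s \<delta> small inK' in\<Omega>' in auto)
    qed
  qed
  then show ?thesis unfolding controls_def K_def by blast
qed

text \<open>Two links: from the cube to the compact set \<open>K\<close> of points at least
  \<open>\<kappa> * (s / 2)\<close> away from the complement of \<Omega>, and from \<open>K\<close>
  to \<Omega> by the cones.\<close>

lemma cube_controls_domain:
  fixes \<Omega> :: "(real ^ 'n::finite) set"
  assumes "open \<Omega>" and "connected \<Omega>" and "bounded \<Omega>" and "analytic_boundary \<Omega>" and "0 < \<rho>"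
    and S: "cube x0 r0 \<subseteq> \<Omega>" "0 < r0"
  shows "controls \<Omega> \<rho> (cube x0 r0) \<Omega>"
proof -
  obtain s0 \<kappa> where s0: "0 < s0" "0 < \<kappa>" and cone: "\<And>x. x \<in> \<Omega> \<Longrightarrow> \<exists>j \<sigma>. \<bar>\<sigma>\<bar> = 1 \<and> axis_cone \<Omega> x j \<sigma> s0 \<kappa>"
    using uniform_axis_cone[OF assms(4,1,3)] by blast
  define s where "s = min s0 (\<rho> / 2)"
  have s: "0 < s" "s \<le> \<rho> / 2" "s \<le> s0" using s0 assms by (auto simp: s_def)
  define K where "K = {z. ball z (\<kappa> * (s / 2)) \<subseteq> \<Omega>}"
  have c0: "0 < \<kappa> * (s / 2)" using s s0 by simp
  have "controls \<Omega> \<rho> K \<Omega>"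
    unfolding K_def
    by (rule interior_controls_domain[OF _ s(1,2) s0(2) assms(5)]) (use cone s in \<open>meson axis_cone_mono order_refl\<close>)
  moreover have "controls \<Omega> \<rho> (cube x0 r0) K"
  proof (rule cube_controls_compact[OF assms(1,2,5) S])
    show sub: "K \<subseteq> \<Omega>" using c0 by (auto simp: K_def)
    have "- K = (\<Union>y\<in>- \<Omega>. ball y (\<kappa> * (s / 2)))"
      by (auto simp: K_def dist_commute)
    then have "closed K" unfolding closed_def by (simp add: open_UN)
    then show "compact K" using bounded_subset[OF assms(3) sub] by (simp add: compact_eq_bounded_closed)
  qed
  ultimately show ?thesis using controls_trans by blast
qed

text \<open>The cubes are fixed before \<open>E\<close>: they cover a compact part of \<Omega> that
  omits measure less than \<open>m / 2\<close>. By pigeonhole every admissible \<open>E\<close> has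
  a definite amount of measure in one of them, and each cube has constants valid for all such
  pieces.\<close>

lemma measurable_set_propagates:
  fixes \<Omega> :: "(real ^ 'n::finite) set"
  assumes "open \<Omega>" and "connected \<Omega>" and "bounded \<Omega>" and "analytic_boundary \<Omega>" and "0 < \<rho>" and "0 < m"
  shows "\<exists>C \<theta>. 1 \<le> C \<and> 0 < \<theta> \<and> \<theta> < 1 \<and>
    (\<forall>E. E \<in> sets lebesgue \<longrightarrow> E \<subseteq> \<Omega> \<longrightarrow> m \<le> measure lebesgue E \<longrightarrow> propagates \<Omega> \<rho> C \<theta> E \<Omega>)"
proof -
  have \<Omega>m: "\<Omega> \<in> lmeasurable" using assms by (simp add: lmeasurable_open)
  obtain K where K: "closed K" "K \<subseteq> \<Omega>" "\<Omega> - K \<in> lmeasurable" "emeasure lebesgue (\<Omega> - K) < ennreal (m / 2)"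
    using sets_lebesgue_inner_closed[of \<Omega> "m / 2"] \<Omega>m assms(6) by auto
  have Km: "measure lebesgue (\<Omega> - K) < m / 2"
    using K(3,4) assms(6) by (simp add: emeasure_eq_measure2 ennreal_less_iff)
  have "compact K" using K bounded_subset[OF assms(3)] by (simp add: compact_eq_bounded_closed)
  have "\<forall>x\<in>K. \<exists>r>0. r \<le> \<rho> / 4 \<and> cube x r \<subseteq> \<Omega>"
    using cube_in_open[OF assms(1)] K(2) assms(5) by (metis subsetD zero_less_divide_iff zero_less_numeral)
  then obtain r where r: "\<And>x. x \<in> K \<Longrightarrow> 0 < r x \<and> r x \<le> \<rho> / 4 \<and> cube x (r x) \<subseteq> \<Omega>" by metis
  have "\<exists>I\<subseteq>K. finite I \<and> K \<subseteq> (\<Union>x\<in>I. ball x (r x))"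
    by (rule compactE_image[OF \<open>compact K\<close>, of K "\<lambda>x. ball x (r x)"])
       (use r in \<open>auto intro: centre_in_ball[THEN iffD2]\<close>)
  then obtain I where I: "I \<subseteq> K" "finite I" "K \<subseteq> (\<Union>x\<in>I. ball x (r x))" by blast
  then have cover: "K \<subseteq> (\<Union>x\<in>I. cube x (r x))" using ball_subset_cube by blast
  \<comment> \<open>If every cube held at most \<open>2 * \<mu>\<close> of \<open>E\<close>,
    together they would hold at most \<open>m / 2\<close>, and \<open>\<Omega> - K\<close> has
    measure less than \<open>m / 2\<close>. The summand 1 avoids division by zero.\<close>
  define \<mu> where "\<mu> = m / (4 * (real (card I) + 1))"
  have \<mu>: "0 < \<mu>" using assms(6) by (simp add: \<mu>_def)
  define F where "F x = {E. E \<in> sets borel \<and> E \<subseteq> cube x (r x) \<and> \<mu> \<le> measure lborel E}" for x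
  have "\<exists>C \<theta>. 1 \<le> C \<and> 0 < \<theta> \<and> \<theta> < 1 \<and> (\<forall>S\<in>F x. propagates \<Omega> \<rho> C \<theta> S \<Omega>)" if "x \<in> I" for x
  proof -
    have rx: "0 < r x" "r x \<le> \<rho> / 4" "cube x (r x) \<subseteq> \<Omega>" using r I that by auto
    obtain C \<theta> where 1: "1 \<le> C" "0 < \<theta>" "\<theta> < 1"
      "\<And>E. E \<in> sets borel \<Longrightarrow> E \<subseteq> cube x (r x) \<Longrightarrow> \<mu> \<le> measure lborel E \<Longrightarrow> propagates \<Omega> \<rho> C \<theta> E (cube x (r x))"
      using cube_family_propagates[OF rx(3,1,2) \<mu>] by metis
    obtain C' \<theta>' where 2: "propagates \<Omega> \<rho> C' \<theta>' (cube x (r x)) \<Omega>"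
      using cube_controls_domain[OF assms(1-5) rx(3,1)] by (auto simp: controls_def)
    then have c': "1 \<le> C'" "0 < \<theta>'" "\<theta>' < 1" by (auto simp: propagates_def)
    have "1 * 1 \<le> C' * C powr \<theta>'" using 1 c' by (intro mult_mono ge_one_powr_ge_zero) auto
    moreover have "\<theta> * \<theta>' < 1 * 1" using 1 c' by (intro mult_strict_mono) auto
    moreover have "propagates \<Omega> \<rho> (C' * C powr \<theta>') (\<theta> * \<theta>') S \<Omega>" if "S \<in> F x" for S
      using that by (intro propagates_trans[OF 1(4) 2]) (auto simp: F_def)
    ultimately show ?thesis using 1 c'
      by (intro exI[of _ "C' * C powr \<theta>'"] exI[of _ "\<theta> * \<theta>'"]) auto
  qed
  from finite_common_constants[of I F \<Omega> \<rho> "\<lambda>_. \<Omega>", OF I(2) this order_refl] obtain C \<theta>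
    where C: "1 \<le> C" "0 < \<theta>" "\<theta> < 1" and propE: "\<And>x S. x \<in> I \<Longrightarrow> S \<in> F x \<Longrightarrow> propagates \<Omega> \<rho> C \<theta> S \<Omega>"
    by metis
  have "propagates \<Omega> \<rho> C \<theta> E \<Omega>" if E: "E \<in> sets lebesgue" "E \<subseteq> \<Omega>" "m \<le> measure lebesgue E" for E
  proof -
    have Em: "E \<in> lmeasurable" using E assms(3) bounded_subset by (blast intro: bounded_set_imp_lmeasurable)
    have cm: "E \<inter> cube x (r x) \<in> sets lebesgue" for x
      using E(1) by (intro sets.Int) (auto simp: cube_def)
    have "\<exists>x\<in>I. 2 * \<mu> \<le> measure lebesgue (E \<inter> cube x (r x))"
    proof (rule ccontr)
      assume "\<not> ?thesis"
      then have lt: "\<And>x. x \<in> I \<Longrightarrow> measure lebesgue (E \<inter> cube x (r x)) \<le> 2 * \<mu>" by (force intro: less_imp_le)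
      have fmU: "(\<Union>x\<in>I. E \<inter> cube x (r x)) \<in> lmeasurable"
        using Em I(2) by (intro fmeasurable.finite_UN) (auto simp: cube_def intro!: fmeasurable_Int_fmeasurable)
      have "measure lebesgue E \<le> measure lebesgue ((\<Omega> - K) \<union> (\<Union>x\<in>I. E \<inter> cube x (r x)))"
        using E cover K(3) fmU by (intro measure_mono_fmeasurable) (auto intro: fmeasurable.Un)
      also have "\<dots> \<le> measure lebesgue (\<Omega> - K) + measure lebesgue (\<Union>x\<in>I. E \<inter> cube x (r x))"
        using K(3) fmU by (intro measure_Un_le) auto
      also have "measure lebesgue (\<Union>x\<in>I. E \<inter> cube x (r x)) \<le> (\<Sum>x\<in>I. measure lebesgue (E \<inter> cube x (r x)))"
        using I(2) cm by (intro measure_UNION_le) auto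
      also have "\<dots> \<le> (\<Sum>x\<in>I. 2 * \<mu>)" using lt by (intro sum_mono) auto
      also have "\<dots> = real (card I) * (2 * \<mu>)" by simp
      also have "\<dots> \<le> (real (card I) + 1) * (2 * \<mu>)" using \<mu> by (intro mult_right_mono) auto
      also have "\<dots> = m / 2" by (simp add: \<mu>_def field_simps add_nonneg_pos)
      finally show False using Km E(3) by simp
    qed
    then obtain x where x: "x \<in> I" "2 * \<mu> \<le> measure lebesgue (E \<inter> cube x (r x))" by blast
    \<comment> \<open>The cube estimate is about Borel sets. Inner approximation by a closed set
      gives up less than \<mu> of the available \<open>2 * \<mu>\<close>.\<close>
    obtain T where T: "closed T" "T \<subseteq> E \<inter> cube x (r x)" "E \<inter> cube x (r x) - T \<in> lmeasurable"
      "emeasure lebesgue (E \<inter> cube x (r x) - T) < ennreal \<mu>"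
      using sets_lebesgue_inner_closed[OF cm[of x] \<mu>] by metis
    have "measure lebesgue (E \<inter> cube x (r x) - T) < \<mu>"
      using T(3,4) \<mu> by (simp add: emeasure_eq_measure2 ennreal_less_iff)
    moreover have Tl: "T \<in> lmeasurable"
      using T(1,2) Em by (intro fmeasurableI2[OF Em]) auto
    moreover have "measure lebesgue (E \<inter> cube x (r x)) \<le> measure lebesgue T + measure lebesgue (E \<inter> cube x (r x) - T)"
    proof -
      have "E \<inter> cube x (r x) = T \<union> (E \<inter> cube x (r x) - T)" using T by blast
      then show ?thesis using measure_Un_le[of T lebesgue "E \<inter> cube x (r x) - T"] Tl T(3) by (metis fmeasurableD)
    qed
    ultimately have "\<mu> \<le> measure lebesgue T" using x by linarith
    then have "T \<in> F x" using T by (auto simp: F_def borel_closed)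
    then show ?thesis using propE[OF x(1)] T(2) propagates_mono by blast
  qed
  then show ?thesis using C by blast
qed

text \<open>Chebyshev's inequality: off the sublevel set \<open>\<bar>f x\<bar>\<close> exceeds
  \<open>2 * \<eta>\<close>, twice the bound on its mean, so that part has at most half the measure.
  The last conclusion later shows that the mean is at most \<open>M\<close>.\<close>

lemma measure_sublevel_ge:
  fixes f :: "real ^ 'n::finite \<Rightarrow> real"
  assumes "open \<Omega>" and cont: "continuous_on \<Omega> f" and bd: "\<And>x. x \<in> \<Omega> \<Longrightarrow> \<bar>f x\<bar> \<le> M"
    and \<omega>: "\<omega> \<in> lmeasurable" "\<omega> \<subseteq> \<Omega>" and \<eta>: "0 < \<eta>"
    and int: "(LINT x:\<omega>|lebesgue. \<bar>f x\<bar>) \<le> measure lebesgue \<omega> * \<eta>"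
  shows "{x \<in> \<omega>. \<bar>f x\<bar> \<le> 2 * \<eta>} \<in> sets lebesgue"
    and "measure lebesgue \<omega> / 2 \<le> measure lebesgue {x \<in> \<omega>. \<bar>f x\<bar> \<le> 2 * \<eta>}"
    and "(LINT x:\<omega>|lebesgue. \<bar>f x\<bar>) \<le> measure lebesgue \<omega> * M"
proof -
  have \<Omega>l: "\<Omega> \<in> sets lebesgue" using assms(1) by auto
  have [measurable]: "\<omega> \<in> sets lebesgue" using \<omega> by auto
  define g where "g x = indicator \<Omega> x *\<^sub>R f x" for x
  have "f \<in> borel_measurable (lebesgue_on \<Omega>)"
    by (rule continuous_imp_measurable_on_sets_lebesgue[OF cont \<Omega>l])
  then have [measurable]: "g \<in> borel_measurable lebesgue"
    unfolding g_def using \<Omega>l by (subst (asm) borel_measurable_restrict_space_iff) auto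
  have g: "g x = f x" if "x \<in> \<omega>" for x using that \<omega> by (auto simp: g_def)
  define E where "E = {x \<in> \<omega>. \<bar>f x\<bar> \<le> 2 * \<eta>}"
  have "E = {x \<in> space lebesgue. x \<in> \<omega> \<and> \<bar>g x\<bar> \<le> 2 * \<eta>}" using g by (auto simp: E_def)
  also have "\<dots> \<in> sets lebesgue" by measurable
  finally have [measurable]: "E \<in> sets lebesgue" .
  then show "{x \<in> \<omega>. \<bar>f x\<bar> \<le> 2 * \<eta>} \<in> sets lebesgue" by (simp add: E_def)
  have fin: "emeasure lebesgue \<omega> < \<infinity>" using \<omega> by (auto simp: fmeasurable_def)
  have intg: "integrable lebesgue (\<lambda>x. indicator \<omega> x *\<^sub>R \<bar>g x\<bar>)"
    using fin bd \<omega>(2) by (intro integrableI_bounded_set_indicator[where B = M]) (auto simp: g)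
  have ig: "(LINT x:\<omega>|lebesgue. \<bar>f x\<bar>) = (\<integral>x. indicator \<omega> x *\<^sub>R \<bar>g x\<bar> \<partial>lebesgue)"
    unfolding set_lebesgue_integral_def by (intro Bochner_Integration.integral_cong) (auto simp: indicator_def g)
  have El: "\<omega> - E \<in> lmeasurable" using \<omega> by (intro fmeasurableI2[OF \<omega>(1)]) auto
  have "measure lebesgue (\<omega> - E) * (2 * \<eta>) = (\<integral>x. indicator (\<omega> - E) x * (2 * \<eta>) \<partial>lebesgue)"
    using El by (simp add: fmeasurable_def)
  also have "\<dots> \<le> (\<integral>x. indicator \<omega> x *\<^sub>R \<bar>g x\<bar> \<partial>lebesgue)"
    using El by (intro integral_mono intg integrable_mult_left integrable_real_indicator)
      (auto simp: fmeasurable_def indicator_def E_def g)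
  also have "\<dots> \<le> measure lebesgue \<omega> * \<eta>" using int ig by simp
  finally have "measure lebesgue (\<omega> - E) \<le> measure lebesgue \<omega> / 2" using \<eta> by (simp add: field_simps)
  moreover have "measure lebesgue (\<omega> - E) = measure lebesgue \<omega> - measure lebesgue E"
    using \<omega> by (intro measurable_measure_Diff) (auto simp: E_def[symmetric], auto simp: E_def)
  ultimately show "measure lebesgue \<omega> / 2 \<le> measure lebesgue {x \<in> \<omega>. \<bar>f x\<bar> \<le> 2 * \<eta>}"
    by (simp add: E_def)
  have "(\<integral>x. indicator \<omega> x *\<^sub>R \<bar>g x\<bar> \<partial>lebesgue) \<le> (\<integral>x. indicator \<omega> x * M \<partial>lebesgue)"
    using fin bd \<omega>(2) by (intro integral_mono intg integrable_mult_left integrable_real_indicator)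
      (auto simp: indicator_def g)
  also have "\<dots> = measure lebesgue \<omega> * M" using fin by simp
  finally show "(LINT x:\<omega>|lebesgue. \<bar>f x\<bar>) \<le> measure lebesgue \<omega> * M" using ig by simp
qed

section \<open>Interpolation of derivatives\<close>

lemma axis_increment:
  fixes \<Omega> :: "(real ^ 'n::finite) set"
  assumes f: "analytic_class \<Omega> \<rho> M f" and seg: "\<And>\<tau>. \<tau> \<in> closed_segment 0 t \<Longrightarrow> x + \<tau> *\<^sub>R axis i 1 \<in> \<Omega>"
  shows "\<bar>mi_deriv \<alpha> f (x + t *\<^sub>R axis i 1) - mi_deriv \<alpha> f x\<bar>
    \<le> M * fact (Suc (mi_size \<alpha>)) * (1 / \<rho>) ^ Suc (mi_size \<alpha>) * \<bar>t\<bar>"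
proof -
  have an: "real_analytic_on f \<Omega>" using f by (simp add: analytic_class_def)
  have "norm ((\<lambda>\<tau>. mi_deriv \<alpha> f (x + \<tau> *\<^sub>R axis i 1)) t - (\<lambda>\<tau>. mi_deriv \<alpha> f (x + \<tau> *\<^sub>R axis i 1)) 0)
      \<le> (M * fact (Suc (mi_size \<alpha>)) * (1 / \<rho>) ^ Suc (mi_size \<alpha>)) * norm (t - 0)"
  proof (rule field_differentiable_bound[where S = "closed_segment 0 t"])
    fix \<tau> assume \<tau>: "\<tau> \<in> closed_segment 0 t"
    show "((\<lambda>\<tau>. mi_deriv \<alpha> f (x + \<tau> *\<^sub>R axis i 1)) has_real_derivative
        mi_deriv (\<alpha>(i := Suc (\<alpha> i))) f (x + \<tau> *\<^sub>R axis i 1)) (at \<tau> within closed_segment 0 t)"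
      using mi_deriv_has_partial_deriv_line[OF an seg[OF \<tau>]] by (rule has_field_derivative_at_within)
    show "norm (mi_deriv (\<alpha>(i := Suc (\<alpha> i))) f (x + \<tau> *\<^sub>R axis i 1))
        \<le> M * fact (Suc (mi_size \<alpha>)) * (1 / \<rho>) ^ Suc (mi_size \<alpha>)"
      using f seg[OF \<tau>] unfolding analytic_class_def mi_size_Suc[symmetric, of \<alpha> i] real_norm_def by blast
  qed auto
  then show ?thesis by simp
qed

text \<open>Near the boundary there may be no room at \<open>x\<close> for a segment in direction
  \<open>i\<close>. Moving by \<open>s\<close> along the cone axis to \<open>z\<close> makes room
  for one of length \<open>\<kappa> * s\<close>, on which the mean value theorem finds a point with
  small derivative. The two axis-parallel moves back to \<open>x\<close> cost at most
  \<open>s * B\<close> each.\<close>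

lemma derivative_interpolation_step:
  fixes \<Omega> :: "(real ^ 'n::finite) set"
  assumes f: "analytic_class \<Omega> \<rho> M f" and cone: "axis_cone \<Omega> x j \<sigma> s0 \<kappa>" and \<sigma>: "\<bar>\<sigma>\<bar> = 1"
    and \<kappa>: "0 < \<kappa>" "\<kappa> \<le> 1" and s: "0 < s" "s \<le> s0" and x: "x \<in> \<Omega>" and \<rho>: "0 < \<rho>"
    and G: "\<And>y. y \<in> \<Omega> \<Longrightarrow> \<bar>mi_deriv \<alpha> f y\<bar> \<le> G"
  shows "\<bar>mi_deriv (\<alpha>(i := Suc (\<alpha> i))) f x\<bar>
    \<le> 2 * G / (\<kappa> * s) + 2 * s * (M * fact (mi_size \<alpha> + 2) * (1 / \<rho>) ^ (mi_size \<alpha> + 2))"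
proof -
  define \<beta> where "\<beta> = \<alpha>(i := Suc (\<alpha> i))"
  define B where "B = M * fact (mi_size \<alpha> + 2) * (1 / \<rho>) ^ (mi_size \<alpha> + 2)"
  have an: "real_analytic_on f \<Omega>" and M: "0 < M" using f by (simp_all add: analytic_class_def)
  have B0: "0 \<le> B" using M \<rho> by (simp add: B_def)
  have \<beta>: "mi_size \<beta> = Suc (mi_size \<alpha>)" by (simp add: \<beta>_def mi_size_Suc)
  have incr: "\<bar>mi_deriv \<beta> f (y + t *\<^sub>R axis l 1) - mi_deriv \<beta> f y\<bar> \<le> B * \<bar>t\<bar>"
    if "\<And>\<tau>. \<tau> \<in> closed_segment 0 t \<Longrightarrow> y + \<tau> *\<^sub>R axis l 1 \<in> \<Omega>" for y t l
    using axis_increment[OF f that, where \<alpha> = \<beta>] by (simp add: \<beta> B_def del: fact_Suc)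
  define z where "z = x + (\<sigma> * s) *\<^sub>R axis j 1"
  have "\<bar>mi_deriv \<beta> f z - mi_deriv \<beta> f x\<bar> \<le> B * \<bar>\<sigma> * s\<bar>"
    unfolding z_def
  proof (rule incr)
    fix \<tau> assume "\<tau> \<in> closed_segment 0 (\<sigma> * s)"
    then obtain u where u: "0 \<le> u" "u \<le> 1" "\<tau> = \<sigma> * (u * s)" by (auto simp: in_segment)
    show "x + \<tau> *\<^sub>R axis j 1 \<in> \<Omega>"
    proof (cases "u = 0")
      case False
      then have "0 < u * s" using u s by simp
      moreover have "u * s \<le> s0" using u s mult_right_mono[of u 1 s] by linarith
      ultimately have "x + (\<sigma> * (u * s)) *\<^sub>R axis j 1 + 0 \<in> \<Omega>"
        using cone \<kappa>(1) unfolding axis_cone_def by (metis less_imp_le mult_pos_pos norm_zero)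
      then show ?thesis using u by simp
    qed (use x u in simp)
  qed
  then have 1: "\<bar>mi_deriv \<beta> f z - mi_deriv \<beta> f x\<bar> \<le> B * s" using \<sigma> s by (simp add: abs_mult)
  \<comment> \<open>At height \<open>s\<close> the cone has radius \<open>\<kappa> * s\<close>,
    enough for a segment in any coordinate direction.\<close>
  have seg: "z + t *\<^sub>R axis i 1 \<in> \<Omega>" if "0 \<le> t" "t \<le> \<kappa> * s" for t
    using cone s that unfolding axis_cone_def z_def by (auto simp: norm_axis_real)
  have ks: "0 < \<kappa> * s" using \<kappa> s by simp
  have "\<exists>\<xi>. 0 < \<xi> \<and> \<xi> < \<kappa> * s \<and> mi_deriv \<alpha> f (z + (\<kappa> * s) *\<^sub>R axis i 1) - mi_deriv \<alpha> f (z + 0 *\<^sub>R axis i 1)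
      = (\<kappa> * s - 0) * mi_deriv \<beta> f (z + \<xi> *\<^sub>R axis i 1)"
    by (rule MVT2[OF ks]) (use mi_deriv_has_partial_deriv_line[OF an seg, of _ \<alpha>] in \<open>auto simp: \<beta>_def\<close>)
  then obtain \<xi> where \<xi>: "0 < \<xi>" "\<xi> < \<kappa> * s"
    and mvt: "mi_deriv \<alpha> f (z + (\<kappa> * s) *\<^sub>R axis i 1) - mi_deriv \<alpha> f z = (\<kappa> * s) * mi_deriv \<beta> f (z + \<xi> *\<^sub>R axis i 1)"
    by auto
  have "z \<in> \<Omega>" using seg[of 0] ks by simp
  then have "(\<kappa> * s) * \<bar>mi_deriv \<beta> f (z + \<xi> *\<^sub>R axis i 1)\<bar> \<le> 2 * G"
    using G[of z] G[OF seg[of "\<kappa> * s"]] ks arg_cong[OF mvt, of abs] by (simp add: abs_mult)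
  then have 2: "\<bar>mi_deriv \<beta> f (z + \<xi> *\<^sub>R axis i 1)\<bar> \<le> 2 * G / (\<kappa> * s)"
    using ks by (simp add: pos_le_divide_eq mult.commute)
  have "\<bar>mi_deriv \<beta> f (z + \<xi> *\<^sub>R axis i 1) - mi_deriv \<beta> f z\<bar> \<le> B * \<bar>\<xi>\<bar>"
    using \<xi> by (intro incr seg) (auto simp: closed_segment_eq_real_ivl)
  also have "\<dots> \<le> B * s"
    using \<xi> order_trans[OF less_imp_le[OF \<xi>(2)] mult_right_mono[OF \<kappa>(2), of s]] s B0 by (intro mult_left_mono) auto
  finally have 3: "\<bar>mi_deriv \<beta> f (z + \<xi> *\<^sub>R axis i 1) - mi_deriv \<beta> f z\<bar> \<le> B * s" .
  have "\<bar>mi_deriv \<beta> f x\<bar> \<le> 2 * G / (\<kappa> * s) + 2 * s * B" using 1 2 3 by (simp add: mult.commute)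
  then show ?thesis by (simp add: \<beta>_def B_def)
qed

text \<open>If the bound for one order is proportional to \<open>q * q\<close>, a step length
  proportional to \<open>q\<close> makes both terms of the interpolation step proportional to
  \<open>q\<close>; this halves the exponent. \<Lambda> does not depend on the order, so each
  derivative costs one factor \<Lambda> besides the growth of the factorial.\<close>

lemma derivative_interpolation:
  fixes \<Omega> :: "(real ^ 'n::finite) set"
  assumes f: "analytic_class \<Omega> \<rho> M f" and \<rho>: "0 < \<rho>"
    and cone: "\<And>x. x \<in> \<Omega> \<Longrightarrow> \<exists>j \<sigma>. \<bar>\<sigma>\<bar> = 1 \<and> axis_cone \<Omega> x j \<sigma> s0 \<kappa>"
    and \<kappa>: "0 < \<kappa>" "\<kappa> \<le> 1" and s0: "0 < s0" and \<delta>: "0 < \<delta>" "\<delta> \<le> 1" and \<theta>: "0 < \<theta>"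
    and base: "\<And>x. x \<in> \<Omega> \<Longrightarrow> \<bar>f x\<bar> \<le> M * (C * \<delta> powr \<theta>)"
    and \<Lambda>: "C \<le> \<Lambda>" "4 / (\<kappa> * s0) \<le> \<Lambda>" "2 * max 1 (4 * s0) / \<rho> \<le> \<Lambda>"
    and x: "x \<in> \<Omega>"
  shows "\<bar>mi_deriv \<alpha> f x\<bar> \<le> M * (fact (mi_size \<alpha>) * \<Lambda> ^ Suc (mi_size \<alpha>) * \<delta> powr (\<theta> / 2 ^ mi_size \<alpha>))"
proof -
  have M: "0 < M" using f by (simp add: analytic_class_def)
  have "0 < 2 * max 1 (4 * s0) / \<rho>" using \<rho> by simp
  then have \<Lambda>0: "0 < \<Lambda>" using \<Lambda> by linarith
  have "\<forall>x\<in>\<Omega>. \<bar>mi_deriv \<alpha> f x\<bar> \<le> M * (fact k * \<Lambda> ^ Suc k * \<delta> powr (\<theta> / 2 ^ k))" if "mi_size \<alpha> = k" for k \<alpha>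
    using that
  proof (induction k arbitrary: \<alpha>)
    case 0
    then have "\<alpha> = (\<lambda>_. 0)" by (auto simp: mi_size_def)
    show ?case
    proof
      fix x assume "x \<in> \<Omega>"
      then have "\<bar>f x\<bar> \<le> M * (C * \<delta> powr \<theta>)" by (rule base)
      also have "\<dots> \<le> M * (\<Lambda> * \<delta> powr \<theta>)" using M \<Lambda> by (intro mult_left_mono mult_right_mono) auto
      finally show "\<bar>mi_deriv \<alpha> f x\<bar> \<le> M * (fact 0 * \<Lambda> ^ Suc 0 * \<delta> powr (\<theta> / 2 ^ 0))"
        using \<open>\<alpha> = (\<lambda>_. 0)\<close> by (simp add: mi_deriv_0)
    qed
  next
    case (Suc k)
    then have "\<exists>i. \<alpha> i \<noteq> 0" by (metis mi_size_def nat.distinct(1) sum.neutral)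
    then obtain i where i: "\<alpha> i \<noteq> 0" by blast
    define \<alpha>' where "\<alpha>' = \<alpha>(i := \<alpha> i - 1)"
    have \<alpha>: "\<alpha> = \<alpha>'(i := Suc (\<alpha>' i))" using i by (auto simp: \<alpha>'_def)
    have "mi_size \<alpha> = Suc (mi_size \<alpha>')" by (subst \<alpha>) (rule mi_size_Suc)
    then have k: "mi_size \<alpha>' = k" using Suc.prems by simp
    define q where "q = \<delta> powr (\<theta> / 2 ^ Suc k)"
    have q: "0 < q" "q \<le> 1" using \<delta> \<theta> by (auto simp: q_def powr_le1)
    have q2: "\<delta> powr (\<theta> / 2 ^ k) = q * q"
      unfolding q_def powr_add[symmetric] by simp
    define G where "G = M * (fact k * \<Lambda> ^ Suc k * (q * q))"
    have G: "\<bar>mi_deriv \<alpha>' f y\<bar> \<le> G" if "y \<in> \<Omega>" for y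
      using Suc.IH[OF k] that unfolding G_def q2 by blast
    show ?case
    proof
      fix x assume x: "x \<in> \<Omega>"
      obtain j \<sigma> where c: "\<bar>\<sigma>\<bar> = 1" "axis_cone \<Omega> x j \<sigma> s0 \<kappa>" using cone[OF x] by blast
      define s where "s = s0 * q" \<comment> \<open>balances the two terms of the interpolation step\<close>
      have s: "0 < s" "s \<le> s0" using s0 q mult_left_mono[of q 1 s0] by (auto simp: s_def)
      have "\<bar>mi_deriv \<alpha> f x\<bar> \<le> 2 * G / (\<kappa> * s) + 2 * s * (M * fact (k + 2) * (1 / \<rho>) ^ (k + 2))"
        using derivative_interpolation_step[OF f c(2,1) \<kappa> s x \<rho> G, of i] unfolding k \<alpha>[symmetric] .
      \<comment> \<open>Each of the two terms is shown to be at most half of the claimed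
        bound.\<close>
      also have "2 * G / (\<kappa> * s) = (4 / (\<kappa> * s0)) * (M * fact k * \<Lambda> ^ Suc k * q / 2)"
        using q s0 \<kappa> by (simp add: G_def s_def field_simps)
      also have "\<dots> \<le> \<Lambda> * (M * fact k * \<Lambda> ^ Suc k * q / 2)"
        using M \<Lambda> \<Lambda>0 q by (intro mult_right_mono) auto
      also have "\<dots> \<le> M * fact (Suc k) * \<Lambda> ^ Suc (Suc k) * q / 2"
      proof -
        have "(fact k :: real) \<le> fact (Suc k)" by (rule fact_mono) simp
        then have "(M * \<Lambda> ^ Suc (Suc k) * q / 2) * fact k \<le> (M * \<Lambda> ^ Suc (Suc k) * q / 2) * fact (Suc k)"
          using M \<Lambda>0 q by (intro mult_left_mono) auto
        then show ?thesis by (simp add: mult_ac del: fact_Suc)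
      qed
      also have "2 * s * (M * fact (k + 2) * (1 / \<rho>) ^ (k + 2)) \<le> M * fact (Suc k) * \<Lambda> ^ Suc (Suc k) * q / 2"
      proof -
        \<comment> \<open>The factor \<open>k + 2\<close>, by which the factorial overshoots, is
          absorbed by \<open>2 ^ (k + 2)\<close>, and \<open>4 * s0\<close> by
          \<open>P ^ (k + 2)\<close>; this is the origin of the third condition on
          \<Lambda>.\<close>
        define P where "P = max 1 (4 * s0)"
        have P: "1 \<le> P" "4 * s0 \<le> P" by (auto simp: P_def)
        have "real (k + 2) \<le> 2 ^ (k + 2)" using of_nat_less_two_power[of "k + 2", where 'a = real] by linarith
        moreover have "4 * s0 \<le> P ^ (k + 2)" using order_trans[OF P(2) self_le_power[OF P(1), of "k + 2"]] by simp
        ultimately have "(4 * s0) * real (k + 2) \<le> P ^ (k + 2) * 2 ^ (k + 2)"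
          using s0 P by (intro mult_mono) auto
        then have "(4 * s0) * real (k + 2) * (1 / \<rho>) ^ (k + 2) \<le> (P ^ (k + 2) * 2 ^ (k + 2)) * (1 / \<rho>) ^ (k + 2)"
          using \<rho> by (intro mult_right_mono) auto
        also have "\<dots> = (2 * P / \<rho>) ^ (k + 2)" by (simp add: power_mult_distrib power_divide)
        also have "\<dots> \<le> \<Lambda> ^ (k + 2)" using \<Lambda>(3) P \<rho> by (intro power_mono) (auto simp: P_def)
        finally have "(4 * s0) * real (k + 2) * (1 / \<rho>) ^ (k + 2) \<le> \<Lambda> ^ (k + 2)" .
        then have "(M * fact (Suc k) * q / 2) * ((4 * s0) * real (k + 2) * (1 / \<rho>) ^ (k + 2))
            \<le> (M * fact (Suc k) * q / 2) * \<Lambda> ^ (k + 2)"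
          using M q by (intro mult_left_mono) auto
        moreover have "(fact (k + 2) :: real) = real (k + 2) * fact (Suc k)" by simp
        ultimately show ?thesis by (simp add: s_def mult_ac del: fact_Suc of_nat_add of_nat_Suc)
      qed
      finally show "\<bar>mi_deriv \<alpha> f x\<bar> \<le> M * (fact (Suc k) * \<Lambda> ^ Suc (Suc k) * \<delta> powr (\<theta> / 2 ^ Suc k))"
        by (simp add: q_def mult_ac del: fact_Suc)
    qed
  qed
  then show ?thesis using x by blast
qed

text \<open>Only the number \<open>m\<close> is available when the constants are chosen; \<omega>,
  \<open>f\<close> and \<open>M\<close> are quantified afterwards, which encodes the permitted
  dependence. The essential supremum is bounded through a bound at every point.\<close>

theorem lemma2:
  fixes \<Omega> :: "(real ^ 'n::finite) set" and \<rho> m :: real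
  assumes "open \<Omega>" and "connected \<Omega>" and "\<Omega> \<noteq> {}" and "bounded \<Omega>"
    and "analytic_boundary \<Omega>"
    and "0 < \<rho>" and "\<rho> \<le> 1"
    and "0 < m"
  shows "\<exists>N \<theta> :: real. 0 < N \<and> 0 < \<theta> \<and> \<theta> < 1 \<and>
    (\<forall>(\<omega> :: (real ^ 'n) set) (f :: real ^ 'n \<Rightarrow> real) (M :: real).
       \<omega> \<in> sets lebesgue \<longrightarrow> \<omega> \<subseteq> \<Omega> \<longrightarrow> measure lebesgue \<omega> = m \<longrightarrow>
       real_analytic_on f \<Omega> \<longrightarrow> 0 < M \<longrightarrow>
       (\<forall>\<alpha>. \<forall>x\<in>\<Omega>. \<bar>mi_deriv \<alpha> f x\<bar> \<le> M * fact (mi_size \<alpha>) * \<rho> powi (- int (mi_size \<alpha>))) \<longrightarrow>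
       (\<forall>\<alpha>. esssup (lebesgue_on \<Omega>) (\<lambda>x. ereal \<bar>mi_deriv \<alpha> f x\<bar>) \<le>
          ereal (fact (mi_size \<alpha>) * (\<rho> / N) powi (- int (mi_size \<alpha>) - 1)
            * M powr (1 - \<theta> / 2 ^ mi_size \<alpha>)
            * ((1 / measure lebesgue \<omega>) * (LINT x:\<omega>|lebesgue. \<bar>f x\<bar>)) powr (\<theta> / 2 ^ mi_size \<alpha>))))"
proof -
  obtain s0 \<kappa>0 where s0: "0 < s0" "0 < \<kappa>0"
    and cone0: "\<And>x. x \<in> \<Omega> \<Longrightarrow> \<exists>j \<sigma>. \<bar>\<sigma>\<bar> = 1 \<and> axis_cone \<Omega> x j \<sigma> s0 \<kappa>0"
    using uniform_axis_cone[OF assms(5,1,4)] by blast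
  define \<kappa> where "\<kappa> = min 1 \<kappa>0"
  have \<kappa>: "0 < \<kappa>" "\<kappa> \<le> 1" "\<kappa> \<le> \<kappa>0" using s0 by (auto simp: \<kappa>_def)
  have cone: "\<exists>j \<sigma>. \<bar>\<sigma>\<bar> = 1 \<and> axis_cone \<Omega> x j \<sigma> s0 \<kappa>" if "x \<in> \<Omega>" for x
    using cone0[OF that] axis_cone_mono[OF _ order_refl \<kappa>(3)] by blast
  \<comment> \<open>\<open>m / 2\<close> is what Chebyshev's inequality leaves of \<omega>.\<close>
  obtain C \<theta> where C: "1 \<le> C" "0 < \<theta>" "\<theta> < 1"
    and propE: "\<And>E. E \<in> sets lebesgue \<Longrightarrow> E \<subseteq> \<Omega> \<Longrightarrow> m / 2 \<le> measure lebesgue E \<Longrightarrow> propagates \<Omega> \<rho> C \<theta> E \<Omega>"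
    using measurable_set_propagates[OF assms(1,2,4,5,6), of "m / 2"] assms(8) by (metis half_gt_zero)
  \<comment> \<open>\<open>2 * C\<close> replaces \<open>C\<close> because smallness will hold with
    \<open>2 * \<delta>\<close>, and \<open>2 powr \<theta> \<le> 2\<close>.\<close>
  define \<Lambda> where "\<Lambda> = max (2 * C) (max (4 / (\<kappa> * s0)) (2 * max 1 (4 * s0) / \<rho>))"
  have \<Lambda>: "2 * C \<le> \<Lambda>" "4 / (\<kappa> * s0) \<le> \<Lambda>" "2 * max 1 (4 * s0) / \<rho> \<le> \<Lambda>" by (auto simp: \<Lambda>_def)
  then have \<Lambda>0: "0 < \<Lambda>" using C by linarith
  \<comment> \<open>The witness \<open>N = \<rho> * \<Lambda>\<close> turns
    \<open>\<rho> / N\<close> into \<open>1 / \<Lambda>\<close>.\<close>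
  have main: "esssup (lebesgue_on \<Omega>) (\<lambda>x. ereal \<bar>mi_deriv \<alpha> f x\<bar>) \<le>
      ereal (fact (mi_size \<alpha>) * (\<rho> / (\<rho> * \<Lambda>)) powi (- int (mi_size \<alpha>) - 1)
        * M powr (1 - \<theta> / 2 ^ mi_size \<alpha>)
        * ((1 / measure lebesgue \<omega>) * (LINT x:\<omega>|lebesgue. \<bar>f x\<bar>)) powr (\<theta> / 2 ^ mi_size \<alpha>))"
    if \<omega>: "\<omega> \<in> sets lebesgue" "\<omega> \<subseteq> \<Omega>" "measure lebesgue \<omega> = m" and an: "real_analytic_on f \<Omega>" and M: "0 < M"
      and bnd: "\<forall>\<alpha>. \<forall>x\<in>\<Omega>. \<bar>mi_deriv \<alpha> f x\<bar> \<le> M * fact (mi_size \<alpha>) * \<rho> powi (- int (mi_size \<alpha>))"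
    for \<omega> f M \<alpha>
  proof -
    define k where "k = mi_size \<alpha>"
    have f: "analytic_class \<Omega> \<rho> M f"
      using an M bnd unfolding analytic_class_def by (simp add: power_int_minus power_one_over inverse_eq_divide)
    have \<omega>m: "\<omega> \<in> lmeasurable" using \<omega> assms(4) bounded_subset by (blast intro: bounded_set_imp_lmeasurable)
    define A where "A = (1 / measure lebesgue \<omega>) * (LINT x:\<omega>|lebesgue. \<bar>f x\<bar>)"
    have A: "(LINT x:\<omega>|lebesgue. \<bar>f x\<bar>) = m * A" using \<omega> assms(8) by (simp add: A_def)
    have A0: "0 \<le> A"
      unfolding A_def set_lebesgue_integral_def by (intro mult_nonneg_nonneg integral_nonneg_AE) auto
    note sub = measure_sublevel_ge[OF assms(1) real_analytic_on_continuous_on[OF an] analytic_class_bound[OF f] \<omega>m \<omega>(2)]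
    \<comment> \<open>\<delta> is any number with \<open>A \<le> M * \<delta>\<close> rather than
      \<open>A / M\<close> itself, since it must be positive and the mean \<open>A\<close> may
      vanish.\<close>
    have bound: "\<bar>mi_deriv \<alpha> f x\<bar> \<le> M * (fact k * \<Lambda> ^ Suc k * \<delta> powr (\<theta> / 2 ^ k))"
      if x: "x \<in> \<Omega>" and \<delta>: "0 < \<delta>" "\<delta> \<le> 1" "A \<le> M * \<delta>" for x \<delta>
    proof -
      have int: "(LINT x:\<omega>|lebesgue. \<bar>f x\<bar>) \<le> measure lebesgue \<omega> * (M * \<delta>)"
        unfolding A \<omega>(3) using \<delta> assms(8) by (intro mult_left_mono) auto
      have pos: "0 < M * \<delta>" using M \<delta> by simp
      define E where "E = {x \<in> \<omega>. \<bar>f x\<bar> \<le> 2 * (M * \<delta>)}"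
      have "propagates \<Omega> \<rho> C \<theta> E \<Omega>"
        using sub(1,2)[OF _ pos int] \<omega> unfolding E_def by (intro propE) auto
      moreover have "\<forall>x\<in>E. \<bar>f x\<bar> \<le> M * (2 * \<delta>)" by (auto simp: E_def)
      ultimately have fb: "\<forall>y\<in>\<Omega>. \<bar>f y\<bar> \<le> M * (C * (2 * \<delta>) powr \<theta>)"
        using f \<delta> unfolding propagates_def by (meson mult_pos_pos zero_less_numeral)
      have two: "2 powr \<theta> \<le> 2 powr 1" using C by (intro powr_mono) auto
      have "C * (2 * \<delta>) powr \<theta> \<le> (2 * C) * \<delta> powr \<theta>"
      proof -
        have "C * (2 * \<delta>) powr \<theta> = (C * \<delta> powr \<theta>) * 2 powr \<theta>" using \<delta> by (simp add: powr_mult)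
        also have "\<dots> \<le> (C * \<delta> powr \<theta>) * 2" using C two by (intro mult_left_mono) auto
        finally show ?thesis by (simp add: mult_ac)
      qed
      then have "\<bar>f y\<bar> \<le> M * ((2 * C) * \<delta> powr \<theta>)" if "y \<in> \<Omega>" for y
        using fb that M mult_left_mono[of _ _ M] by (meson less_imp_le order_trans)
      from derivative_interpolation[OF f assms(6) cone \<kappa>(1,2) s0(1) \<delta>(1,2) C(2) this \<Lambda> x]
      show ?thesis by (simp add: k_def)
    qed
    have "\<bar>mi_deriv \<alpha> f x\<bar> \<le> fact k * \<Lambda> ^ Suc k * (M powr (1 - \<theta> / 2 ^ k) * A powr (\<theta> / 2 ^ k))"
      if x: "x \<in> \<Omega>" for x
    proof (cases "A = 0")
      \<comment> \<open>If the mean is zero, every \<delta> in (0, 1] is admissible, and the bound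
        tends to 0 with \<delta>.\<close>
      case True
      define c where "c = M * (fact k * \<Lambda> ^ Suc k)"
      have "((\<lambda>\<delta>. c * \<delta> powr (\<theta> / 2 ^ k)) \<longlongrightarrow> c * 0 powr (\<theta> / 2 ^ k)) (at_right 0)"
        using C by (intro tendsto_intros tendsto_powr2) (auto simp: eventually_at_filter)
      moreover have "\<forall>\<^sub>F \<delta> in at_right 0. \<bar>mi_deriv \<alpha> f x\<bar> \<le> c * \<delta> powr (\<theta> / 2 ^ k)"
      proof -
        have "\<bar>mi_deriv \<alpha> f x\<bar> \<le> c * \<delta> powr (\<theta> / 2 ^ k)" if "0 < \<delta>" "\<delta> \<le> 1" for \<delta>
          using bound[OF x that] True M that by (simp add: c_def mult_ac)
        then show ?thesis unfolding eventually_at_right_field by (intro exI[of _ 1]) auto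
      qed
      ultimately have "\<bar>mi_deriv \<alpha> f x\<bar> \<le> c * 0 powr (\<theta> / 2 ^ k)"
        by (rule tendsto_lowerbound) simp
      then show ?thesis using True by simp
    next
      case False
      \<comment> \<open>Ensures \<open>A / M \<le> 1\<close>, so that this quotient is an admissible
        \<delta>.\<close>
      have "m * A \<le> m * M"
      proof -
        have "0 < A" using False A0 by simp
        then show ?thesis using sub(3)[of A] A \<omega>(3) by simp
      qed
      then have AM: "A \<le> M" using assms(8) by simp
      have "\<bar>mi_deriv \<alpha> f x\<bar> \<le> M * (fact k * \<Lambda> ^ Suc k * (A / M) powr (\<theta> / 2 ^ k))"
        using False A0 AM M by (intro bound[OF x]) auto
      also have "M * (A / M) powr (\<theta> / 2 ^ k) = M powr (1 - \<theta> / 2 ^ k) * A powr (\<theta> / 2 ^ k)"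
        using M A0 by (simp add: powr_divide powr_diff)
      then have "M * (fact k * \<Lambda> ^ Suc k * (A / M) powr (\<theta> / 2 ^ k))
          = fact k * \<Lambda> ^ Suc k * (M powr (1 - \<theta> / 2 ^ k) * A powr (\<theta> / 2 ^ k))"
        by (metis mult.left_commute)
      finally show ?thesis .
    qed
    moreover have "(\<rho> / (\<rho> * \<Lambda>)) powi (- int k - 1) = \<Lambda> ^ Suc k"
    proof -
      have "- int k - 1 = - int (Suc k)" by simp
      then have "(\<rho> / (\<rho> * \<Lambda>)) powi (- int k - 1) = inverse ((1 / \<Lambda>) ^ Suc k)"
        using assms(6) by (simp only: power_int_minus power_int_of_nat) simp
      then show ?thesis by (simp add: power_one_over inverse_eq_divide)
    qed
    moreover have "(\<lambda>x. ereal \<bar>mi_deriv \<alpha> f x\<bar>) \<in> borel_measurable (lebesgue_on \<Omega>)"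
    proof -
      have "mi_deriv \<alpha> f \<in> borel_measurable (lebesgue_on \<Omega>)"
        using assms(1) by (intro continuous_imp_measurable_on_sets_lebesgue real_analytic_on_continuous_on
            real_analytic_on_mi_deriv an) auto
      then show ?thesis by measurable
    qed
    ultimately show ?thesis
      unfolding k_def[symmetric] A_def[symmetric]
      by (intro esssup_I AE_I2) (auto simp: space_restrict_space mult.assoc)
  qed
  show ?thesis
    by (rule exI[of _ "\<rho> * \<Lambda>"], rule exI[of _ \<theta>]) (use C \<Lambda>0 assms(6) main in auto)
qed

end
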